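(* There is $\varepsilon_0>0$ such that for every $\varepsilon\in(0,\varepsilon_0)$ there exists a constant $C<\infty$ (depending only on $\varepsilon$ and the kernel $\Phi$) with the following property. Let $\zeta, \tau_1, Y_2, Y_3, u$ be smooth real functions on $\mathbb{R}\times\mathbb{R}^3$ and $C_1,C_2\in\mathbb{R}$. Put $\tau_2:=\tau_1^2-C_1$ and $\tau_3:=\tau_1^3-3C_1\tau_1$. Assume that pointwise on $P$ $$(\partial_t-\Delta)\tau_1=\zeta,\qquad (\partial_t-\Delta)Y_2=\tau_2,\qquad (\partial_t-\Delta)Y_3=\tau_3,$$ $$(\partial_t-\Delta)u=-u^3+\zeta+(3C_1-9C_2)u ,$$ and set $v:=u-\tau_1$ (so that $(\partial_t-\Delta)v=-v^3-3v^2\tau_1-3v\tau_2-\tau_3-9C_2(v+\tau_1)$ on $P$). Define the nine quantities $Q_1=[\tau_1]_{-\frac12-\varepsilon}$, $Q_2=[\tau_2]_{-1-2\varepsilon}$, $Q_3=[\tau_3]_{-\frac32-3\varepsilon}$, $Q_4=[Y_2]_{1-2\varepsilon}$, $Q_5=[Y_3]_{\frac12-3\varepsilon}$, $$Q_6=\sup_{x\in P}\sup_{T<1}T^{2\varepsilon}\Big|\int X(y-x)\,\tau_2(y)\,\Psi_T(x-y)\,dy\Big|,$$ $$Q_7=\sup_{x\in P}\sup_{T<1}T^{4\varepsilon}\Big|\int \big(Y_2(y)\tau_2(y)-C_2-Y_2(x)\tau_2(y)\big)\Psi_T(x-y)\,dy\Big|,$$ $$Q_8=\sup_{x\in P}\sup_{T<1}T^{4\varepsilon}\Big|\int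 \big(Y_3(y)\tau_1(y)-Y_3(x)\tau_1(y)\big)\Psi_T(x-y)\,dy\Big|,$$ $$Q_9=\sup_{x\in P}\sup_{T<1}T^{\frac12+5\varepsilon}\Big|\int \big(Y_3(y)\tau_2(y)-3C_2\tau_1(y)-Y_3(x)\tau_2(y)\big)\Psi_T(x-y)\,dy\Big|,$$ with associated integers $(n_1,\dots,n_9)=(1,2,3,2,3,2,4,4,5)$. Then for every $R\in(0,1)$, $$\|v\|_{P_R}\le C\max\Big\{\frac1R,\;Q_i^{\frac{1}{n_i(\frac12-\varepsilon)}},\ i=1,\dots,9\Big\}.$$
   Context: Space-time points are $z=(t,x)\in\mathbb{R}\times\mathbb{R}^3$; $|x|$ is the supremum norm on $\mathbb{R}^3$, $X(z)=x$ is the spatial projection, and the parabolic metric is $d((t,x),(\bar t,\bar x))=\max\{\sqrt{|t-\bar t|},|x-\bar x|\}$. The past parabolic ball is $B(z,R)=\{\bar z=(\bar t,\bar x): d(z,\bar z)<R,\ \bar t<t\}$. $P=(0,1)\times(-1,1)^3$ and $P_R=(R^2,1)\times\{x:|x|<1-R\}$. $\|f\|_B=\sup_B|f|$. Kernel: fix a smooth $\Phi\ge0$ with values in $[0,1]$, integral $1$, symmetric under $x\mapsto -x$, supported in $\{(t,x):0<t<1,|x|<1\}$ (so that convolution at $z$ only sees $B(z,\cdot)$). Set $\Phi_T(t,x)=T^{-5}\Phi(t/T^2,x/T)$, $\Psi_{T,n}=\Phi_{T2^{-1}}*\Phi_{T2^{-2}}*\cdots*\Phi_{T2^{-n}}$,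 $\Psi_T=\lim_{n\to\infty}\Psi_{T,n}$, and $(f)_T(z)=\int\Psi_T(z-w)f(w)\,dw$. Norms: for $\alpha<0$, $[\theta]_\alpha=\sup_{z\in P}\sup_{T\le1}T^{-\alpha}|(\theta)_T(z)|$; for $\alpha\in(0,1)$, $[f]_\alpha=\sup_{z\neq\bar z}|f(z)-f(\bar z)|/d(z,\bar z)^\alpha$; for $\alpha\in(1,2)$, $[f]_\alpha=\sup_{z\ne\bar z}|f(\bar z)-f(z)-\nabla f(z)\cdot(\bar x-x)|/d(z,\bar z)^\alpha$ ($\nabla$ the spatial gradient), suprema over $\mathbb{R}\times\mathbb{R}^3$. *)

theory Defs
  imports "HOL-Analysis.Analysis"
begin

type_synonym pt = "real \<times> (real^3)"

definition pdist :: "pt \<Rightarrow> pt \<Rightarrow> real" where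
  "pdist z w = max (sqrt \<bar>fst z - fst w\<bar>) (infnorm (snd z - snd w))"

coinductive smooth :: "('a::euclidean_space \<Rightarrow> real) \<Rightarrow> bool" where
  "(\<And>z. f differentiable (at z)) \<Longrightarrow>
   (\<And>b. b \<in> Basis \<Longrightarrow> smooth (\<lambda>z. frechet_derivative f (at z) b)) \<Longrightarrow> smooth f"

definition dt :: "(pt \<Rightarrow> real) \<Rightarrow> pt \<Rightarrow> real" where
  "dt f z = frechet_derivative f (at z) (1, 0)"

definition dx :: "3 \<Rightarrow> (pt \<Rightarrow> real) \<Rightarrow> pt \<Rightarrow> real" where
  "dx i f z = frechet_derivative f (at z) (0, axis i 1)"

definition lap :: "(pt \<Rightarrow> real) \<Rightarrow> pt \<Rightarrow> real" where
  "lap f z = (\<Sum>i\<in>UNIV. dx i (dx i f) z)"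

definition heat :: "(pt \<Rightarrow> real) \<Rightarrow> pt \<Rightarrow> real" where
  "heat f z = dt f z - lap f z"

definition Pset :: "pt set" where
  "Pset = {(t, x). 0 < t \<and> t < 1 \<and> infnorm x < 1}"

definition PRset :: "real \<Rightarrow> pt set" where
  "PRset R = {(t, x). R\<^sup>2 < t \<and> t < 1 \<and> infnorm x < 1 - R}"

definition kernel :: "(pt \<Rightarrow> real) \<Rightarrow> bool" where
  "kernel \<Phi> \<longleftrightarrow> smooth \<Phi> \<and> (\<forall>z. 0 \<le> \<Phi> z \<and> \<Phi> z \<le> 1) \<and> (\<Phi> has_integral 1) UNIV
     \<and> (\<forall>t x. \<Phi> (t, - x) = \<Phi> (t, x))
     \<and> closure {z. \<Phi> z \<noteq> 0} \<subseteq> {(t, x). 0 < t \<and> t < 1 \<and> infnorm x < 1}"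

definition conv :: "(pt \<Rightarrow> real) \<Rightarrow> (pt \<Rightarrow> real) \<Rightarrow> pt \<Rightarrow> real" where
  "conv f g z = integral UNIV (\<lambda>w. f (z - w) * g w)"

definition PhiT :: "(pt \<Rightarrow> real) \<Rightarrow> real \<Rightarrow> pt \<Rightarrow> real" where
  "PhiT \<Phi> T z = T powr (-5) * \<Phi> (fst z / T\<^sup>2, (1 / T) *\<^sub>R snd z)"

text \<open>PsiTn Phi T n = Psi_{T,n+1} = Phi_{T/2} * ... * Phi_{T/2^(n+1)}.\<close>
primrec PsiTn :: "(pt \<Rightarrow> real) \<Rightarrow> real \<Rightarrow> nat \<Rightarrow> pt \<Rightarrow> real" where
  "PsiTn \<Phi> T 0 = PhiT \<Phi> (T / 2)"
| "PsiTn \<Phi> T (Suc n) = conv (PsiTn \<Phi> T n) (PhiT \<Phi> (T / 2 ^ (n + 2)))"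

definition PsiT :: "(pt \<Rightarrow> real) \<Rightarrow> real \<Rightarrow> pt \<Rightarrow> real" where
  "PsiT \<Phi> T z = lim (\<lambda>n. PsiTn \<Phi> T n z)"

definition mollify :: "(pt \<Rightarrow> real) \<Rightarrow> real \<Rightarrow> (pt \<Rightarrow> real) \<Rightarrow> pt \<Rightarrow> real" where
  "mollify \<Phi> T f z = conv (PsiT \<Phi> T) f z"

definition negnorm :: "(pt \<Rightarrow> real) \<Rightarrow> real \<Rightarrow> (pt \<Rightarrow> real) \<Rightarrow> ereal" where
  "negnorm \<Phi> \<alpha> \<theta> = (SUP z\<in>Pset. SUP T\<in>{0<..1}. ereal (T powr (-\<alpha>) * \<bar>mollify \<Phi> T \<theta> z\<bar>))"

definition hoelder :: "real \<Rightarrow> (pt \<Rightarrow> real) \<Rightarrow> ereal" where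
  "hoelder \<alpha> f = (SUP p\<in>{(z, w). z \<noteq> w}. ereal (\<bar>f (fst p) - f (snd p)\<bar> / pdist (fst p) (snd p) powr \<alpha>))"

definition wsup :: "(pt \<Rightarrow> real) \<Rightarrow> real \<Rightarrow> (pt \<Rightarrow> pt \<Rightarrow> real) \<Rightarrow> ereal" where
  "wsup \<Phi> a F = (SUP x\<in>Pset. SUP T\<in>{0<..<1}.
      ereal (T powr a * \<bar>integral UNIV (\<lambda>y. F x y * PsiT \<Phi> T (x - y))\<bar>))"

definition wsupX :: "(pt \<Rightarrow> real) \<Rightarrow> real \<Rightarrow> (pt \<Rightarrow> real) \<Rightarrow> ereal" where
  "wsupX \<Phi> a g = (SUP x\<in>Pset. SUP T\<in>{0<..<1}.
      ereal (T powr a * infnorm (integral UNIV (\<lambda>y. (g y * PsiT \<Phi> T (x - y)) *\<^sub>R snd (y - x)))))"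

text \<open>Power on nonnegative extended reals (infinity stays infinity).\<close>
definition epow :: "ereal \<Rightarrow> real \<Rightarrow> ereal" where
  "epow q a = (case q of ereal r \<Rightarrow> ereal (r powr a) | PInfty \<Rightarrow> \<infinity> | MInfty \<Rightarrow> 0)"

end

theory Submission
  imports Defs
begin

text \<open>Let $d$ be the parabolic distance to the past boundary of $P$ and let $p$ maximise $|v| \min(d, R)$; put
  $M = |v(p)|$. On the past ball of radius of order $1/M$ at $p$ one has $|v| \<le> 2M$, and if $M$ exceeds
  a large multiple of the claimed bound, then after parabolic rescaling by $1/M$ every noise quantity is
  small. So it suffices to show: small noise and $|v| \<le> 2$ on a large past ball imply $|v| < 1$ at its
  centre.

  Locally $v(y) = v(z) - (Y_3(y) - Y_3(z)) - 3 v(z) (Y_2(y) - Y_2(z)) + \<nu>(z) \<cdot> (y - z) + O(d^{5/4})$. The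
  remainder is bounded by a Campanato iteration: reconstruction controls the mollified right hand side
  at each scale, linearly in the remainder and with a small factor from the noise, and the interior
  regularity of the heat equation comes from the maximum principle alone. The smallness lets the
  remainder be absorbed.

  Finally the mollification $v_T$ solves $(\<partial>_t - \<Delta>) v_T = - v_T^3 + \mathrm{small}$, and comparison with
  $1/2 + b (|x|^2 - t)$ gives $|v_T| \<le> 1/2$ at the centre.\<close>

section \<open>Parabolic geometry\<close>

declare split_paired_All [simp del] split_paired_Ex [simp del]

definition tdir :: pt where "tdir = (1, 0)"
definition xdir :: "3 \<Rightarrow> pt" where "xdir i = (0, axis i 1)"

lemma fst_tdir [simp]: "fst tdir = 1" and snd_tdir [simp]: "snd tdir = 0"
  and fst_xdir [simp]: "fst (xdir i) = 0" and snd_xdir [simp]: "snd (xdir i) = axis i 1"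
  by (simp_all add: tdir_def xdir_def)

lemma infnorm_le_iff_cart: "infnorm (x::real^'n) \<le> r \<longleftrightarrow> (\<forall>i. \<bar>x $ i\<bar> \<le> r)"
  by (auto simp: infnorm_Max Basis_vec_def inner_axis)

lemma infnorm_axis [simp]: "infnorm (axis i 1 :: real^'n) = 1"
  using component_le_infnorm_cart[of "axis i 1 :: real^'n" i]
    infnorm_le_norm[of "axis i 1 :: real^'n"]
  by simp

lemma pdist_nonneg [simp]: "0 \<le> pdist y z"
  by (simp add: pdist_def infnorm_pos_le le_max_iff_disj)

lemma pdist_self [simp]: "pdist z z = 0"
  by (simp add: pdist_def infnorm_0)

lemma pdist_pos: "y \<noteq> z \<Longrightarrow> 0 < pdist y z"
  by (auto simp: pdist_def prod_eq_iff less_max_iff_disj infnorm_pos_lt)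

lemma pdist_triangle: "pdist x z \<le> pdist x y + pdist y z"
proof -
  have "sqrt \<bar>fst x - fst z\<bar> \<le> sqrt (\<bar>fst x - fst y\<bar> + \<bar>fst y - fst z\<bar>)" by simp
  also have "\<dots> \<le> sqrt \<bar>fst x - fst y\<bar> + sqrt \<bar>fst y - fst z\<bar>" by (simp add: sqrt_add_le_add_sqrt)
  finally have "sqrt \<bar>fst x - fst z\<bar> \<le> sqrt \<bar>fst x - fst y\<bar> + sqrt \<bar>fst y - fst z\<bar>" .
  moreover have "infnorm (snd x - snd z) \<le> infnorm (snd x - snd y) + infnorm (snd y - snd z)"
    using infnorm_triangle[of "snd x - snd y" "snd y - snd z"] by simp
  ultimately show ?thesis unfolding pdist_def by linarith
qed

lemma pdist_le_iff:
  "0 \<le> r \<Longrightarrow> pdist y z \<le> r \<longleftrightarrow> \<bar>fst y - fst z\<bar> \<le> r\<^sup>2 \<and> infnorm (snd y - snd z) \<le> r"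
  by (auto simp: pdist_def sqrt_le_D real_le_lsqrt)

lemma pdist_translate [simp]: "pdist (w + y) (w + z) = pdist y z"
  by (simp add: pdist_def)

lemma component_le_pdist: "\<bar>snd (y - z) $ i\<bar> \<le> pdist y z"
  using component_le_infnorm_cart[of "snd (y - z)" i] by (auto simp: pdist_def le_max_iff_disj)

lemma pdist_xdir [simp]: "pdist (z + s *\<^sub>R xdir i) z = \<bar>s\<bar>"
  by (simp add: pdist_def infnorm_mul)

definition past_cball :: "pt \<Rightarrow> real \<Rightarrow> pt set" where
  "past_cball z r = {y. fst y \<le> fst z \<and> pdist y z \<le> r}"

lemma mem_past_cball: "y \<in> past_cball z r \<longleftrightarrow> fst y \<le> fst z \<and> pdist y z \<le> r"
  by (simp add: past_cball_def)

lemma mem_past_cball_iff_box: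
  "y \<in> past_cball z r \<longleftrightarrow>
    0 \<le> r \<and> fst z - r\<^sup>2 \<le> fst y \<and> fst y \<le> fst z \<and> infnorm (snd y - snd z) \<le> r"
  using pdist_le_iff[of r y z] order_trans[OF pdist_nonneg, of y z r]
    infnorm_pos_le[of "snd y - snd z"]
  by (auto simp: mem_past_cball abs_le_iff)

lemma center_in_past_cball [simp]: "z \<in> past_cball z r \<longleftrightarrow> 0 \<le> r"
  by (simp add: mem_past_cball)

lemma past_cball_mono: "y \<in> past_cball z r \<Longrightarrow> r \<le> s \<Longrightarrow> y \<in> past_cball z s"
  by (simp add: mem_past_cball)

lemma past_cball_trans:
  "x \<in> past_cball y r \<Longrightarrow> y \<in> past_cball z s \<Longrightarrow> r + s \<le> q \<Longrightarrow> x \<in> past_cball z q"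
  using pdist_triangle[of x z y] by (auto simp: mem_past_cball)

lemma past_cball_eq_cbox:
  assumes "0 \<le> r"
  shows "past_cball z r = cbox (fst z - r\<^sup>2, snd z - (\<chi> i. r)) (fst z, snd z + (\<chi> i. r))"
  using assms
  by (auto simp: mem_past_cball_iff_box cbox_Pair_eq mem_box_cart infnorm_le_iff_cart abs_le_iff
      algebra_simps)

lemma compact_past_cball: "compact (past_cball z r)"
proof (cases "0 \<le> r")
  case False
  then have "past_cball z r = {}" by (auto simp: mem_past_cball_iff_box)
  then show ?thesis by simp
qed (simp add: past_cball_eq_cbox)

lemma measure_past_cball: "0 \<le> r \<Longrightarrow> measure lborel (past_cball z r) = 8 * r ^ 5"
proof -
  assume r: "0 \<le> r"
  have "cbox (snd z - (\<chi> i. r)) (snd z + (\<chi> i. r)) \<noteq> {}"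
    using r by (simp add: interval_ne_empty_cart)
  then show ?thesis
    using r by (simp add: past_cball_eq_cbox content_Pair content_cbox_cart power2_eq_square
        eval_nat_numeral)
qed

lemma add_xdir_in_past_cball:
  "y \<in> past_cball z r \<Longrightarrow> r + \<bar>s\<bar> \<le> q \<Longrightarrow> y + s *\<^sub>R xdir i \<in> past_cball z q"
  by (rule past_cball_trans[of _ y "\<bar>s\<bar>"]) (auto simp: mem_past_cball)

lemma past_cball_translate: "w + y \<in> past_cball (w + z) r \<longleftrightarrow> y \<in> past_cball z r"
  by (simp add: mem_past_cball)

lemma diff_in_past_cball_0: "y - z \<in> past_cball 0 r \<longleftrightarrow> y \<in> past_cball z r"
  using past_cball_translate[of z "y - z" 0 r] by simp

lemma sum_mult_xdir: "(\<Sum>j\<in>UNIV. a j * snd (s *\<^sub>R xdir i) $ j) = a i * s"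
  by (simp add: axis_def if_distrib cong: if_cong)

lemma abs_sum_mult_le:
  fixes a b :: "'i::finite \<Rightarrow> real"
  assumes "\<And>i. \<bar>a i\<bar> \<le> A" "\<And>i. \<bar>b i\<bar> \<le> B"
  shows "\<bar>\<Sum>i\<in>UNIV. a i * b i\<bar> \<le> real CARD('i) * (A * B)"
proof -
  have "0 \<le> A" by (rule order_trans[OF abs_ge_zero assms(1)])
  then have "\<bar>\<Sum>i\<in>UNIV. a i * b i\<bar> \<le> (\<Sum>i\<in>(UNIV::'i set). A * B)"
    by (intro order_trans[OF sum_abs] sum_mono) (auto simp: abs_mult intro!: mult_mono assms)
  then show ?thesis by simp
qed

text \<open>Parabolic scaling gives time the weight 2; the dilation has Jacobian \<open>r^5\<close>.\<close>

definition dil :: "real \<Rightarrow> pt \<Rightarrow> pt" where "dil r y = (r\<^sup>2 * fst y, r *\<^sub>R snd y)"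

lemma dil_dil [simp]: "dil r (dil s z) = dil (r * s) z"
  by (simp add: dil_def power_mult_distrib)

lemma dil_1 [simp]: "dil 1 z = z" and dil_0 [simp]: "dil r 0 = 0"
  by (simp_all add: dil_def prod_eq_iff)

lemma dil_add: "dil r (x + y) = dil r x + dil r y"
  and dil_diff: "dil r (x - y) = dil r x - dil r y"
  by (simp_all add: dil_def prod_eq_iff algebra_simps)

lemma dil_tdir: "dil r (s *\<^sub>R tdir) = (r\<^sup>2 * s) *\<^sub>R tdir"
  and dil_xdir: "dil r (s *\<^sub>R xdir i) = (r * s) *\<^sub>R xdir i"
  by (simp_all add: dil_def prod_eq_iff)

lemma continuous_on_dil [continuous_intros]:
  "continuous_on S f \<Longrightarrow> continuous_on S (\<lambda>z. dil r (f z))"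
  unfolding dil_def by (intro continuous_intros)

lemma pdist_dil:
  assumes "0 \<le> r" shows "pdist (dil r y) (dil r z) = r * pdist y z"
proof -
  have "sqrt \<bar>r\<^sup>2 * fst y - r\<^sup>2 * fst z\<bar> = r * sqrt \<bar>fst y - fst z\<bar>"
    using assms by (simp add: abs_mult real_sqrt_mult flip: right_diff_distrib)
  moreover have "infnorm (r *\<^sub>R snd y - r *\<^sub>R snd z) = r * infnorm (snd y - snd z)"
    using assms by (simp add: infnorm_mul flip: scaleR_right_diff_distrib)
  ultimately show ?thesis using assms by (simp add: pdist_def dil_def max_mult_distrib_left)
qed

lemma dil_in_past_cball: "0 < r \<Longrightarrow> dil r y \<in> past_cball (dil r z) (r * s) \<longleftrightarrow> y \<in> past_cball z s"
  by (simp add: mem_past_cball pdist_dil) (simp add: dil_def)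

lemma blow_up_in_past_cball: "0 < r \<Longrightarrow> p + dil r y \<in> past_cball p (r * s) \<longleftrightarrow> y \<in> past_cball 0 s"
  using past_cball_translate[of p "dil r y" 0 "r * s"] dil_in_past_cball[of r y 0 s] by simp

lemma norm_le_of_past_cball:
  assumes "y \<in> past_cball 0 s" shows "norm y \<le> s\<^sup>2 + 2 * s"
proof -
  have y: "0 \<le> s" "\<bar>fst y\<bar> \<le> s\<^sup>2" "infnorm (snd y) \<le> s"
    using assms by (auto simp: mem_past_cball_iff_box)
  have "norm y \<le> norm (fst y) + norm (snd y)" by (metis norm_Pair_le prod.collapse)
  moreover have "norm (snd y) \<le> sqrt 3 * infnorm (snd y)" using norm_le_infnorm[of "snd y"] by simp
  moreover have "sqrt 3 * infnorm (snd y) \<le> 2 * s"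
    using y by (intro mult_mono) (auto simp: real_le_lsqrt infnorm_pos_le)
  ultimately show ?thesis using y by simp
qed

section \<open>Convolution with compactly supported kernels\<close>

definition Cc :: "('a::euclidean_space \<Rightarrow> real) \<Rightarrow> bool" where
  "Cc \<psi> \<longleftrightarrow> continuous_on UNIV \<psi> \<and> (\<exists>K. compact K \<and> (\<forall>z. z \<notin> K \<longrightarrow> \<psi> z = 0))"

lemma Cc_continuous: "Cc \<psi> \<Longrightarrow> continuous_on UNIV \<psi>"
  by (simp add: Cc_def)

lemma Cc_compact_support:
  assumes "Cc \<psi>" obtains K where "compact K" "\<And>z. z \<notin> K \<Longrightarrow> \<psi> z = 0"
  using assms by (auto simp: Cc_def)

lemma CcI: "continuous_on UNIV \<psi> \<Longrightarrow> compact K \<Longrightarrow> (\<And>z. z \<notin> K \<Longrightarrow> \<psi> z = 0) \<Longrightarrow> Cc \<psi>"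
  by (auto simp: Cc_def)

lemma Cc_integrable:
  assumes "Cc f" shows "integrable lborel f"
proof -
  obtain K where K: "compact K" "\<And>z. z \<notin> K \<Longrightarrow> f z = 0"
    using Cc_compact_support[OF assms] by blast
  have "integrable lborel (\<lambda>x. indicator K x *\<^sub>R f x)"
    by (rule borel_integrable_compact[OF K(1)])
       (auto intro: continuous_on_subset Cc_continuous[OF assms])
  moreover have "(\<lambda>x. indicator K x *\<^sub>R f x) = f"
    using K(2) by (auto simp: indicator_def fun_eq_iff)
  ultimately show ?thesis by simp
qed

lemma Cc_mult:
  assumes \<psi>: "Cc \<psi>" and f: "continuous_on UNIV f" shows "Cc (\<lambda>y. \<psi> y * f y)"
proof -
  obtain K where "compact K" "\<And>z. z \<notin> K \<Longrightarrow> \<psi> z = 0"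
    using Cc_compact_support[OF \<psi>] by blast
  then show ?thesis by (intro CcI continuous_on_mult Cc_continuous[OF \<psi>] f) auto
qed

lemma Cc_diff:
  assumes "Cc \<phi>" "Cc \<psi>" shows "Cc (\<lambda>y. \<phi> y - \<psi> y)"
proof -
  obtain K where "compact K" "\<And>z. z \<notin> K \<Longrightarrow> \<phi> z = 0"
    using Cc_compact_support[OF assms(1)] by blast
  moreover obtain L where "compact L" "\<And>z. z \<notin> L \<Longrightarrow> \<psi> z = 0"
    using Cc_compact_support[OF assms(2)] by blast
  ultimately show ?thesis
    by (intro CcI[of _ "K \<union> L"] continuous_on_diff Cc_continuous[OF assms(1)]
        Cc_continuous[OF assms(2)] compact_Un) auto
qed

lemma Cc_bounded:
  assumes "Cc \<psi>" obtains M where "0 \<le> M" "\<And>z. \<bar>\<psi> z\<bar> \<le> M"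
proof -
  obtain K where K: "compact K" "\<And>z. z \<notin> K \<Longrightarrow> \<psi> z = 0"
    using Cc_compact_support[OF assms] by blast
  then have "bounded (\<psi> ` K)"
    by (intro compact_imp_bounded compact_continuous_image)
       (auto intro: continuous_on_subset Cc_continuous[OF assms])
  then obtain M where "\<And>z. z \<in> K \<Longrightarrow> \<bar>\<psi> z\<bar> \<le> M" unfolding bounded_iff by auto
  then have "\<bar>\<psi> z\<bar> \<le> max 0 M" for z
    using K(2)[of z] by (cases "z \<in> K") (auto simp: le_max_iff_disj)
  then show thesis by (intro that[of "max 0 M"]) auto
qed

lemma Cc_reflect:
  assumes "Cc \<psi>" shows "Cc (\<lambda>y. \<psi> (z - y))"
proof -
  obtain K where K: "compact K" "\<And>z. z \<notin> K \<Longrightarrow> \<psi> z = 0"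
    using Cc_compact_support[OF assms] by blast
  show ?thesis
  proof (rule CcI)
    show "compact ((\<lambda>y. z - y) ` K)" by (intro compact_continuous_image continuous_intros K)
    show "\<psi> (z - y) = 0" if "y \<notin> (\<lambda>y. z - y) ` K" for y
    proof (rule K(2))
      show "z - y \<notin> K" using that by (metis diff_diff_eq2 add_diff_cancel_left' imageI)
    qed
  qed (intro continuous_on_compose2[OF Cc_continuous[OF assms]] continuous_intros; simp)
qed

lemma Cc_translate:
  assumes "Cc \<psi>" shows "Cc (\<lambda>y. \<psi> (y + h))"
  using Cc_reflect[OF Cc_reflect[OF assms, of h], of 0] by (simp add: add.commute)

lemma Cc_support_cbox:
  assumes "Cc \<psi>" obtains a b where "\<And>y. y \<notin> cbox a b \<Longrightarrow> \<psi> y = 0"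
proof -
  obtain K where K: "compact K" "\<And>z. z \<notin> K \<Longrightarrow> \<psi> z = 0"
    using Cc_compact_support[OF assms] by blast
  then obtain a b where "K \<subseteq> cbox a b"
    using bounded_subset_cbox_symmetric[OF compact_imp_bounded] by metis
  with K show thesis by (intro that[of a b]) auto
qed

lemma lborel_integral_diagonal:
  fixes f :: "'a::euclidean_space \<Rightarrow> real"
  assumes f[measurable]: "f \<in> borel_measurable borel" and c: "\<And>j. j \<in> Basis \<Longrightarrow> c j \<noteq> 0"
  shows "(LINT y|lborel. f y) =
    (\<Prod>j\<in>Basis. \<bar>c j\<bar>) * (LINT y|lborel. f (p + (\<Sum>j\<in>Basis. (c j * (y \<bullet> j)) *\<^sub>R j)))"
proof -
  define T where "T = (\<lambda>y::'a. p + (\<Sum>j\<in>Basis. (c j * (y \<bullet> j)) *\<^sub>R j))"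
  have [measurable]: "T \<in> borel \<rightarrow>\<^sub>M borel" unfolding T_def by simp
  have "(LINT y|lborel. f y)
      = integral\<^sup>L (density (distr lborel borel T) (\<lambda>_. (\<Prod>j\<in>Basis. \<bar>c j\<bar>))) f"
    unfolding T_def using c
    by (subst lborel_affine_euclidean[of c p]) (auto simp: ennreal_mult prod_ennreal)
  also have "\<dots> = (LINT y|distr lborel borel T. (\<Prod>j\<in>Basis. \<bar>c j\<bar>) *\<^sub>R f y)"
    by (rule integral_density) (auto simp: prod_nonneg)
  also have "\<dots> = (LINT y|lborel. (\<Prod>j\<in>Basis. \<bar>c j\<bar>) *\<^sub>R f (T y))"
    by (rule integral_distr) auto
  finally show ?thesis by (simp add: T_def)
qed

lemma scaled_euclidean_representation:
  fixes y :: "'a::euclidean_space"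
  shows "(\<Sum>j\<in>Basis. (c * (y \<bullet> j)) *\<^sub>R j) = c *\<^sub>R y"
  unfolding scaleR_scaleR[symmetric] scaleR_sum_right[symmetric] euclidean_representation by simp

lemma lborel_integral_translate:
  fixes f :: "'a::euclidean_space \<Rightarrow> real"
  assumes "f \<in> borel_measurable borel"
  shows "(LINT y|lborel. f (w + y)) = (LINT y|lborel. f y)"
  using lborel_integral_diagonal[OF assms, of "\<lambda>_. 1" w] by (simp add: euclidean_representation)

lemma lborel_integral_reflect:
  fixes f :: "'a::euclidean_space \<Rightarrow> real"
  assumes "f \<in> borel_measurable borel"
  shows "(LINT y|lborel. f (z - y)) = (LINT y|lborel. f y)"
  using lborel_integral_diagonal[OF assms, of "\<lambda>_. -1" z]
  by (simp add: sum_negf euclidean_representation)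

lemma lborel_integral_scale_prod:
  fixes f :: "'a::euclidean_space \<times> 'b::euclidean_space \<Rightarrow> real"
  assumes f: "f \<in> borel_measurable borel" and ab: "a \<noteq> 0" "b \<noteq> 0"
  shows "(LINT y|lborel. f y) =
    \<bar>a\<bar> ^ DIM('a) * \<bar>b\<bar> ^ DIM('b) * (LINT y|lborel. f (p + (a *\<^sub>R fst y, b *\<^sub>R snd y)))"
proof -
  define c where "c = (\<lambda>j::'a \<times> 'b. if snd j = 0 then a else b)"
  have "(\<Sum>j\<in>Basis. (c j * (y \<bullet> j)) *\<^sub>R j) = (a *\<^sub>R fst y, b *\<^sub>R snd y)" for y
  proof -
    have "(\<Sum>j\<in>Basis. (c j * (y \<bullet> j)) *\<^sub>R j) =
       (\<Sum>i\<in>Basis. (a * (fst y \<bullet> i)) *\<^sub>R (i, 0)) + (\<Sum>i\<in>Basis. (b * (snd y \<bullet> i)) *\<^sub>R (0, i))"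
      unfolding sum_Basis_prod_eq
      by (intro arg_cong2[where f="(+)"] sum.cong) (auto simp: c_def inner_Pair_0 zero_prod_def)
    also have "\<dots> = (a *\<^sub>R fst y, b *\<^sub>R snd y)"
      by (simp add: sum_prod scaled_euclidean_representation)
    finally show ?thesis .
  qed
  moreover have "(\<Prod>j\<in>Basis. \<bar>c j\<bar>) = \<bar>a\<bar> ^ DIM('a) * \<bar>b\<bar> ^ DIM('b)"
  proof -
    have "(\<Prod>j\<in>Basis. \<bar>c j\<bar>)
        = (\<Prod>u\<in>(Basis::'a set). \<bar>c (u, 0)\<bar>) * (\<Prod>u\<in>(Basis::'b set). \<bar>c (0, u)\<bar>)"
      unfolding Basis_prod_def
      by (subst prod.union_disjoint) (auto simp: prod.reindex inj_on_def)
    also have "\<dots> = (\<Prod>u\<in>(Basis::'a set). \<bar>a\<bar>) * (\<Prod>u\<in>(Basis::'b set). \<bar>b\<bar>)"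
      by (intro arg_cong2[where f="(*)"] prod.cong) (auto simp: c_def nonzero_Basis)
    finally show ?thesis by simp
  qed
  ultimately show ?thesis
    using lborel_integral_diagonal[OF f, of c p] ab by (simp add: c_def)
qed

lemma lborel_integral_dil:
  fixes f :: "pt \<Rightarrow> real"
  assumes "f \<in> borel_measurable borel" "r > 0"
  shows "(LINT y|lborel. f y) = r ^ 5 * (LINT y|lborel. f (p + dil r y))"
  using lborel_integral_scale_prod[OF assms(1), of "r\<^sup>2" r p] assms(2)
  by (simp add: dil_def power2_eq_square eval_nat_numeral)

lemma lborel_integral_reflect_snd:
  fixes f :: "'a::euclidean_space \<times> 'b::euclidean_space \<Rightarrow> real"
  assumes "f \<in> borel_measurable borel"
  shows "(LINT y|lborel. f (fst y, - snd y)) = (LINT y|lborel. f y)"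
  using lborel_integral_scale_prod[OF assms, of 1 "-1" 0] by simp

lemma lborel_integral_swap:
  fixes F :: "'a::euclidean_space \<Rightarrow> 'b::euclidean_space \<Rightarrow> real"
  assumes "Cc (\<lambda>(x, y). F x y)"
  shows "(LINT x|lborel. LINT y|lborel. F x y) = (LINT y|lborel. LINT x|lborel. F x y)"
proof -
  have "integrable (lborel \<Otimes>\<^sub>M lborel) (\<lambda>(x, y). F x y)"
    using Cc_integrable[OF assms] by (simp add: lborel_prod)
  from lborel_pair.Fubini_integral[OF this] show ?thesis by simp
qed

context
  fixes \<psi> f :: "pt \<Rightarrow> real"
  assumes \<psi>: "Cc \<psi>" and f: "continuous_on UNIV f"
begin

lemma conv_integrable: "integrable lborel (\<lambda>y. \<psi> (z - y) * f y)"
  by (intro Cc_integrable Cc_mult Cc_reflect \<psi> f)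

lemma conv_eq_LINT: "conv \<psi> f z = (LINT y|lborel. \<psi> (z - y) * f y)"
  unfolding conv_def by (rule integral_lborel[OF conv_integrable])

lemma continuous_on_reflected: "continuous_on UNIV (\<lambda>y. f (z - y))"
  by (intro continuous_on_compose2[OF f] continuous_intros) auto

lemma conv_eq_LINT_reflected: "conv \<psi> f z = (LINT y|lborel. \<psi> y * f (z - y))"
  using lborel_integral_reflect[of "\<lambda>y. \<psi> (z - y) * f y" z]
    borel_measurable_integrable[OF conv_integrable]
  by (simp add: conv_eq_LINT)

lemma conv_integrable_reflected: "integrable lborel (\<lambda>y. \<psi> y * f (z - y))"
  by (intro Cc_integrable Cc_mult \<psi> continuous_on_reflected)

lemma conv_cbox:
  assumes "\<And>y. y \<notin> cbox a b \<Longrightarrow> \<psi> y = 0"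
  shows "conv \<psi> f z = integral (cbox a b) (\<lambda>y. \<psi> y * f (z - y))"
proof -
  have "conv \<psi> f z = integral UNIV (\<lambda>y. \<psi> y * f (z - y))"
    using conv_eq_LINT_reflected integral_lborel[OF conv_integrable_reflected] by simp
  also have "\<dots> = integral UNIV (\<lambda>y. if y \<in> cbox a b then \<psi> y * f (z - y) else 0)"
    using assms by (intro arg_cong[where f="integral UNIV"]) auto
  finally show ?thesis by (simp add: integral_restrict_UNIV)
qed

lemma continuous_on_conv: "continuous_on UNIV (conv \<psi> f)"
proof -
  obtain a b where ab: "\<And>y. y \<notin> cbox a b \<Longrightarrow> \<psi> y = 0" using Cc_support_cbox[OF \<psi>] by blast
  note [continuous_intros] =
    continuous_on_compose2[OF Cc_continuous[OF \<psi>]] continuous_on_compose2[OF f]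
  have "continuous_on UNIV (\<lambda>z. integral (cbox a b) (\<lambda>y. \<psi> y * f (z - y)))"
    by (rule integral_continuous_on_param) (auto intro!: continuous_intros simp: split_beta)
  moreover have "conv \<psi> f = (\<lambda>z. integral (cbox a b) (\<lambda>y. \<psi> y * f (z - y)))"
    by (intro ext conv_cbox ab)
  ultimately show ?thesis by simp
qed

end

lemma conv_cmult: "conv \<psi> (\<lambda>y. c * f y) z = c * conv \<psi> f z"
  unfolding conv_def by (simp add: mult.left_commute)

lemma conv_add:
  assumes "Cc \<psi>" "continuous_on UNIV f" "continuous_on UNIV g"
  shows "conv \<psi> (\<lambda>y. f y + g y) z = conv \<psi> f z + conv \<psi> g z"
  using assms by (simp add: conv_eq_LINT conv_integrable continuous_on_add distrib_left)

lemma conv_diff: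
  assumes "Cc \<psi>" "continuous_on UNIV f" "continuous_on UNIV g"
  shows "conv \<psi> (\<lambda>y. f y - g y) z = conv \<psi> f z - conv \<psi> g z"
  using assms by (simp add: conv_eq_LINT conv_integrable continuous_on_diff right_diff_distrib)

lemma conv_sum:
  assumes "Cc \<psi>" "finite A" "\<And>i. i \<in> A \<Longrightarrow> continuous_on UNIV (f i)"
  shows "conv \<psi> (\<lambda>y. \<Sum>i\<in>A. f i y) z = (\<Sum>i\<in>A. conv \<psi> (f i) z)"
  using assms(2,3)
proof (induction A)
  case empty then show ?case by (simp add: conv_def)
next
  case (insert i A)
  then show ?case by (simp add: conv_add[OF assms(1)] continuous_on_sum)
qed

lemma conv_diff_left:
  assumes "Cc \<phi>" "Cc \<psi>" "continuous_on UNIV f"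
  shows "conv (\<lambda>y. \<phi> y - \<psi> y) f z = conv \<phi> f z - conv \<psi> f z"
  using assms by (simp add: conv_eq_LINT conv_integrable Cc_diff left_diff_distrib)

lemma conv_commute: "Cc \<phi> \<Longrightarrow> Cc \<psi> \<Longrightarrow> conv \<phi> \<psi> z = conv \<psi> \<phi> z"
  by (simp add: conv_eq_LINT_reflected[of \<phi> \<psi>] conv_eq_LINT[of \<psi> \<phi>] Cc_continuous mult.commute)

lemma conv_translate:
  assumes "Cc \<phi>" "continuous_on UNIV g"
  shows "conv \<phi> (\<lambda>y. g (y + h)) z = conv \<phi> g (z + h)"
proof -
  have "continuous_on UNIV (\<lambda>y. g (y + h))"
    by (intro continuous_on_compose2[OF assms(2)] continuous_intros) auto
  then show ?thesis using assms by (simp add: conv_eq_LINT_reflected algebra_simps)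
qed

lemma conv_translate_left:
  assumes "Cc \<phi>" "continuous_on UNIV g"
  shows "conv (\<lambda>y. \<phi> (y + h)) g z = conv \<phi> g (z + h)"
  by (simp add: conv_eq_LINT[OF Cc_translate[OF assms(1)] assms(2)] conv_eq_LINT[OF assms]
      diff_add_eq)

lemma conv_support:
  assumes "Cc \<phi>" "continuous_on UNIV \<psi>" "conv \<phi> \<psi> z \<noteq> 0"
  obtains y where "\<phi> y \<noteq> 0" "\<psi> (z - y) \<noteq> 0"
proof -
  have "\<exists>y. \<phi> y * \<psi> (z - y) \<noteq> 0"
  proof (rule ccontr)
    assume "\<not> (\<exists>y. \<phi> y * \<psi> (z - y) \<noteq> 0)"
    then have "(\<lambda>y. \<phi> y * \<psi> (z - y)) = (\<lambda>_. 0)" by blast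
    with assms show False by (simp add: conv_eq_LINT_reflected)
  qed
  with that show thesis by auto
qed

lemma Cc_conv:
  assumes "Cc \<phi>" "Cc \<psi>" shows "Cc (conv \<phi> \<psi>)"
proof -
  obtain K where K: "compact K" "\<And>z. z \<notin> K \<Longrightarrow> \<phi> z = 0"
    using Cc_compact_support[OF assms(1)] by blast
  obtain L where L: "compact L" "\<And>z. z \<notin> L \<Longrightarrow> \<psi> z = 0"
    using Cc_compact_support[OF assms(2)] by blast
  note \<psi> = Cc_continuous[OF assms(2)]
  show ?thesis
  proof (rule CcI[OF continuous_on_conv[OF assms(1) \<psi>] compact_sums[OF K(1) L(1)]])
    fix z assume z: "z \<notin> {x + y |x y. x \<in> K \<and> y \<in> L}"
    show "conv \<phi> \<psi> z = 0"
    proof (rule ccontr)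
      assume "conv \<phi> \<psi> z \<noteq> 0"
      then obtain y where "\<phi> y \<noteq> 0" "\<psi> (z - y) \<noteq> 0" using conv_support[OF assms(1) \<psi>] by blast
      then have "y \<in> K" "z - y \<in> L" using K L by blast+
      moreover have "z = y + (z - y)" by simp
      ultimately show False using z by blast
    qed
  qed
qed

lemma Cc_conv_conv_integrand:
  assumes \<phi>: "Cc \<phi>" and \<psi>: "Cc \<psi>" and f: "continuous_on UNIV f"
  shows "Cc (\<lambda>(u, w). \<phi> (u - w) * \<psi> w * f (z - u))"
proof -
  obtain K where K: "compact K" "\<And>z. z \<notin> K \<Longrightarrow> \<phi> z = 0"
    using Cc_compact_support[OF \<phi>] by blast
  obtain L where L: "compact L" "\<And>z. z \<notin> L \<Longrightarrow> \<psi> z = 0"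
    using Cc_compact_support[OF \<psi>] by blast
  let ?S = "{x + y |x y. x \<in> K \<and> y \<in> L} \<times> L"
  have support: "(case p of (u, w) \<Rightarrow> \<phi> (u - w) * \<psi> w * f (z - u)) = 0" if p: "p \<notin> ?S" for p
  proof (rule ccontr)
    assume "(case p of (u, w) \<Rightarrow> \<phi> (u - w) * \<psi> w * f (z - u)) \<noteq> 0"
    then have "\<phi> (fst p - snd p) \<noteq> 0" "\<psi> (snd p) \<noteq> 0" by (auto simp: split_beta)
    then have "fst p - snd p \<in> K" "snd p \<in> L" using K L by blast+
    moreover have "fst p = (fst p - snd p) + snd p" by simp
    ultimately have "fst p \<in> {x + y |x y. x \<in> K \<and> y \<in> L}" by blast
    with \<open>snd p \<in> L\<close> p show False unfolding mem_Times_iff by blast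
  qed
  note [continuous_intros] = continuous_on_compose2[OF Cc_continuous[OF \<phi>]]
    continuous_on_compose2[OF Cc_continuous[OF \<psi>]] continuous_on_compose2[OF f]
  show ?thesis
  proof (rule CcI[OF _ _ support])
    show "compact ?S" by (intro compact_Times compact_sums K L)
  qed (auto simp: split_beta intro!: continuous_intros)
qed

lemma conv_conv_right_commute:
  assumes \<phi>: "Cc \<phi>" and \<psi>: "Cc \<psi>" and f: "continuous_on UNIV f"
  shows "conv (conv \<phi> \<psi>) f z = conv \<psi> (conv \<phi> f) z"
proof -
  note cont = Cc_continuous[OF \<phi>] Cc_continuous[OF \<psi>]
  note [continuous_intros] =
    continuous_on_compose2[OF cont(1)] continuous_on_compose2[OF cont(2)]
    continuous_on_compose2[OF f]
  define F where "F = (\<lambda>u w. \<phi> (u - w) * \<psi> w * f (z - u))"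
  have "Cc (\<lambda>(u, w). F u w)" unfolding F_def by (rule Cc_conv_conv_integrand[OF assms])
  note swap = lborel_integral_swap[OF this]
  have inner: "(LINT u|lborel. F u w) = \<psi> w * conv \<phi> f (z - w)" for w
  proof -
    have "(LINT u|lborel. F u w) = (LINT y|lborel. F (w + y) w)"
      by (rule lborel_integral_translate[symmetric])
         (auto simp: F_def intro!: borel_measurable_continuous_onI continuous_intros)
    also have "\<dots> = (LINT y|lborel. \<psi> w * (\<phi> y * f (z - w - y)))"
      by (simp add: F_def mult_ac diff_diff_eq)
    finally show ?thesis by (simp add: conv_eq_LINT_reflected[OF \<phi> f])
  qed
  have "conv (conv \<phi> \<psi>) f z = (LINT u|lborel. conv \<phi> \<psi> u * f (z - u))"
    by (rule conv_eq_LINT_reflected[OF Cc_conv[OF \<phi> \<psi>] f])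
  also have "\<dots> = (LINT u|lborel. LINT w|lborel. F u w)"
    by (simp add: conv_eq_LINT[OF \<phi> cont(2)] F_def)
  also have "\<dots> = (LINT w|lborel. \<psi> w * conv \<phi> f (z - w))"
    by (simp add: swap inner)
  also have "\<dots> = conv \<psi> (conv \<phi> f) z"
    by (rule conv_eq_LINT_reflected[OF \<psi> continuous_on_conv[OF \<phi> f], symmetric])
  finally show ?thesis .
qed

lemma conv_assoc:
  assumes "Cc \<phi>" "Cc \<psi>" "continuous_on UNIV f"
  shows "conv (conv \<phi> \<psi>) f z = conv \<phi> (conv \<psi> f) z"
proof -
  have "conv \<phi> \<psi> = conv \<psi> \<phi>" using conv_commute[OF assms(1,2)] by blast
  then show ?thesis using conv_conv_right_commute[OF assms(2,1,3)] by simp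
qed

section \<open>Mollifiers\<close>

text \<open>Mollifiers are supported at nonnegative times, so \<open>conv \<psi> f z\<close> depends only on \<open>f\<close> on
  \<open>past_cball z r\<close>.\<close>

definition mollifier :: "real \<Rightarrow> (pt \<Rightarrow> real) \<Rightarrow> bool" where
  "mollifier r \<psi> \<longleftrightarrow> 0 \<le> r \<and> continuous_on UNIV \<psi> \<and> (\<forall>z. 0 \<le> \<psi> z)
    \<and> (\<forall>z. \<psi> z \<noteq> 0 \<longrightarrow> - z \<in> past_cball 0 r)
    \<and> (\<forall>t x. \<psi> (t, - x) = \<psi> (t, x)) \<and> (LINT z|lborel. \<psi> z) = 1"

lemma Cc_past_supported:
  assumes "continuous_on UNIV \<psi>" "\<And>z. \<psi> z \<noteq> 0 \<Longrightarrow> - z \<in> past_cball 0 r"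
  shows "Cc \<psi>"
proof (rule CcI[OF assms(1)])
  show "compact (uminus ` past_cball 0 r)"
    by (intro compact_continuous_image continuous_intros compact_past_cball)
  show "\<psi> z = 0" if "z \<notin> uminus ` past_cball 0 r" for z
    using assms(2)[of z] that by (metis imageI minus_minus)
qed

lemma mollifierD:
  assumes "mollifier r \<psi>"
  shows "0 \<le> r" and "continuous_on UNIV \<psi>" and "0 \<le> \<psi> z" and "\<psi> z \<noteq> 0 \<Longrightarrow> - z \<in> past_cball 0 r"
    and "\<psi> (t, - x) = \<psi> (t, x)" and "(LINT z|lborel. \<psi> z) = 1"
  using assms by (auto simp: mollifier_def)

lemma mollifier_Cc: "mollifier r \<psi> \<Longrightarrow> Cc \<psi>"
  using Cc_past_supported mollifierD by metis

lemma mollifier_support: "mollifier r \<psi> \<Longrightarrow> \<psi> (z - y) \<noteq> 0 \<Longrightarrow> y \<in> past_cball z r"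
  using mollifierD(4)[of r \<psi> "z - y"] diff_in_past_cball_0[of y z r] by simp

lemma mollifier_mono: "mollifier r \<psi> \<Longrightarrow> r \<le> s \<Longrightarrow> mollifier s \<psi>"
  using past_cball_mono[of _ 0 r s] by (auto simp: mollifier_def)

lemma conv_one: "Cc \<psi> \<Longrightarrow> conv \<psi> (\<lambda>_. 1) z = (LINT y|lborel. \<psi> y)"
  by (simp add: conv_eq_LINT_reflected)

lemma conv_const: "mollifier r \<psi> \<Longrightarrow> conv \<psi> (\<lambda>_. c) z = c"
  using conv_eq_LINT_reflected[OF mollifier_Cc, of r \<psi> "\<lambda>_. c" z] by (simp add: mollifierD(6))

lemma conv_mono:
  assumes \<psi>: "mollifier r \<psi>" and f: "continuous_on UNIV f" and g: "continuous_on UNIV g"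
    and f_le_g: "\<And>y. y \<in> past_cball z r \<Longrightarrow> f y \<le> g y"
  shows "conv \<psi> f z \<le> conv \<psi> g z"
  unfolding conv_eq_LINT[OF mollifier_Cc[OF \<psi>] f] conv_eq_LINT[OF mollifier_Cc[OF \<psi>] g]
proof (rule integral_mono)
  show "\<psi> (z - y) * f y \<le> \<psi> (z - y) * g y" for y
    using f_le_g[of y] mollifier_support[OF \<psi>, of z y] mollifierD(3)[OF \<psi>, of "z - y"]
    by (cases "\<psi> (z - y) = 0") (auto intro: mult_left_mono)
qed (intro conv_integrable mollifier_Cc[OF \<psi>] f g)+

lemma conv_cong:
  assumes "mollifier r \<psi>" "continuous_on UNIV f" "continuous_on UNIV g"
    "\<And>y. y \<in> past_cball z r \<Longrightarrow> f y = g y"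
  shows "conv \<psi> f z = conv \<psi> g z"
  by (rule antisym; rule conv_mono) (use assms in auto)

lemma abs_conv_le:
  assumes \<psi>: "mollifier r \<psi>" and f: "continuous_on UNIV f"
    and f_le: "\<And>y. y \<in> past_cball z r \<Longrightarrow> \<bar>f y\<bar> \<le> B"
  shows "\<bar>conv \<psi> f z\<bar> \<le> B"
proof -
  have "conv \<psi> f z \<le> conv \<psi> (\<lambda>_. B) z" "conv \<psi> (\<lambda>_. - B) z \<le> conv \<psi> f z"
    by (intro conv_mono[OF \<psi>]; use f f_le in \<open>force simp: abs_le_iff\<close>)+
  then show ?thesis by (simp add: conv_const[OF \<psi>])
qed

lemma abs_conv_diff_le:
  assumes \<psi>: "mollifier r \<psi>" and f: "continuous_on UNIV f"
    and f_le: "\<And>y. y \<in> past_cball z r \<Longrightarrow> \<bar>f y - c\<bar> \<le> B"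
  shows "\<bar>conv \<psi> f z - c\<bar> \<le> B"
proof -
  have "conv \<psi> f z - c = conv \<psi> (\<lambda>y. f y - c) z"
    using conv_diff[OF mollifier_Cc[OF \<psi>] f, of "\<lambda>_. c" z] by (simp add: conv_const[OF \<psi>])
  also have "\<bar>\<dots>\<bar> \<le> B" by (intro abs_conv_le[OF \<psi>] continuous_intros f f_le)
  finally show ?thesis .
qed

lemma abs_conv_le_measure:
  assumes \<psi>: "continuous_on UNIV \<psi>" and f: "continuous_on UNIV f" and r: "0 \<le> r"
    and supp: "\<And>y. \<psi> y \<noteq> 0 \<Longrightarrow> - y \<in> past_cball 0 r" and m: "\<And>y. \<bar>\<psi> y\<bar> \<le> m"
    and B: "\<And>y. y \<in> past_cball z r \<Longrightarrow> \<bar>f y\<bar> \<le> B"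
  shows "\<bar>conv \<psi> f z\<bar> \<le> m * B * (8 * r ^ 5)"
proof -
  obtain a b where cbox: "past_cball z r = cbox a b" using past_cball_eq_cbox[OF r] by blast
  note [continuous_intros] = continuous_on_compose2[OF f] continuous_on_compose2[OF \<psi>]
  have "\<psi> (z - y) = 0" if "y \<notin> past_cball z r" for y
    using that supp[of "z - y"] diff_in_past_cball_0[of y z r] by auto
  then have "conv \<psi> f z = integral UNIV (\<lambda>y. if y \<in> past_cball z r then \<psi> (z - y) * f y else 0)"
    unfolding conv_def by (intro arg_cong[where f="integral UNIV"]) auto
  also have "\<dots> = integral (past_cball z r) (\<lambda>y. \<psi> (z - y) * f y)" by (rule integral_restrict_UNIV)
  also have "norm \<dots> \<le> integral (past_cball z r) (\<lambda>y. m * B)"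
  proof (rule Henstock_Kurzweil_Integration.integral_norm_bound_integral)
    show "norm (\<psi> (z - y) * f y) \<le> m * B" if "y \<in> past_cball z r" for y
      using B[OF that] m[of "z - y"] by (auto simp: abs_mult intro!: mult_mono)
  qed (auto simp: cbox intro!: integrable_continuous continuous_intros)
  also have "\<dots> = m * B * (8 * r ^ 5)"
    using measure_past_cball[OF r, of z] by (simp add: cbox)
  finally show ?thesis by simp
qed

lemma conv_coordinate:
  assumes \<psi>: "mollifier r \<psi>" shows "conv \<psi> (\<lambda>y. snd (y - z) $ i) z = 0"
proof -
  note [continuous_intros] = continuous_on_compose2[OF mollifierD(2)[OF \<psi>]]
  have even: "\<psi> (fst y, - snd y) = \<psi> y" for y
    using mollifierD(5)[OF \<psi>, of "fst y" "snd y"] by simp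
  have reflected: "conv \<psi> (\<lambda>y. snd (y - z) $ i) z = (LINT y|lborel. \<psi> y * (- (snd y $ i)))"
    by (subst conv_eq_LINT_reflected[OF mollifier_Cc[OF \<psi>]]) (auto intro!: continuous_intros)
  also have "\<dots> = (LINT y|lborel. \<psi> (fst y, - snd y) * (- (snd (fst y, - snd y) $ i)))"
    by (rule lborel_integral_reflect_snd[symmetric])
       (intro borel_measurable_continuous_onI continuous_intros; simp)
  also have "\<dots> = - (LINT y|lborel. \<psi> y * (- (snd y $ i)))"
    by (simp add: even flip: integral_minus)
  finally show ?thesis using reflected by simp
qed

lemma even_conv:
  assumes \<phi>: "mollifier r \<phi>" and \<psi>: "mollifier s \<psi>"
  shows "conv \<phi> \<psi> (t, - x) = conv \<phi> \<psi> (t, x)"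
proof -
  note cont = mollifierD(2)[OF \<phi>] mollifierD(2)[OF \<psi>]
  note [continuous_intros] = continuous_on_compose2[OF cont(1)] continuous_on_compose2[OF cont(2)]
  let ?R = "\<lambda>y::pt. (fst y, - snd y)"
  have \<phi>_even: "\<phi> (?R y) = \<phi> y" and \<psi>_even: "\<psi> (?R y) = \<psi> y" for y
    using mollifierD(5)[OF \<phi>, of "fst y" "snd y"] mollifierD(5)[OF \<psi>, of "fst y" "snd y"]
    by simp_all
  have "conv \<phi> \<psi> (t, - x) = (LINT y|lborel. \<phi> y * \<psi> (?R (t, x) - y))"
    by (simp add: conv_eq_LINT_reflected[OF mollifier_Cc[OF \<phi>] cont(2)])
  also have "\<dots> = (LINT y|lborel. \<phi> (?R y) * \<psi> (?R (t, x) - ?R y))"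
    by (rule lborel_integral_reflect_snd[symmetric])
       (intro borel_measurable_continuous_onI continuous_intros; simp)
  also have "?R (t, x) - ?R y = ?R ((t, x) - y)" for y by (simp add: prod_eq_iff)
  then have "(LINT y|lborel. \<phi> (?R y) * \<psi> (?R (t, x) - ?R y)) = conv \<phi> \<psi> (t, x)"
    by (simp only: \<phi>_even \<psi>_even conv_eq_LINT_reflected[OF mollifier_Cc[OF \<phi>] cont(2)])
  finally show ?thesis .
qed

lemma mollifier_conv:
  assumes \<phi>: "mollifier r \<phi>" and \<psi>: "mollifier s \<psi>"
  shows "mollifier (r + s) (conv \<phi> \<psi>)"
proof -
  note Cc = mollifier_Cc[OF \<phi>] mollifier_Cc[OF \<psi>]
  note cont = mollifierD(2)[OF \<psi>]
  have "0 \<le> conv \<phi> \<psi> z" for z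
    using conv_mono[OF \<phi> _ cont, of "\<lambda>_. 0" z] mollifierD(3)[OF \<psi>] by (simp add: conv_const[OF \<phi>])
  moreover have "- z \<in> past_cball 0 (r + s)" if nz: "conv \<phi> \<psi> z \<noteq> 0" for z
  proof -
    obtain y where y: "\<phi> y \<noteq> 0" "\<psi> (z - y) \<noteq> 0" by (rule conv_support[OF Cc(1) cont nz])
    have "- y + - (z - y) \<in> past_cball (- y + 0) s"
      using mollifierD(4)[OF \<psi> y(2)] by (simp only: past_cball_translate)
    then show ?thesis using past_cball_trans[OF _ mollifierD(4)[OF \<phi> y(1)]] by simp
  qed
  moreover have "(LINT z|lborel. conv \<phi> \<psi> z) = 1"
    using conv_assoc[OF Cc, of "\<lambda>_. 1" 0]
    by (simp add: conv_const[OF \<phi>] conv_const[OF \<psi>, abs_def]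
        flip: conv_one[OF Cc_conv[OF Cc], of 0])
  ultimately show ?thesis
    using mollifierD(1)[OF \<phi>] mollifierD(1)[OF \<psi>] continuous_on_conv[OF Cc(1) cont]
      even_conv[OF \<phi> \<psi>]
    by (auto simp: mollifier_def)
qed

lemma conv_lipschitz:
  assumes \<phi>: "mollifier r \<phi>" and g: "continuous_on UNIV g"
    and lip: "\<And>z w. \<bar>g z - g w\<bar> \<le> \<Lambda> * norm (z - w)"
  shows "\<bar>conv \<phi> g z - conv \<phi> g w\<bar> \<le> \<Lambda> * norm (z - w)"
proof -
  have g': "continuous_on UNIV (\<lambda>y. g (y + (z - w)))"
    by (intro continuous_on_compose2[OF g] continuous_intros) auto
  have "conv \<phi> g z - conv \<phi> g w = conv \<phi> (\<lambda>y. g (y + (z - w)) - g y) w"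
    using conv_diff[OF mollifier_Cc[OF \<phi>] g' g]
      conv_translate[OF mollifier_Cc[OF \<phi>] g, of "z - w" w]
    by simp
  also have "\<bar>\<dots>\<bar> \<le> \<Lambda> * norm (z - w)"
    using lip[of "y + (z - w)" y for y]
    by (intro abs_conv_le[OF \<phi> continuous_on_diff[OF g' g]]) simp
  finally show ?thesis .
qed

lemma conv_lipschitz_close:
  assumes \<phi>: "mollifier s \<phi>" and g: "continuous_on UNIV g" and \<Lambda>: "0 \<le> \<Lambda>"
    and lip: "\<And>z w. \<bar>g z - g w\<bar> \<le> \<Lambda> * norm (z - w)"
  shows "\<bar>conv \<phi> g z - g z\<bar> \<le> \<Lambda> * (s\<^sup>2 + 2 * s)"
proof (rule abs_conv_diff_le[OF \<phi> g])
  fix y assume "y \<in> past_cball z s"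
  then have "norm (y - z) \<le> s\<^sup>2 + 2 * s"
    by (intro norm_le_of_past_cball) (simp add: diff_in_past_cball_0)
  then have "\<Lambda> * norm (y - z) \<le> \<Lambda> * (s\<^sup>2 + 2 * s)" using \<Lambda> by (intro mult_left_mono) auto
  with lip[of y z] show "\<bar>g y - g z\<bar> \<le> \<Lambda> * (s\<^sup>2 + 2 * s)" by linarith
qed

lemma conv_uniform_limit:
  assumes \<phi>: "mollifier r \<phi>" and f: "\<And>n. continuous_on UNIV (f n)" and g: "continuous_on UNIV g"
    and lim: "uniform_limit UNIV f g sequentially"
  shows "(\<lambda>n. conv \<phi> (f n) z) \<longlonglongrightarrow> conv \<phi> g z"
proof (rule LIMSEQ_I)
  fix e :: real assume e: "e > 0"
  then obtain N where N: "\<And>n x. n \<ge> N \<Longrightarrow> \<bar>f n x - g x\<bar> < e / 2"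
    using uniform_limitD[OF lim, of "e / 2"] by (auto simp: eventually_sequentially dist_real_def)
  have "\<bar>conv \<phi> (f n) z - conv \<phi> g z\<bar> \<le> e / 2" if "n \<ge> N" for n
    unfolding conv_diff[OF mollifier_Cc[OF \<phi>] f g, symmetric]
    by (intro abs_conv_le[OF \<phi>] continuous_on_diff f g less_imp_le[OF N[OF that]])
  then show "\<exists>N. \<forall>n\<ge>N. norm (conv \<phi> (f n) z - conv \<phi> g z) < e"
    using e by (intro exI[of _ N]) (smt (verit) field_sum_of_halves real_norm_def)
qed

lemma mollifier_uniform_limit:
  assumes f: "\<And>n. mollifier r (f n)" and lim: "uniform_limit UNIV f g sequentially"
  shows "mollifier r g"
proof -
  note cont = mollifierD(2)[OF f]
  have r: "0 \<le> r" by (rule mollifierD(1)[OF f])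
  have lim_at: "(\<lambda>n. f n z) \<longlonglongrightarrow> g z" for z using tendsto_uniform_limitI[OF lim] by simp
  have g: "continuous_on UNIV g" by (rule uniform_limit_theorem[OF _ lim]) (auto simp: cont)
  have nonneg: "0 \<le> g z" for z
    by (rule LIMSEQ_le_const[OF lim_at]) (use mollifierD(3)[OF f] in auto)
  have supp: "- z \<in> past_cball 0 r" if "g z \<noteq> 0" for z
  proof (rule ccontr)
    assume "- z \<notin> past_cball 0 r"
    then have "f n z = 0" for n using mollifierD(4)[OF f] by blast
    then show False using lim_at[of z] that LIMSEQ_unique[of "\<lambda>_. 0" 0 "g z"] by simp
  qed
  have even: "g (t, - x) = g (t, x)" for t x
    using lim_at[of "(t, - x)"] lim_at[of "(t, x)"] mollifierD(5)[OF f] LIMSEQ_unique by simp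
  note Cc_g = Cc_past_supported[OF g supp]
  have "\<bar>(LINT z|lborel. g z) - 1\<bar> \<le> 0"
  proof (rule field_le_epsilon)
    fix e :: real assume e: "0 < e"
    define d where "d = e / (8 * r ^ 5 + 1)"
    have "0 < 8 * r ^ 5 + 1" using r by (simp add: add_nonneg_pos)
    then have d: "0 < d" "d * (8 * r ^ 5 + 1) = e" using e by (auto simp: d_def)
    obtain n where n: "\<And>z. \<bar>g z - f n z\<bar> \<le> d"
      using uniform_limitD[OF lim d(1)] by (auto simp: eventually_sequentially dist_real_def
          abs_minus_commute intro: less_imp_le)
    have "\<bar>conv (\<lambda>y. g y - f n y) (\<lambda>_. 1) 0\<bar> \<le> d * 1 * (8 * r ^ 5)"
    proof (rule abs_conv_le_measure[OF _ _ r _ n])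
      show "- y \<in> past_cball 0 r" if "g y - f n y \<noteq> 0" for y
        using that supp[of y] mollifierD(4)[OF f, of n y] by (cases "g y = 0") auto
    qed (auto intro!: continuous_intros g cont)
    then show "\<bar>(LINT z|lborel. g z) - 1\<bar> \<le> 0 + e"
      using d
      by (simp add: algebra_simps conv_diff_left[OF Cc_g mollifier_Cc[OF f]] conv_const[OF f]
          conv_one[OF Cc_g])
  qed
  then show ?thesis using r g nonneg supp even by (auto simp: mollifier_def)
qed

definition conv_le :: "(pt \<Rightarrow> real) \<Rightarrow> pt \<Rightarrow> (pt \<Rightarrow> real) \<Rightarrow> real \<Rightarrow> bool" where
  "conv_le \<psi> z f B \<longleftrightarrow> Cc \<psi> \<and> continuous_on UNIV f \<and> \<bar>conv \<psi> f z\<bar> \<le> B"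

lemma conv_leI: "Cc \<psi> \<Longrightarrow> continuous_on UNIV f \<Longrightarrow> \<bar>conv \<psi> f z\<bar> \<le> B \<Longrightarrow> conv_le \<psi> z f B"
  by (simp add: conv_le_def)

lemma conv_leD: "conv_le \<psi> z f B \<Longrightarrow> \<bar>conv \<psi> f z\<bar> \<le> B"
  by (simp add: conv_le_def)

lemma conv_le_mono: "conv_le \<psi> z f A \<Longrightarrow> A \<le> B \<Longrightarrow> conv_le \<psi> z f B"
  by (simp add: conv_le_def)

lemma conv_le_add:
  "conv_le \<psi> z f A \<Longrightarrow> conv_le \<psi> z g B \<Longrightarrow> conv_le \<psi> z (\<lambda>y. f y + g y) (A + B)"
  using abs_triangle_ineq[of "conv \<psi> f z" "conv \<psi> g z"]
  by (simp add: conv_le_def conv_add continuous_on_add)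

lemma conv_le_diff:
  "conv_le \<psi> z f A \<Longrightarrow> conv_le \<psi> z g B \<Longrightarrow> conv_le \<psi> z (\<lambda>y. f y - g y) (A + B)"
  using abs_triangle_ineq4[of "conv \<psi> f z" "conv \<psi> g z"]
  by (simp add: conv_le_def conv_diff continuous_on_diff)

lemma conv_le_cmult:
  assumes "conv_le \<psi> z f B" "\<bar>c\<bar> \<le> A" shows "conv_le \<psi> z (\<lambda>y. c * f y) (A * B)"
  using assms
  by (auto simp: conv_le_def conv_cmult abs_mult intro!: continuous_intros mult_mono
      intro: order_trans[OF abs_ge_zero])

lemma conv_le_sum:
  fixes f :: "'i::finite \<Rightarrow> pt \<Rightarrow> real"
  assumes "\<And>i. conv_le \<psi> z (f i) B"
  shows "conv_le \<psi> z (\<lambda>y. \<Sum>i\<in>UNIV. f i y) (real CARD('i) * B)"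
proof (rule conv_leI)
  show "Cc \<psi>" "continuous_on UNIV (\<lambda>y. \<Sum>i\<in>UNIV. f i y)"
    using assms by (auto simp: conv_le_def intro!: continuous_intros)
  then have "conv \<psi> (\<lambda>y. \<Sum>i\<in>UNIV. f i y) z = (\<Sum>i\<in>UNIV. conv \<psi> (f i) z)"
    using assms by (intro conv_sum) (auto simp: conv_le_def)
  then show "\<bar>conv \<psi> (\<lambda>y. \<Sum>i\<in>UNIV. f i y) z\<bar> \<le> real CARD('i) * B"
    using abs_sum_mult_le[of "\<lambda>i. conv \<psi> (f i) z" B "\<lambda>_. 1" 1] conv_leD[OF assms] by simp
qed

section \<open>The kernels \<open>PsiT\<close>\<close>

lemma smooth_differentiable: "smooth f \<Longrightarrow> f differentiable (at z)"
  and smooth_frechet_derivative: "smooth f \<Longrightarrow> b \<in> Basis \<Longrightarrow> smooth (\<lambda>z. frechet_derivative f (at z) b)"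
  by (auto elim: smooth.cases)

lemma smooth_continuous: "smooth f \<Longrightarrow> continuous_on UNIV f"
  by (meson smooth_differentiable differentiable_imp_continuous_within
      continuous_on_eq_continuous_within)

lemma smooth_has_derivative: "smooth f \<Longrightarrow> (f has_derivative frechet_derivative f (at z)) (at z)"
  using smooth_differentiable frechet_derivative_works by blast

lemma Cc_frechet_derivative:
  assumes f: "smooth f" "Cc f" and b: "b \<in> Basis"
  shows "Cc (\<lambda>z. frechet_derivative f (at z) b)"
proof -
  obtain K where K: "compact K" "\<And>z. z \<notin> K \<Longrightarrow> f z = 0" using Cc_compact_support[OF f(2)] by blast
  show ?thesis
  proof (rule CcI[OF smooth_continuous[OF smooth_frechet_derivative[OF f(1) b]] K(1)])
    fix z assume z: "z \<notin> K"
    have "open (- K)" using K(1) compact_imp_closed by blast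
    then have "(f has_derivative (\<lambda>_. 0)) (at z)"
      by (rule has_derivative_transform_within_open[OF has_derivative_const[of 0]])
         (use z K in auto)
    then have "frechet_derivative f (at z) = (\<lambda>_. 0)"
      by (rule has_derivative_unique[OF smooth_has_derivative[OF f(1)]])
    then show "frechet_derivative f (at z) b = 0" by simp
  qed
qed

lemma smooth_Cc_lipschitz:
  fixes f :: "'a::euclidean_space \<Rightarrow> real"
  assumes f: "smooth f" "Cc f"
  obtains \<Lambda> where "0 \<le> \<Lambda>" "\<And>z w. \<bar>f z - f w\<bar> \<le> \<Lambda> * norm (z - w)"
proof -
  let ?D = "\<lambda>z. frechet_derivative f (at z)"
  have "\<exists>M\<ge>0. \<forall>z. \<bar>?D z b\<bar> \<le> M" if "b \<in> Basis" for b
    using Cc_bounded[OF Cc_frechet_derivative[OF f that]] by metis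
  then obtain M where M: "\<And>b. b \<in> Basis \<Longrightarrow> 0 \<le> M b \<and> (\<forall>z. \<bar>?D z b\<bar> \<le> M b)" by metis
  have "onorm (?D z) \<le> (\<Sum>b\<in>Basis. M b)" for z
  proof (rule onorm_componentwise_le)
    show "bounded_linear (?D z)"
      using smooth_has_derivative[OF f(1)] has_derivative_bounded_linear by blast
    show "(\<Sum>b\<in>Basis. norm (?D z b)) \<le> (\<Sum>b\<in>Basis. M b)" using M by (intro sum_mono) auto
  qed
  then have "norm (f z - f w) \<le> (\<Sum>b\<in>Basis. M b) * norm (z - w)" for z w
    by (intro differentiable_bound[of UNIV f ?D]) (auto intro: smooth_has_derivative[OF f(1)])
  with M show thesis by (intro that[of "\<Sum>b\<in>Basis. M b"]) (auto intro!: sum_nonneg)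
qed

lemma kernel_mollifier: assumes "kernel \<Phi>" shows "mollifier 1 \<Phi>"
proof -
  have cont: "continuous_on UNIV \<Phi>" using assms smooth_continuous by (auto simp: kernel_def)
  have supp: "- z \<in> past_cball 0 1" if "\<Phi> z \<noteq> 0" for z
  proof -
    have "z \<in> closure {z. \<Phi> z \<noteq> 0}" using that by (intro closure_subset[THEN subsetD] CollectI)
    then have "z \<in> {(t, x). 0 < t \<and> t < 1 \<and> infnorm x < 1}"
      using assms unfolding kernel_def by blast
    then show ?thesis by (auto simp: mem_past_cball_iff_box infnorm_neg)
  qed
  have "(LINT z|lborel. \<Phi> z) = integral UNIV \<Phi>"
    using Cc_integrable[OF Cc_past_supported[OF cont supp]] by (simp add: integral_lborel)
  also have "\<dots> = 1" using assms by (auto simp: kernel_def)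
  finally show ?thesis using cont supp assms by (auto simp: mollifier_def kernel_def)
qed

lemma PhiT_eq_dil: "T > 0 \<Longrightarrow> PhiT \<Phi> T z = \<Phi> (dil (1 / T) z) / T ^ 5"
  by (simp add: PhiT_def dil_def powr_minus_divide power_divide flip: powr_numeral)

lemma PhiT_dil: "r > 0 \<Longrightarrow> T > 0 \<Longrightarrow> PhiT \<Phi> (r * T) (dil r z) = PhiT \<Phi> T z / r ^ 5"
  by (simp add: PhiT_eq_dil power_mult_distrib field_simps)

lemma PhiT_mollifier: assumes \<Phi>: "mollifier 1 \<Phi>" and T: "T > 0" shows "mollifier T (PhiT \<Phi> T)"
proof -
  note [continuous_intros] = continuous_on_compose2[OF mollifierD(2)[OF \<Phi>]]
  have PhiT_eq: "PhiT \<Phi> T = (\<lambda>z. \<Phi> (dil (1 / T) z) / T ^ 5)" using PhiT_eq_dil[OF T] by auto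
  have supp: "- z \<in> past_cball 0 T" if "\<Phi> (dil (1 / T) z) \<noteq> 0" for z
  proof -
    have "dil (1 / T) (- z) \<in> past_cball (dil (1 / T) 0) (1 / T * T)"
      using mollifierD(4)[OF \<Phi> that] T dil_diff[of "1 / T" 0 z] by simp
    then show ?thesis using T by (subst (asm) dil_in_past_cball) auto
  qed
  have mass: "(LINT z|lborel. \<Phi> (dil (1 / T) z) / T ^ 5) = 1"
  proof -
    have "(LINT z|lborel. \<Phi> (dil (1 / T) z) / T ^ 5)
        = T ^ 5 * (LINT z|lborel. \<Phi> (dil (1 / T) (0 + dil T z)) / T ^ 5)"
      by (rule lborel_integral_dil[OF _ T])
         (intro borel_measurable_continuous_onI continuous_intros; use T in simp)
    also have "\<dots> = 1" using T by (simp add: mollifierD(6)[OF \<Phi>])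
    finally show ?thesis .
  qed
  have "\<Phi> (dil (1 / T) (t, - x)) = \<Phi> (dil (1 / T) (t, x))" for t x
    using mollifierD(5)[OF \<Phi>] by (simp add: dil_def)
  moreover have "0 \<le> \<Phi> (dil (1 / T) z) / T ^ 5" for z using T mollifierD(3)[OF \<Phi>] by simp
  ultimately show ?thesis
    using T supp mass unfolding PhiT_eq mollifier_def by (auto intro!: continuous_intros)
qed

lemma norm_dil_le: assumes "0 \<le> r" shows "norm (dil r z) \<le> (r\<^sup>2 + r) * norm z"
proof -
  have "norm (dil r z) \<le> norm (r\<^sup>2 * fst z) + norm (r *\<^sub>R snd z)"
    unfolding dil_def by (rule norm_Pair_le)
  also have "\<dots> \<le> r\<^sup>2 * norm z + r * norm z"
    using assms norm_fst_le[of "fst z" "snd z"] norm_snd_le[of "snd z" "fst z"]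
    by (intro add_mono) (auto simp: abs_mult intro!: mult_left_mono)
  finally show ?thesis by (simp add: distrib_right)
qed

lemma PhiT_lipschitz_dil:
  assumes "kernel \<Phi>"
  obtains \<Lambda> where "0 \<le> \<Lambda>"
    "\<And>T z w. T > 0 \<Longrightarrow> \<bar>PhiT \<Phi> T z - PhiT \<Phi> T w\<bar> \<le> \<Lambda> * norm (dil (1 / T) (z - w)) / T ^ 5"
proof -
  obtain \<Lambda> where \<Lambda>: "0 \<le> \<Lambda>" "\<And>z w. \<bar>\<Phi> z - \<Phi> w\<bar> \<le> \<Lambda> * norm (z - w)"
    using smooth_Cc_lipschitz[of \<Phi>] assms mollifier_Cc[OF kernel_mollifier[OF assms]]
    by (metis kernel_def)
  have "\<bar>PhiT \<Phi> T z - PhiT \<Phi> T w\<bar> \<le> \<Lambda> * norm (dil (1 / T) (z - w)) / T ^ 5" if T: "T > 0" for T z w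
  proof -
    have "\<bar>PhiT \<Phi> T z - PhiT \<Phi> T w\<bar> = \<bar>\<Phi> (dil (1 / T) z) - \<Phi> (dil (1 / T) w)\<bar> / T ^ 5"
      using T by (simp add: PhiT_eq_dil diff_divide_distrib[symmetric])
    also have "\<dots> \<le> \<Lambda> * norm (dil (1 / T) z - dil (1 / T) w) / T ^ 5"
      using T by (intro divide_right_mono \<Lambda>) auto
    finally show ?thesis by (simp add: dil_diff)
  qed
  with \<Lambda>(1) show thesis by (rule that)
qed

lemma PhiT_lipschitz:
  assumes "kernel \<Phi>" "T > 0"
  obtains \<Lambda> where "0 \<le> \<Lambda>" "\<And>z w. \<bar>PhiT \<Phi> T z - PhiT \<Phi> T w\<bar> \<le> \<Lambda> * norm (z - w)"
proof -
  obtain \<Lambda> where \<Lambda>: "0 \<le> \<Lambda>"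
    "\<And>z w. \<bar>PhiT \<Phi> T z - PhiT \<Phi> T w\<bar> \<le> \<Lambda> * norm (dil (1 / T) (z - w)) / T ^ 5"
    using PhiT_lipschitz_dil[OF assms(1)] assms(2) by metis
  define q where "q = (1 / T)\<^sup>2 + 1 / T"
  have q: "0 \<le> q" using assms(2) by (simp add: q_def)
  have "\<bar>PhiT \<Phi> T z - PhiT \<Phi> T w\<bar> \<le> \<Lambda> * q / T ^ 5 * norm (z - w)" for z w
  proof -
    have "\<Lambda> * norm (dil (1 / T) (z - w)) / T ^ 5 \<le> \<Lambda> * (q * norm (z - w)) / T ^ 5"
      unfolding q_def
      using \<Lambda>(1) assms(2) by (intro divide_right_mono mult_left_mono norm_dil_le) auto
    with \<Lambda>(2)[of z w] show ?thesis by simp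
  qed
  moreover have "0 \<le> \<Lambda> * q / T ^ 5" using \<Lambda>(1) q assms(2) by simp
  ultimately show thesis using that by blast
qed

lemma PsiTn_mollifier:
  assumes \<Phi>: "mollifier 1 \<Phi>" and T: "T > 0" shows "mollifier T (PsiTn \<Phi> T n)"
proof -
  have "mollifier (T - T / 2 ^ (n + 1)) (PsiTn \<Phi> T n)"
  proof (induction n)
    case 0 then show ?case using PhiT_mollifier[OF \<Phi>, of "T / 2"] T by simp
  next
    case (Suc n)
    have "mollifier (T - T / 2 ^ (n + 1) + T / 2 ^ (n + 2))
        (conv (PsiTn \<Phi> T n) (PhiT \<Phi> (T / 2 ^ (n + 2))))"
      by (intro mollifier_conv Suc PhiT_mollifier \<Phi>) (use T in auto)
    then show ?case by simp
  qed
  then show ?thesis using T by (elim mollifier_mono) simp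
qed

context
  fixes \<Phi> :: "pt \<Rightarrow> real"
  assumes \<Phi>: "kernel \<Phi>"
begin

lemma PhiT_mollifier_of_kernel: "T > 0 \<Longrightarrow> mollifier T (PhiT \<Phi> T)"
  by (rule PhiT_mollifier[OF kernel_mollifier[OF \<Phi>]])

lemma PsiTn_mollifier_of_kernel: "T > 0 \<Longrightarrow> mollifier T (PsiTn \<Phi> T n)"
  by (rule PsiTn_mollifier[OF kernel_mollifier[OF \<Phi>]])

lemma PsiTn_Suc_flip:
  "T > 0 \<Longrightarrow> PsiTn \<Phi> T (Suc n) z = conv (PhiT \<Phi> (T / 2 ^ (n + 2))) (PsiTn \<Phi> T n) z"
  by (simp add: conv_commute mollifier_Cc[OF PhiT_mollifier_of_kernel]
      mollifier_Cc[OF PsiTn_mollifier_of_kernel])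

lemma PsiTn_lipschitz:
  assumes T: "T > 0"
  obtains \<Lambda> where "0 \<le> \<Lambda>" "\<And>n z w. \<bar>PsiTn \<Phi> T n z - PsiTn \<Phi> T n w\<bar> \<le> \<Lambda> * norm (z - w)"
proof -
  obtain \<Lambda> where \<Lambda>: "0 \<le> \<Lambda>" "\<And>z w. \<bar>PhiT \<Phi> (T / 2) z - PhiT \<Phi> (T / 2) w\<bar> \<le> \<Lambda> * norm (z - w)"
    using PhiT_lipschitz[OF \<Phi>, of "T / 2"] T by (metis half_gt_zero)
  have "\<bar>PsiTn \<Phi> T n z - PsiTn \<Phi> T n w\<bar> \<le> \<Lambda> * norm (z - w)" for n z w
  proof (induction n arbitrary: z w)
    case 0 then show ?case using \<Lambda> by simp
  next
    case (Suc n)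
    have "T / 2 ^ (n + 2) > 0" using T by simp
    then show ?case unfolding PsiTn_Suc_flip[OF T]
      by (rule conv_lipschitz[OF PhiT_mollifier_of_kernel
            mollifierD(2)[OF PsiTn_mollifier_of_kernel[OF T]] Suc])
  qed
  with \<Lambda>(1) show thesis by (rule that)
qed

lemma PsiTn_increment:
  assumes T: "T > 0"
  obtains M where "\<And>n z. \<bar>PsiTn \<Phi> T (Suc n) z - PsiTn \<Phi> T n z\<bar> \<le> M * (1 / 2) ^ n"
proof -
  obtain \<Lambda> where \<Lambda>: "0 \<le> \<Lambda>" "\<And>n z w. \<bar>PsiTn \<Phi> T n z - PsiTn \<Phi> T n w\<bar> \<le> \<Lambda> * norm (z - w)"
    using PsiTn_lipschitz[OF T] by metis
  have "\<bar>PsiTn \<Phi> T (Suc n) z - PsiTn \<Phi> T n z\<bar> \<le> (\<Lambda> * (T\<^sup>2 + 2 * T)) * (1 / 2) ^ n" for n z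
  proof -
    define s where "s = T / 2 ^ (n + 2)"
    have s: "0 < s" "s \<le> T * (1 / 2) ^ n" "s \<le> T"
      using T one_le_power[of "2::real" "n + 2"] by (auto simp: s_def field_simps)
    have "s * s \<le> T * (T * (1 / 2) ^ n)" using s by (intro mult_mono) auto
    then have "s\<^sup>2 + 2 * s \<le> (T\<^sup>2 + 2 * T) * (1 / 2) ^ n"
      using s(2) by (simp add: power2_eq_square algebra_simps)
    then have "\<Lambda> * (s\<^sup>2 + 2 * s) \<le> \<Lambda> * ((T\<^sup>2 + 2 * T) * (1 / 2) ^ n)"
      using \<Lambda>(1) by (rule mult_left_mono)
    moreover have "\<bar>PsiTn \<Phi> T (Suc n) z - PsiTn \<Phi> T n z\<bar> \<le> \<Lambda> * (s\<^sup>2 + 2 * s)"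
      unfolding PsiTn_Suc_flip[OF T] s_def
      by (rule conv_lipschitz_close[OF PhiT_mollifier_of_kernel
            mollifierD(2)[OF PsiTn_mollifier_of_kernel[OF T]] \<Lambda>]) (use T in simp)
    ultimately show ?thesis by (simp add: mult.assoc)
  qed
  then show thesis by (rule that)
qed

lemma PsiTn_uniform_limit:
  assumes T: "T > 0" shows "uniform_limit UNIV (PsiTn \<Phi> T) (PsiT \<Phi> T) sequentially"
proof -
  define d where "d = (\<lambda>n z. PsiTn \<Phi> T (Suc n) z - PsiTn \<Phi> T n z)"
  obtain M where M: "\<And>n z. \<bar>d n z\<bar> \<le> M * (1 / 2) ^ n"
    using PsiTn_increment[OF T] unfolding d_def by metis
  define \<Psi> where "\<Psi> = (\<lambda>z. PsiTn \<Phi> T 0 z + (\<Sum>i. d i z))"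
  have "uniform_limit UNIV (\<lambda>n z. \<Sum>i<n. d i z) (\<lambda>z. \<Sum>i. d i z) sequentially"
    by (rule Weierstrass_m_test[where M="\<lambda>n. M * (1 / 2) ^ n"])
       (use M in \<open>auto intro: summable_mult summable_geometric\<close>)
  then have "uniform_limit UNIV (\<lambda>n z. PsiTn \<Phi> T 0 z + (\<Sum>i<n. d i z)) \<Psi> sequentially"
    unfolding \<Psi>_def by (intro uniform_limit_add uniform_limit_const)
  moreover have "PsiTn \<Phi> T 0 z + (\<Sum>i<n. d i z) = PsiTn \<Phi> T n z" for n z
    unfolding d_def by (induction n) (simp_all del: PsiTn.simps)
  ultimately have lim: "uniform_limit UNIV (PsiTn \<Phi> T) \<Psi> sequentially" by (simp only:)
  have "PsiT \<Phi> T = \<Psi>"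
    unfolding PsiT_def using limI[OF tendsto_uniform_limitI[OF lim]] by auto
  with lim show ?thesis by simp
qed

lemma PsiTn_tendsto: "T > 0 \<Longrightarrow> (\<lambda>n. PsiTn \<Phi> T n z) \<longlonglongrightarrow> PsiT \<Phi> T z"
  using tendsto_uniform_limitI[OF PsiTn_uniform_limit] by simp

lemma PsiT_mollifier: "T > 0 \<Longrightarrow> mollifier T (PsiT \<Phi> T)"
  using mollifier_uniform_limit[OF PsiTn_mollifier_of_kernel PsiTn_uniform_limit] .

lemma PsiT_Cc: "T > 0 \<Longrightarrow> Cc (PsiT \<Phi> T)"
  by (rule mollifier_Cc[OF PsiT_mollifier])

lemma PsiTn_Suc_left:
  assumes T: "T > 0"
  shows "PsiTn \<Phi> T (Suc n) = conv (PhiT \<Phi> (T / 2)) (PsiTn \<Phi> (T / 2) n)"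
proof (induction n)
  case 0 show ?case by simp
next
  case (Suc n)
  have s: "T / 2 > 0" "T / 2 ^ (n + 3) > 0" using T by auto
  have "PsiTn \<Phi> T (Suc (Suc n))
      = conv (conv (PhiT \<Phi> (T / 2)) (PsiTn \<Phi> (T / 2) n)) (PhiT \<Phi> (T / 2 ^ (n + 3)))"
    unfolding PsiTn.simps(2)[of \<Phi> T "Suc n"] Suc by (simp add: eval_nat_numeral)
  also have "\<dots> = conv (PhiT \<Phi> (T / 2)) (conv (PsiTn \<Phi> (T / 2) n) (PhiT \<Phi> (T / 2 ^ (n + 3))))"
    using s by (intro ext conv_assoc mollifier_Cc[OF PhiT_mollifier_of_kernel]
        mollifier_Cc[OF PsiTn_mollifier_of_kernel] mollifierD(2)[OF PhiT_mollifier_of_kernel])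
  finally show ?case by (simp add: eval_nat_numeral)
qed

lemma PsiT_semigroup:
  assumes T: "T > 0" shows "PsiT \<Phi> T = conv (PhiT \<Phi> (T / 2)) (PsiT \<Phi> (T / 2))"
proof
  fix z
  have half_pos: "T / 2 > 0" using T by simp
  have "(\<lambda>n. conv (PhiT \<Phi> (T / 2)) (PsiTn \<Phi> (T / 2) n) z)
      \<longlonglongrightarrow> conv (PhiT \<Phi> (T / 2)) (PsiT \<Phi> (T / 2)) z"
    by (rule conv_uniform_limit[OF PhiT_mollifier_of_kernel[OF half_pos]
          mollifierD(2)[OF PsiTn_mollifier_of_kernel[OF half_pos]]
          mollifierD(2)[OF PsiT_mollifier[OF half_pos]]
          PsiTn_uniform_limit[OF half_pos]])
  moreover have "(\<lambda>n. PsiTn \<Phi> T (Suc n) z) \<longlonglongrightarrow> PsiT \<Phi> T z"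
    using PsiTn_tendsto[OF T] LIMSEQ_Suc by blast
  ultimately show "PsiT \<Phi> T z = conv (PhiT \<Phi> (T / 2)) (PsiT \<Phi> (T / 2)) z"
    unfolding PsiTn_Suc_left[OF T] using LIMSEQ_unique by blast
qed

lemma mollify_eq_conv: "mollify \<Phi> T f = conv (PsiT \<Phi> T) f"
  by (simp add: fun_eq_iff mollify_def)

lemma mollify_semigroup:
  assumes T: "T > 0" and f: "continuous_on UNIV f"
  shows "mollify \<Phi> T f z = conv (PhiT \<Phi> (T / 2)) (mollify \<Phi> (T / 2) f) z"
  unfolding mollify_eq_conv PsiT_semigroup[OF T]
  using T by (intro conv_assoc mollifier_Cc[OF PhiT_mollifier_of_kernel] PsiT_Cc f) auto

lemma continuous_on_mollify:
  "T > 0 \<Longrightarrow> continuous_on UNIV f \<Longrightarrow> continuous_on UNIV (mollify \<Phi> T f)"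
  unfolding mollify_eq_conv by (intro continuous_on_conv PsiT_Cc)

end

lemma conv_dil:
  assumes r: "r > 0" and f: "Cc f" and f': "Cc f'" and g: "continuous_on UNIV g"
    and scale: "\<And>y. f (dil r y) = f' y / r ^ 5"
  shows "conv f g (p + dil r z) = conv f' (\<lambda>y. g (p + dil r y)) z"
proof -
  note [continuous_intros] =
    continuous_on_compose2[OF Cc_continuous[OF f]] continuous_on_compose2[OF g]
  have "conv f g (p + dil r z) = (LINT y|lborel. f ((p + dil r z) - y) * g y)"
    by (rule conv_eq_LINT[OF f g])
  also have "\<dots> = r ^ 5 * (LINT y|lborel. f ((p + dil r z) - (p + dil r y)) * g (p + dil r y))"
    by (rule lborel_integral_dil[OF _ r])
       (intro borel_measurable_continuous_onI continuous_intros; simp)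
  also have "\<dots> = (LINT y|lborel. f' (z - y) * g (p + dil r y))"
    using r by (simp add: scale flip: dil_diff)
  also have "\<dots> = conv f' (\<lambda>y. g (p + dil r y)) z"
    by (rule conv_eq_LINT[OF f', symmetric]) (intro continuous_intros; simp)
  finally show ?thesis .
qed

context
  fixes \<Phi> :: "pt \<Rightarrow> real"
  assumes \<Phi>: "kernel \<Phi>"
begin

lemma PsiTn_dil:
  assumes r: "r > 0" and T: "T > 0"
  shows "PsiTn \<Phi> (r * T) n (dil r z) = PsiTn \<Phi> T n z / r ^ 5"
proof (induction n arbitrary: z)
  case 0 then show ?case using PhiT_dil[of r "T / 2"] assms by simp
next
  case (Suc n)
  have rT_pos: "r * T > 0" and scales_pos: "T / 2 ^ (n + 2) > 0" "r * T / 2 ^ (n + 2) > 0"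
    using r T by auto
  note Cc = mollifier_Cc[OF PsiTn_mollifier_of_kernel[OF \<Phi> rT_pos]]
    mollifier_Cc[OF PsiTn_mollifier_of_kernel[OF \<Phi> T]]
  have "PsiTn \<Phi> (r * T) (Suc n) (dil r z)
      = conv (PsiTn \<Phi> (r * T) n) (PhiT \<Phi> (r * T / 2 ^ (n + 2))) (0 + dil r z)" by simp
  also have "\<dots> = conv (PsiTn \<Phi> T n) (\<lambda>y. PhiT \<Phi> (r * T / 2 ^ (n + 2)) (0 + dil r y)) z"
    by (rule conv_dil[OF r Cc mollifierD(2)[OF PhiT_mollifier_of_kernel[OF \<Phi> scales_pos(2)]] Suc])
  also have "\<dots> = conv (PsiTn \<Phi> T n) (\<lambda>y. (1 / r ^ 5) * PhiT \<Phi> (T / 2 ^ (n + 2)) y) z"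
    using PhiT_dil[OF r scales_pos(1), of \<Phi>] by simp
  also have "\<dots> = PsiTn \<Phi> T (Suc n) z / r ^ 5" unfolding conv_cmult by simp
  finally show ?case .
qed

lemma PsiT_dil:
  assumes r: "r > 0" and T: "T > 0" shows "PsiT \<Phi> (r * T) (dil r z) = PsiT \<Phi> T z / r ^ 5"
proof -
  have "(\<lambda>n. PsiTn \<Phi> (r * T) n (dil r z)) \<longlonglongrightarrow> PsiT \<Phi> (r * T) (dil r z)"
    by (rule PsiTn_tendsto[OF \<Phi>]) (use r T in auto)
  moreover have "(\<lambda>n. PsiTn \<Phi> T n z / r ^ 5) \<longlonglongrightarrow> PsiT \<Phi> T z / r ^ 5"
    by (intro tendsto_divide tendsto_const PsiTn_tendsto[OF \<Phi> T]) (use r in auto)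
  ultimately show ?thesis unfolding PsiTn_dil[OF r T] using LIMSEQ_unique by blast
qed

lemma mollify_dil:
  assumes r: "r > 0" and T: "T > 0" and f: "continuous_on UNIV f"
  shows "mollify \<Phi> T (\<lambda>y. f (p + dil r y)) z = mollify \<Phi> (r * T) f (p + dil r z)"
  unfolding mollify_eq_conv[OF \<Phi>]
  by (rule conv_dil[OF r PsiT_Cc[OF \<Phi>] PsiT_Cc[OF \<Phi> T] f PsiT_dil[OF r T], symmetric])
     (use r T in simp)

end

text \<open>The gain of one derivative comes from the first factor of
  \<open>PsiT \<Phi> T = conv (PhiT \<Phi> (T / 2)) (PsiT \<Phi> (T / 2))\<close>.\<close>

definition mollify_lipschitz :: "(pt \<Rightarrow> real) \<Rightarrow> real \<Rightarrow> bool" where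
  "mollify_lipschitz \<Phi> \<Lambda> \<longleftrightarrow> 0 \<le> \<Lambda> \<and> (\<forall>T f z s i B. 0 < T \<longrightarrow> continuous_on UNIV f \<longrightarrow> \<bar>s\<bar> \<le> T \<longrightarrow>
    (\<forall>y\<in>past_cball z (2 * T). \<bar>mollify \<Phi> (T / 2) f y\<bar> \<le> B) \<longrightarrow>
    \<bar>mollify \<Phi> T f (z + s *\<^sub>R xdir i) - mollify \<Phi> T f z\<bar> \<le> \<Lambda> * B / T * \<bar>s\<bar>)"

lemma mollify_lipschitzD:
  assumes "mollify_lipschitz \<Phi> \<Lambda>" "0 < T" "continuous_on UNIV f" "\<bar>s\<bar> \<le> T"
    "\<And>y. y \<in> past_cball z (2 * T) \<Longrightarrow> \<bar>mollify \<Phi> (T / 2) f y\<bar> \<le> B"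
  shows "\<bar>mollify \<Phi> T f (z + s *\<^sub>R xdir i) - mollify \<Phi> T f z\<bar> \<le> \<Lambda> * B / T * \<bar>s\<bar>"
  using assms by (simp add: mollify_lipschitz_def)

lemma mollifier_difference_support:
  assumes \<phi>: "mollifier r \<phi>" and nz: "\<phi> (y + s *\<^sub>R xdir i) - \<phi> y \<noteq> 0" and q: "r + \<bar>s\<bar> \<le> q"
  shows "- y \<in> past_cball 0 q"
proof (cases "\<phi> y = 0")
  case True
  then have "- (y + s *\<^sub>R xdir i) \<in> past_cball 0 r"
    using nz mollifierD(4)[OF \<phi>, of "y + s *\<^sub>R xdir i"] by simp
  from add_xdir_in_past_cball[OF this q, of i] show ?thesis by simp
next
  case False
  from mollifierD(4)[OF \<phi> this] show ?thesis by (rule past_cball_mono) (use q in simp)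
qed

lemma mollify_lipschitz_exists:
  assumes \<Phi>: "kernel \<Phi>" obtains \<Lambda> where "mollify_lipschitz \<Phi> \<Lambda>"
proof -
  obtain \<Lambda> where \<Lambda>: "0 \<le> \<Lambda>"
    "\<And>T z w. T > 0 \<Longrightarrow> \<bar>PhiT \<Phi> T z - PhiT \<Phi> T w\<bar> \<le> \<Lambda> * norm (dil (1 / T) (z - w)) / T ^ 5"
    using PhiT_lipschitz_dil[OF \<Phi>] by metis
  have "\<bar>mollify \<Phi> T f (z + s *\<^sub>R xdir i) - mollify \<Phi> T f z\<bar> \<le> (2 ^ 14 * \<Lambda>) * B / T * \<bar>s\<bar>"
    if T: "0 < T" and f: "continuous_on UNIV f" and s: "\<bar>s\<bar> \<le> T"
      and B: "\<forall>y\<in>past_cball z (2 * T). \<bar>mollify \<Phi> (T / 2) f y\<bar> \<le> B" for T f z s i B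
  proof -
    have half_pos: "0 < T / 2" using T by simp
    define \<phi> where "\<phi> = PhiT \<Phi> (T / 2)"
    define g where "g = mollify \<Phi> (T / 2) f"
    define h where "h = s *\<^sub>R xdir i"
    have \<phi>: "mollifier (T / 2) \<phi>" unfolding \<phi>_def by (rule PhiT_mollifier_of_kernel[OF \<Phi> half_pos])
    have g: "continuous_on UNIV g" unfolding g_def by (rule continuous_on_mollify[OF \<Phi> half_pos f])
    note Cc = Cc_translate[OF mollifier_Cc[OF \<phi>], of h] mollifier_Cc[OF \<phi>]
    have supp: "- y \<in> past_cball 0 (2 * T)" if "\<phi> (y + h) - \<phi> y \<noteq> 0" for y
      by (rule mollifier_difference_support[OF \<phi> that[unfolded h_def]]) (use s T in simp)
    have "mollify \<Phi> T f (z + h) - mollify \<Phi> T f z = conv (\<lambda>y. \<phi> (y + h) - \<phi> y) g z"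
      unfolding mollify_semigroup[OF \<Phi> T f] conv_diff_left[OF Cc g] \<phi>_def[symmetric]
        g_def[symmetric]
      by (simp add: conv_translate_left[OF mollifier_Cc[OF \<phi>] g])
    also have "\<bar>\<dots>\<bar> \<le> \<Lambda> * (2 * \<bar>s\<bar> / T) / (T / 2) ^ 5 * B * (8 * (2 * T) ^ 5)"
    proof (rule abs_conv_le_measure[OF Cc_continuous[OF Cc_diff[OF Cc]] g _ supp])
      show "\<bar>\<phi> (y + h) - \<phi> y\<bar> \<le> \<Lambda> * (2 * \<bar>s\<bar> / T) / (T / 2) ^ 5" for y
        using \<Lambda>(2)[OF half_pos, of "y + h" y] T
        by (simp add: \<phi>_def h_def dil_xdir abs_mult) (simp add: xdir_def norm_Pair)
    qed (use T B in \<open>simp_all add: g_def\<close>)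
    also have "\<dots> = (2 ^ 14 * \<Lambda>) * B / T * \<bar>s\<bar>" using T by (simp add: field_simps eval_nat_numeral)
    finally show ?thesis by (simp add: h_def)
  qed
  with \<Lambda>(1) have "mollify_lipschitz \<Phi> (2 ^ 14 * \<Lambda>)" by (auto simp: mollify_lipschitz_def)
  then show thesis by (rule that)
qed

section \<open>Functions with one time and two space derivatives\<close>

definition has_pdv :: "pt \<Rightarrow> (pt \<Rightarrow> real) \<Rightarrow> (pt \<Rightarrow> real) \<Rightarrow> bool" where
  "has_pdv e f g \<longleftrightarrow> (\<forall>z. ((\<lambda>s. f (z + s *\<^sub>R e)) has_real_derivative g z) (at 0))"

definition pdv :: "pt \<Rightarrow> (pt \<Rightarrow> real) \<Rightarrow> pt \<Rightarrow> real" where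
  "pdv e f z = deriv (\<lambda>s. f (z + s *\<^sub>R e)) 0"

lemma has_pdv_imp_pdv: "has_pdv e f g \<Longrightarrow> pdv e f = g"
  unfolding has_pdv_def pdv_def by (intro ext DERIV_imp_deriv) auto

lemma has_pdv_at:
  assumes "has_pdv e f g"
  shows "((\<lambda>s. f (z + s *\<^sub>R e)) has_real_derivative g (z + s\<^sub>0 *\<^sub>R e)) (at s\<^sub>0)"
proof -
  have "((\<lambda>s. f ((z + s\<^sub>0 *\<^sub>R e) + s *\<^sub>R e)) has_real_derivative g (z + s\<^sub>0 *\<^sub>R e)) (at 0)"
    using assms by (simp add: has_pdv_def)
  moreover have "(\<lambda>s. f ((z + s\<^sub>0 *\<^sub>R e) + s *\<^sub>R e)) = (\<lambda>s. f (z + (s + s\<^sub>0) *\<^sub>R e))"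
    by (simp add: algebra_simps)
  ultimately show ?thesis
    using DERIV_shift[of "\<lambda>s. f (z + s *\<^sub>R e)" "g (z + s\<^sub>0 *\<^sub>R e)" 0 s\<^sub>0] by simp
qed

lemma has_pdv_at_reflected:
  assumes "has_pdv e f g"
  shows "((\<lambda>s. f (z - s *\<^sub>R e)) has_real_derivative - g (z - s\<^sub>0 *\<^sub>R e)) (at s\<^sub>0)"
proof -
  have "((\<lambda>s. f (z + (- s) *\<^sub>R e)) has_real_derivative g (z + (- s\<^sub>0) *\<^sub>R e) * -1) (at s\<^sub>0)"
    by (rule DERIV_chain2[where f="\<lambda>s. f (z + s *\<^sub>R e)", OF has_pdv_at[OF assms]])
       (auto intro!: derivative_eq_intros)
  then show ?thesis by simp
qed

lemma has_pdv_const: "has_pdv e (\<lambda>_. c) (\<lambda>_. 0)"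
  by (simp add: has_pdv_def)

lemma has_pdv_add: "has_pdv e f f' \<Longrightarrow> has_pdv e g g' \<Longrightarrow> has_pdv e (\<lambda>z. f z + g z) (\<lambda>z. f' z + g' z)"
  by (simp add: has_pdv_def DERIV_add)

lemma has_pdv_diff: "has_pdv e f f' \<Longrightarrow> has_pdv e g g' \<Longrightarrow> has_pdv e (\<lambda>z. f z - g z) (\<lambda>z. f' z - g' z)"
  by (simp add: has_pdv_def DERIV_diff)

lemma has_pdv_cmult: "has_pdv e f f' \<Longrightarrow> has_pdv e (\<lambda>z. c * f z) (\<lambda>z. c * f' z)"
  by (simp add: has_pdv_def DERIV_cmult)

lemma has_pdv_dil:
  assumes f: "has_pdv e f f'" and e: "\<And>s. dil r (s *\<^sub>R e) = (q * s) *\<^sub>R e"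
  shows "has_pdv e (\<lambda>z. f (p + dil r z)) (\<lambda>z. q * f' (p + dil r z))"
  unfolding has_pdv_def
proof
  fix z
  have "((\<lambda>s. f ((p + dil r z) + (q * s) *\<^sub>R e)) has_real_derivative f' (p + dil r z) * q) (at 0)"
    by (rule DERIV_chain2[where g="\<lambda>s. q * s" and f="\<lambda>s. f ((p + dil r z) + s *\<^sub>R e)"])
      (use f in \<open>auto simp: has_pdv_def intro!: derivative_eq_intros\<close>)
  then show "((\<lambda>s. f (p + dil r (z + s *\<^sub>R e))) has_real_derivative q * f' (p + dil r z)) (at 0)"
    by (simp add: dil_add e add.assoc mult.commute)
qed

lemma has_pdv_conv:
  assumes \<psi>: "Cc \<psi>" and p: "has_pdv e f g" and f: "continuous_on UNIV f"
    and g: "continuous_on UNIV g"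
  shows "has_pdv e (conv \<psi> f) (conv \<psi> g)"
  unfolding has_pdv_def
proof
  fix z
  obtain a b where ab: "\<And>y. y \<notin> cbox a b \<Longrightarrow> \<psi> y = 0" using Cc_support_cbox[OF \<psi>] by blast
  note [continuous_intros] = continuous_on_compose2[OF Cc_continuous[OF \<psi>]]
    continuous_on_compose2[OF f] continuous_on_compose2[OF g]
  have "((\<lambda>s. integral (cbox a b) (\<lambda>y. \<psi> y * f (z + s *\<^sub>R e - y))) has_field_derivative
      integral (cbox a b) (\<lambda>y. \<psi> y * g (z + 0 *\<^sub>R e - y))) (at 0 within UNIV)"
  proof (rule leibniz_rule_field_derivative[where fx="\<lambda>s y. \<psi> y * g (z + s *\<^sub>R e - y)"])
    fix s :: real and y
    have "((\<lambda>s. f ((z - y) + s *\<^sub>R e)) has_real_derivative g ((z - y) + s *\<^sub>R e)) (at s)"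
      by (rule has_pdv_at[OF p])
    from DERIV_cmult[OF this, of "\<psi> y"]
    show "((\<lambda>s. \<psi> y * f (z + s *\<^sub>R e - y)) has_real_derivative \<psi> y * g (z + s *\<^sub>R e - y))
        (at s within UNIV)" by (simp add: algebra_simps)
  qed (auto intro!: integrable_continuous continuous_intros simp: split_beta)
  then show "((\<lambda>s. conv \<psi> f (z + s *\<^sub>R e)) has_real_derivative conv \<psi> g z) (at 0)"
    by (simp add: conv_cbox[OF \<psi> f ab] conv_cbox[OF \<psi> g ab])
qed

lemma has_pdv_smooth: "smooth f \<Longrightarrow> has_pdv e f (\<lambda>z. frechet_derivative f (at z) e)"
  unfolding has_pdv_def
proof
  fix z assume f: "smooth f"
  have "(f has_derivative frechet_derivative f (at z)) (at (z + 0 *\<^sub>R e))"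
    using smooth_has_derivative[OF f] by simp
  then have "((\<lambda>s. f (z + s *\<^sub>R e)) has_derivative (\<lambda>s. frechet_derivative f (at z) (s *\<^sub>R e)))
      (at 0)"
    by (rule has_derivative_compose[rotated]) (auto intro!: derivative_eq_intros)
  moreover have "linear (frechet_derivative f (at z))"
    using smooth_differentiable[OF f] by (simp add: linear_frechet_derivative)
  ultimately show "((\<lambda>s. f (z + s *\<^sub>R e)) has_real_derivative frechet_derivative f (at z) e) (at 0)"
    by (simp add: has_field_derivative_def linear_cmul mult_commute_abs)
qed

definition has_C12 ::
  "(pt \<Rightarrow> real) \<Rightarrow> (pt \<Rightarrow> real) \<Rightarrow> (3 \<Rightarrow> pt \<Rightarrow> real) \<Rightarrow> (3 \<Rightarrow> 3 \<Rightarrow> pt \<Rightarrow> real) \<Rightarrow> bool" where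
  "has_C12 f f\<^sub>t f\<^sub>x f\<^sub>x\<^sub>x \<longleftrightarrow> continuous_on UNIV f \<and> has_pdv tdir f f\<^sub>t \<and> continuous_on UNIV f\<^sub>t
    \<and> (\<forall>i. has_pdv (xdir i) f (f\<^sub>x i) \<and> continuous_on UNIV (f\<^sub>x i))
    \<and> (\<forall>i j. has_pdv (xdir j) (f\<^sub>x i) (f\<^sub>x\<^sub>x i j) \<and> continuous_on UNIV (f\<^sub>x\<^sub>x i j))"

definition C12 :: "(pt \<Rightarrow> real) \<Rightarrow> bool" where
  "C12 f \<longleftrightarrow> (\<exists>f\<^sub>t f\<^sub>x f\<^sub>x\<^sub>x. has_C12 f f\<^sub>t f\<^sub>x f\<^sub>x\<^sub>x)"

definition heat_op :: "(pt \<Rightarrow> real) \<Rightarrow> pt \<Rightarrow> real" where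
  "heat_op f z = pdv tdir f z - (\<Sum>i\<in>UNIV. pdv (xdir i) (pdv (xdir i) f) z)"

lemma has_C12D:
  assumes "has_C12 f f\<^sub>t f\<^sub>x f\<^sub>x\<^sub>x"
  shows "pdv tdir f = f\<^sub>t" and "pdv (xdir i) f = f\<^sub>x i"
    and "pdv (xdir j) (pdv (xdir i) f) = f\<^sub>x\<^sub>x i j"
    and "heat_op f z = f\<^sub>t z - (\<Sum>i\<in>UNIV. f\<^sub>x\<^sub>x i i z)" and "C12 f"
proof -
  show t: "pdv tdir f = f\<^sub>t" using assms by (intro has_pdv_imp_pdv) (simp add: has_C12_def)
  have x: "pdv (xdir i) f = f\<^sub>x i" for i
    using assms by (intro has_pdv_imp_pdv) (simp add: has_C12_def)
  have xx: "pdv (xdir j) (f\<^sub>x i) = f\<^sub>x\<^sub>x i j" for i j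
    using assms by (intro has_pdv_imp_pdv) (simp add: has_C12_def)
  show "pdv (xdir i) f = f\<^sub>x i" "pdv (xdir j) (pdv (xdir i) f) = f\<^sub>x\<^sub>x i j"
    "heat_op f z = f\<^sub>t z - (\<Sum>i\<in>UNIV. f\<^sub>x\<^sub>x i i z)" by (simp_all add: heat_op_def t x xx)
  show "C12 f" using assms C12_def by blast
qed

lemma C12_has_C12:
  assumes "C12 f"
  shows "has_C12 f (pdv tdir f) (\<lambda>i. pdv (xdir i) f) (\<lambda>i j. pdv (xdir j) (pdv (xdir i) f))"
proof -
  obtain f\<^sub>t f\<^sub>x f\<^sub>x\<^sub>x where f: "has_C12 f f\<^sub>t f\<^sub>x f\<^sub>x\<^sub>x" using assms C12_def by blast
  then show ?thesis unfolding has_C12D(3)[OF f] unfolding has_C12D(1,2)[OF f] .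
qed

lemma C12D:
  assumes "C12 f"
  shows "continuous_on UNIV f" and "has_pdv tdir f (pdv tdir f)"
    and "continuous_on UNIV (pdv tdir f)"
    and "has_pdv (xdir i) f (pdv (xdir i) f)" and "continuous_on UNIV (pdv (xdir i) f)"
    and "has_pdv (xdir j) (pdv (xdir i) f) (pdv (xdir j) (pdv (xdir i) f))"
    and "continuous_on UNIV (pdv (xdir j) (pdv (xdir i) f))"
  using C12_has_C12[OF assms] unfolding has_C12_def by blast+

lemma continuous_on_heat_op: "C12 f \<Longrightarrow> continuous_on UNIV (heat_op f)"
  unfolding heat_op_def[abs_def] by (intro continuous_intros C12D)

lemma has_C12_const: "has_C12 (\<lambda>_. c) (\<lambda>_. 0) (\<lambda>_ _. 0) (\<lambda>_ _ _. 0)"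
  by (simp add: has_C12_def has_pdv_const)

lemma has_C12_add:
  "has_C12 f f\<^sub>t f\<^sub>x f\<^sub>x\<^sub>x \<Longrightarrow> has_C12 g g\<^sub>t g\<^sub>x g\<^sub>x\<^sub>x \<Longrightarrow> has_C12 (\<lambda>z. f z + g z) (\<lambda>z. f\<^sub>t z + g\<^sub>t z)
    (\<lambda>i z. f\<^sub>x i z + g\<^sub>x i z) (\<lambda>i j z. f\<^sub>x\<^sub>x i j z + g\<^sub>x\<^sub>x i j z)"
  by (simp add: has_C12_def has_pdv_add continuous_on_add)

lemma has_C12_diff:
  "has_C12 f f\<^sub>t f\<^sub>x f\<^sub>x\<^sub>x \<Longrightarrow> has_C12 g g\<^sub>t g\<^sub>x g\<^sub>x\<^sub>x \<Longrightarrow> has_C12 (\<lambda>z. f z - g z) (\<lambda>z. f\<^sub>t z - g\<^sub>t z)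
    (\<lambda>i z. f\<^sub>x i z - g\<^sub>x i z) (\<lambda>i j z. f\<^sub>x\<^sub>x i j z - g\<^sub>x\<^sub>x i j z)"
  by (simp add: has_C12_def has_pdv_diff continuous_on_diff)

lemma has_C12_cmult:
  "has_C12 f f\<^sub>t f\<^sub>x f\<^sub>x\<^sub>x \<Longrightarrow>
    has_C12 (\<lambda>z. c * f z) (\<lambda>z. c * f\<^sub>t z) (\<lambda>i z. c * f\<^sub>x i z) (\<lambda>i j z. c * f\<^sub>x\<^sub>x i j z)"
  by (simp add: has_C12_def has_pdv_cmult continuous_on_mult)

lemma has_C12_dil:
  assumes "has_C12 f f\<^sub>t f\<^sub>x f\<^sub>x\<^sub>x"
  shows "has_C12 (\<lambda>z. f (p + dil r z)) (\<lambda>z. r\<^sup>2 * f\<^sub>t (p + dil r z)) (\<lambda>i z. r * f\<^sub>x i (p + dil r z))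
    (\<lambda>i j z. r * (r * f\<^sub>x\<^sub>x i j (p + dil r z)))"
proof -
  have "continuous_on UNIV (\<lambda>z. g (p + dil r z))" if "continuous_on UNIV g" for g :: "pt \<Rightarrow> real"
    by (intro continuous_on_compose2[OF that] continuous_intros) auto
  then show ?thesis
    using assms unfolding has_C12_def
    by (auto intro!: continuous_intros has_pdv_cmult has_pdv_dil[OF _ dil_tdir]
        has_pdv_dil[OF _ dil_xdir])
qed

lemma has_C12_translate:
  "has_C12 f f\<^sub>t f\<^sub>x f\<^sub>x\<^sub>x \<Longrightarrow> has_C12 (\<lambda>z. f (z + p)) (\<lambda>z. f\<^sub>t (z + p)) (\<lambda>i z. f\<^sub>x i (z + p))
    (\<lambda>i j z. f\<^sub>x\<^sub>x i j (z + p))"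
  using has_C12_dil[of f f\<^sub>t f\<^sub>x f\<^sub>x\<^sub>x p 1] by (simp add: add.commute)

lemma has_C12_conv:
  "Cc \<psi> \<Longrightarrow> has_C12 f f\<^sub>t f\<^sub>x f\<^sub>x\<^sub>x \<Longrightarrow>
    has_C12 (conv \<psi> f) (conv \<psi> f\<^sub>t) (\<lambda>i. conv \<psi> (f\<^sub>x i)) (\<lambda>i j. conv \<psi> (f\<^sub>x\<^sub>x i j))"
  by (simp add: has_C12_def has_pdv_conv continuous_on_conv)

lemma has_C12_linear:
  "has_C12 (\<lambda>y. \<Sum>i\<in>UNIV. a i * snd (y - p) $ i) (\<lambda>_. 0) (\<lambda>i _. a i) (\<lambda>_ _ _. 0)"
proof -
  have "(\<Sum>i\<in>UNIV. a i * snd (z + s *\<^sub>R xdir j - p) $ i)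
      = (\<Sum>i\<in>UNIV. a i * snd (z - p) $ i) + a j * s"
    for z s j
  proof -
    have "(\<Sum>i\<in>UNIV. a i * snd (z + s *\<^sub>R xdir j - p) $ i)
        = (\<Sum>i\<in>UNIV. a i * snd (z - p) $ i) + (\<Sum>i\<in>UNIV. a i * snd (s *\<^sub>R xdir j) $ i)"
      by (simp add: algebra_simps sum.distrib sum_subtractf)
    then show ?thesis by (simp only: sum_mult_xdir)
  qed
  then have "has_pdv (xdir j) (\<lambda>y. \<Sum>i\<in>UNIV. a i * snd (y - p) $ i) (\<lambda>_. a j)" for j
    unfolding has_pdv_def by (auto intro!: derivative_eq_intros)
  moreover have "has_pdv tdir (\<lambda>y. \<Sum>i\<in>UNIV. a i * snd (y - p) $ i) (\<lambda>_. 0)"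
    by (simp add: has_pdv_def)
  ultimately show ?thesis by (auto simp: has_C12_def has_pdv_const intro!: continuous_intros)
qed

lemma heat_op_diff: "C12 f \<Longrightarrow> C12 g \<Longrightarrow> heat_op (\<lambda>z. f z - g z) z = heat_op f z - heat_op g z"
  using has_C12D(4)[OF has_C12_diff[OF C12_has_C12 C12_has_C12], of f g z]
  by (simp add: heat_op_def sum_subtractf)

lemma heat_op_cmult: "C12 f \<Longrightarrow> heat_op (\<lambda>z. c * f z) z = c * heat_op f z"
  using has_C12D(4)[OF has_C12_cmult[OF C12_has_C12], of f c z]
  by (simp add: heat_op_def sum_distrib_left right_diff_distrib)

lemma heat_op_dil: "C12 f \<Longrightarrow> heat_op (\<lambda>z. f (p + dil r z)) z = r\<^sup>2 * heat_op f (p + dil r z)"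
  using has_C12D(4)[OF has_C12_dil[OF C12_has_C12], of f p r z]
  by (simp add: heat_op_def power2_eq_square right_diff_distrib sum_distrib_left mult.assoc)

lemma heat_op_conv:
  assumes \<psi>: "Cc \<psi>" and f: "C12 f" shows "heat_op (conv \<psi> f) z = conv \<psi> (heat_op f) z"
proof -
  have "conv \<psi> (heat_op f) z = conv \<psi> (pdv tdir f) z
      - (\<Sum>i\<in>UNIV. conv \<psi> (pdv (xdir i) (pdv (xdir i) f)) z)"
    unfolding heat_op_def[abs_def]
    by (simp add: conv_diff[OF \<psi> C12D(3)[OF f]] conv_sum[OF \<psi>] C12D(7)[OF f] continuous_on_sum)
  then show ?thesis
    using has_C12D(4)[OF has_C12_conv[OF \<psi> C12_has_C12[OF f]]] by simp
qed

lemmas C12_diff = has_C12_diff[OF C12_has_C12 C12_has_C12, THEN has_C12D(5)]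
lemmas C12_cmult = has_C12_cmult[OF C12_has_C12, THEN has_C12D(5)]
lemmas C12_dil = has_C12_dil[OF C12_has_C12, THEN has_C12D(5)]
lemmas C12_conv = has_C12_conv[OF _ C12_has_C12, THEN has_C12D(5)]

lemma smooth_has_C12:
  assumes f: "smooth f" shows "has_C12 f (dt f) (\<lambda>i. dx i f) (\<lambda>i j. dx j (dx i f))"
proof -
  let ?D = "\<lambda>e f z. frechet_derivative f (at z) e"
  have Basis: "tdir \<in> Basis" "xdir i \<in> Basis" for i
    by (auto simp: tdir_def xdir_def Basis_prod_def axis_in_Basis_iff)
  have dt_dx_eq: "dt f = ?D tdir f" "dx i g = ?D (xdir i) g" for i g
    by (auto simp: dt_def dx_def tdir_def xdir_def)
  have "smooth (?D tdir f)" "smooth (?D (xdir i) f)" "smooth (?D (xdir j) (?D (xdir i) f))" for i j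
    using f smooth_frechet_derivative[OF _ Basis(1)] smooth_frechet_derivative[OF _ Basis(2)]
    by auto
  then show ?thesis
    unfolding has_C12_def dt_dx_eq using f by (auto intro!: has_pdv_smooth smooth_continuous)
qed

lemma smooth_C12: "smooth f \<Longrightarrow> C12 f"
  by (rule has_C12D(5)[OF smooth_has_C12])

lemma smooth_heat_op: "smooth f \<Longrightarrow> heat_op f z = heat f z"
  by (simp add: has_C12D(4)[OF smooth_has_C12] heat_def lap_def)

definition taylor_rem :: "(pt \<Rightarrow> real) \<Rightarrow> pt \<Rightarrow> pt \<Rightarrow> real" where
  "taylor_rem f y z = f y - f z - (\<Sum>i\<in>UNIV. pdv (xdir i) f z * snd (y - z) $ i)"

lemma taylor_rem_self [simp]: "taylor_rem f z z = 0"
  by (simp add: taylor_rem_def)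

lemma continuous_on_taylor_rem:
  assumes "C12 f" "continuous_on S g" "continuous_on S h"
  shows "continuous_on S (\<lambda>x. taylor_rem f (g x) (h x))"
  unfolding taylor_rem_def
  by (intro continuous_intros assms(2,3) continuous_on_compose2[OF C12D(1)[OF assms(1)]]
      continuous_on_compose2[OF C12D(5)[OF assms(1)]]) auto

lemma has_C12_taylor_rem:
  assumes "C12 f"
  shows "has_C12 (\<lambda>y. taylor_rem f y p) (pdv tdir f) (\<lambda>i z. pdv (xdir i) f z - pdv (xdir i) f p)
    (\<lambda>i j. pdv (xdir j) (pdv (xdir i) f))"
  unfolding taylor_rem_def
  using has_C12_diff[OF has_C12_diff[OF C12_has_C12[OF assms] has_C12_const] has_C12_linear] by simp

lemma taylor_rem_cmult_dil:
  assumes "C12 f"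
  shows "taylor_rem (\<lambda>z. c * f (p + dil r z)) y z = c * taylor_rem f (p + dil r y) (p + dil r z)"
proof -
  have pdv: "pdv (xdir i) (\<lambda>z. c * f (p + dil r z)) z = c * (r * pdv (xdir i) f (p + dil r z))"
    for i
    using has_C12D(2)[OF has_C12_cmult[OF has_C12_dil[OF C12_has_C12[OF assms]]]] by simp
  have snd: "snd (p + dil r y - (p + dil r z)) $ i = r * snd (y - z) $ i" for i
    by (simp add: dil_def algebra_simps)
  show ?thesis unfolding taylor_rem_def pdv snd by (simp add: algebra_simps sum_distrib_left)
qed

section \<open>Interior estimates for the heat operator\<close>

lemma deriv_nonneg_at_left_max:
  fixes g :: "real \<Rightarrow> real"
  assumes "(g has_real_derivative d) (at 0)" "\<eta> > 0" "\<And>s. - \<eta> \<le> s \<Longrightarrow> s \<le> 0 \<Longrightarrow> g s \<le> g 0"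
  shows "0 \<le> d"
proof (rule ccontr)
  assume "\<not> 0 \<le> d"
  then obtain \<delta> where \<delta>: "\<delta> > 0" "\<And>h. h > 0 \<Longrightarrow> h < \<delta> \<Longrightarrow> g 0 < g (0 - h)"
    using DERIV_neg_dec_left[OF assms(1)] by (metis linorder_not_le)
  have "g 0 < g (0 - min (\<delta> / 2) \<eta>)" using \<delta> assms(2) by (intro \<delta>(2)) auto
  moreover have "g (0 - min (\<delta> / 2) \<eta>) \<le> g 0" using \<delta> assms(2) by (intro assms(3)) auto
  ultimately show False by simp
qed

lemma second_deriv_nonpos_at_max:
  fixes g :: "real \<Rightarrow> real"
  assumes g': "\<And>s. (g has_real_derivative g' s) (at s)" and g'': "(g' has_real_derivative d) (at a)"
    and "\<eta> > 0" and max: "\<And>s. \<bar>s - a\<bar> < \<eta> \<Longrightarrow> g s \<le> g a"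
  shows "d \<le> 0"
proof (rule ccontr)
  assume "\<not> d \<le> 0"
  have "g' a = 0"
    by (rule DERIV_local_max[OF g' \<open>\<eta> > 0\<close>]) (use max in \<open>auto simp: abs_minus_commute\<close>)
  with \<open>\<not> d \<le> 0\<close> obtain \<delta> where \<delta>: "\<delta> > 0" "\<And>h. h > 0 \<Longrightarrow> h < \<delta> \<Longrightarrow> 0 < g' (a + h)"
    using DERIV_pos_inc_right[OF g''] by (metis linorder_not_le)
  define h where "h = min (\<delta> / 2) (\<eta> / 2)"
  have h: "0 < h" "h < \<delta>" "h < \<eta>" using \<delta>(1) \<open>\<eta> > 0\<close> by (auto simp: h_def min_def)
  obtain \<xi> where \<xi>: "a < \<xi>" "\<xi> < a + h" "g (a + h) - g a = (a + h - a) * g' \<xi>"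
    using MVT2[of a "a + h" g g'] h(1) g' by auto
  moreover have "0 < h * g' \<xi>" using \<delta>(2)[of "\<xi> - a"] \<xi>(1,2) h by (intro mult_pos_pos) auto
  ultimately show False using max[of "a + h"] h by simp
qed

definition paraboloid :: "pt \<Rightarrow> pt \<Rightarrow> real" where
  "paraboloid p z = (snd z - snd p) \<bullet> (snd z - snd p) - (fst z - fst p)"

lemma paraboloid_self [simp]: "paraboloid z z = 0"
  by (simp add: paraboloid_def)

lemma paraboloid_nonneg: assumes "z \<in> past_cball p L" shows "0 \<le> paraboloid p z"
proof -
  have "fst z \<le> fst p" using assms by (simp add: mem_past_cball)
  then show ?thesis
    using inner_ge_zero[of "snd z - snd p"] unfolding paraboloid_def by linarith
qed

lemma paraboloid_less_imp_interior:
  assumes z: "z \<in> past_cball p L" and less: "paraboloid p z < L\<^sup>2"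
  shows "fst p - L\<^sup>2 < fst z" and "infnorm (snd z - snd p) < L"
proof -
  have nonneg: "0 \<le> L" "0 \<le> (snd z - snd p) \<bullet> (snd z - snd p)" "fst z \<le> fst p"
    using z by (auto simp: mem_past_cball_iff_box)
  with less show "fst p - L\<^sup>2 < fst z" unfolding paraboloid_def by linarith
  have "(norm (snd z - snd p))\<^sup>2 < L\<^sup>2"
    using less nonneg unfolding paraboloid_def power2_norm_eq_inner by linarith
  then have "norm (snd z - snd p) < L" using nonneg(1) by (rule power_less_imp_less_base)
  then show "infnorm (snd z - snd p) < L" using infnorm_le_norm[of "snd z - snd p"] by linarith
qed

lemma has_C12_paraboloid:
  "has_C12 (paraboloid p) (\<lambda>_. -1) (\<lambda>i z. 2 * (snd z - snd p) $ i) (\<lambda>i j _. if i = j then 2 else 0)"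
proof -
  have expand: "paraboloid p (z + s *\<^sub>R xdir i)
      = paraboloid p z + 2 * (snd z - snd p) $ i * s + s\<^sup>2"
    for z s i
  proof -
    have "(w + s *\<^sub>R axis i 1) \<bullet> (w + s *\<^sub>R axis i 1) = w \<bullet> w + 2 * w $ i * s + s\<^sup>2"
      for w :: "real^3"
      by (simp add: inner_add inner_axis_axis inner_axis inner_commute[of "axis i 1" w]
          power2_eq_square distrib_left)
    from this[of "snd z - snd p"] show ?thesis by (simp add: paraboloid_def algebra_simps)
  qed
  have "has_pdv (xdir i) (paraboloid p) (\<lambda>z. 2 * (snd z - snd p) $ i)" for i
    unfolding has_pdv_def expand by (auto intro!: derivative_eq_intros)
  moreover have "has_pdv tdir (paraboloid p) (\<lambda>_. -1)"
    unfolding has_pdv_def paraboloid_def by (auto intro!: derivative_eq_intros)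
  moreover have "has_pdv (xdir j) (\<lambda>z. 2 * (snd z - snd p) $ i) (\<lambda>_. if i = j then 2 else 0)"
    for i j
    unfolding has_pdv_def by (auto intro!: derivative_eq_intros simp: axis_def)
  ultimately show ?thesis
    by (auto simp: has_C12_def paraboloid_def[abs_def] intro!: continuous_intros)
qed

lemma derivatives_at_max_past_cball:
  assumes f: "C12 f" and z: "z \<in> past_cball p L" and max: "\<And>y. y \<in> past_cball p L \<Longrightarrow> f y \<le> f z"
    and less: "paraboloid p z < L\<^sup>2"
  shows "0 \<le> pdv tdir f z" and "pdv (xdir i) (pdv (xdir i) f) z \<le> 0"
proof -
  note interior = paraboloid_less_imp_interior[OF z less]
  note box = mem_past_cball_iff_box
  show "0 \<le> pdv tdir f z"
  proof (rule deriv_nonneg_at_left_max)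
    show "((\<lambda>s. f (z + s *\<^sub>R tdir)) has_real_derivative pdv tdir f z) (at 0)"
      using C12D(2)[OF f] by (simp add: has_pdv_def)
    show "0 < fst z - (fst p - L\<^sup>2)" using interior by simp
    show "f (z + s *\<^sub>R tdir) \<le> f (z + 0 *\<^sub>R tdir)" if "- (fst z - (fst p - L\<^sup>2)) \<le> s" "s \<le> 0" for s
    proof -
      have "z + s *\<^sub>R tdir \<in> past_cball p L" using that z by (auto simp: box)
      from max[OF this] show ?thesis by simp
    qed
  qed
  show "pdv (xdir i) (pdv (xdir i) f) z \<le> 0"
  proof (rule second_deriv_nonpos_at_max[OF has_pdv_at[OF C12D(4)[OF f]]])
    show "((\<lambda>s. pdv (xdir i) f (z + s *\<^sub>R xdir i)) has_real_derivative
        pdv (xdir i) (pdv (xdir i) f) z) (at 0)"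
      using C12D(6)[OF f] by (simp add: has_pdv_def)
    show "0 < L - infnorm (snd z - snd p)" using interior by simp
    show "f (z + s *\<^sub>R xdir i) \<le> f (z + 0 *\<^sub>R xdir i)"
      if "\<bar>s - 0\<bar> < L - infnorm (snd z - snd p)" for s
    proof -
      have "infnorm (snd (z + s *\<^sub>R xdir i) - snd p) \<le> infnorm (snd z - snd p) + \<bar>s\<bar>"
        using infnorm_triangle[of "snd z - snd p" "s *\<^sub>R axis i 1"]
        by (simp add: infnorm_mul algebra_simps)
      then have "z + s *\<^sub>R xdir i \<in> past_cball p L" using that z by (auto simp: box)
      from max[OF this] show ?thesis by simp
    qed
  qed
qed

text \<open>Brandt's doubling of variables: as a function of \<open>z\<close> and \<open>s\<close>, the odd difference of \<open>h\<close> solves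
  a heat equation in which the second derivative in direction \<open>i\<close> may be traded for the one in \<open>s\<close>.
  It vanishes at \<open>s = 0\<close> and is compared with a barrier that is linear in \<open>s\<close> near \<open>0\<close>.\<close>

definition odd_diff :: "3 \<Rightarrow> (pt \<Rightarrow> real) \<Rightarrow> real \<Rightarrow> pt \<Rightarrow> real" where
  "odd_diff i h s z = (h (z + s *\<^sub>R xdir i) - h (z - s *\<^sub>R xdir i)) / 2"

lemma odd_diff_zero [simp]: "odd_diff i h 0 z = 0"
  by (simp add: odd_diff_def)

lemma has_C12_odd_diff:
  assumes "C12 h"
  shows "has_C12 (odd_diff i h s) (odd_diff i (pdv tdir h) s) (\<lambda>j. odd_diff i (pdv (xdir j) h) s)
    (\<lambda>j k. odd_diff i (pdv (xdir k) (pdv (xdir j) h)) s)"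
  unfolding odd_diff_def[abs_def]
  using has_C12_cmult[OF has_C12_diff[OF
        has_C12_translate[OF C12_has_C12[OF assms], of "s *\<^sub>R xdir i"]
        has_C12_translate[OF C12_has_C12[OF assms], of "- s *\<^sub>R xdir i"]], of "1 / 2"] by simp

lemma odd_diff_heat_op:
  "odd_diff i (heat_op h) s z = odd_diff i (pdv tdir h) s z
    - (\<Sum>j\<in>UNIV. odd_diff i (pdv (xdir j) (pdv (xdir j) h)) s z)"
  by (simp add: odd_diff_def heat_op_def sum_subtractf diff_divide_distrib flip: sum_divide_distrib)

lemma odd_diff_deriv:
  assumes "has_pdv (xdir i) h h'"
  shows "((\<lambda>s. odd_diff i h s z) has_real_derivative
    (h' (z + s *\<^sub>R xdir i) + h' (z - s *\<^sub>R xdir i)) / 2) (at s)"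
  unfolding odd_diff_def
  by (rule derivative_eq_intros has_pdv_at[OF assms] has_pdv_at_reflected[OF assms] refl | simp)+

lemma odd_diff_second_deriv:
  assumes "has_pdv (xdir i) h' h''"
  shows "((\<lambda>s. (h' (z + s *\<^sub>R xdir i) + h' (z - s *\<^sub>R xdir i)) / 2) has_real_derivative
    odd_diff i h'' s z) (at s)"
  unfolding odd_diff_def
  by (rule derivative_eq_intros has_pdv_at[OF assms] has_pdv_at_reflected[OF assms] refl | simp)+

definition brandt_gap :: "3 \<Rightarrow> (pt \<Rightarrow> real) \<Rightarrow> pt \<Rightarrow> real \<Rightarrow> real \<Rightarrow> real \<Rightarrow> pt \<Rightarrow> real \<Rightarrow> real" where
  "brandt_gap i h p \<alpha> \<kappa> L z s = odd_diff i h s z - \<alpha> * paraboloid p z - \<kappa> * (s * (L - s))"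

lemma heat_op_at_brandt_gap_max:
  assumes h: "C12 h" and z: "z \<in> past_cball p (L / 2)" "paraboloid p z < (L / 2)\<^sup>2"
    and s: "0 < s" "s < L / 2"
    and max: "\<And>y q. y \<in> past_cball p (L / 2) \<Longrightarrow> 0 \<le> q \<Longrightarrow> q \<le> L / 2 \<Longrightarrow>
      brandt_gap i h p \<alpha> \<kappa> L y q \<le> brandt_gap i h p \<alpha> \<kappa> L z s"
  shows "2 * \<kappa> - 5 * \<alpha> \<le> odd_diff i (heat_op h) s z"
proof -
  let ?D = "\<lambda>j. odd_diff i (pdv (xdir j) (pdv (xdir j) h)) s z"
  note derivs = has_C12_diff[OF has_C12_diff[OF has_C12_odd_diff[OF h]
        has_C12_cmult[OF has_C12_paraboloid]] has_C12_const]
  have max_z: "odd_diff i h s y - \<alpha> * paraboloid p y - \<kappa> * (s * (L - s))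
      \<le> odd_diff i h s z - \<alpha> * paraboloid p z - \<kappa> * (s * (L - s))"
    if "y \<in> past_cball p (L / 2)" for y
    using max[OF that, of s] s by (simp add: brandt_gap_def)
  note at_max = derivatives_at_max_past_cball[OF has_C12D(5)[OF derivs] z(1) max_z z(2)]
  have "- \<alpha> \<le> odd_diff i (pdv tdir h) s z" using at_max(1) by (simp add: has_C12D(1)[OF derivs])
  moreover have "?D i \<le> - 2 * \<kappa>"
  proof -
    let ?E = "\<lambda>s. (pdv (xdir i) h (z + s *\<^sub>R xdir i) + pdv (xdir i) h (z - s *\<^sub>R xdir i)) / 2"
    have "?D i + 2 * \<kappa> \<le> 0"
    proof (rule second_deriv_nonpos_at_max)
      show "(brandt_gap i h p \<alpha> \<kappa> L z has_real_derivative ?E s - \<kappa> * (L - 2 * s)) (at s)" for s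
        unfolding brandt_gap_def[abs_def]
        by (rule derivative_eq_intros odd_diff_deriv[OF C12D(4)[OF h]] refl
            | simp add: algebra_simps)+
      show "((\<lambda>s. ?E s - \<kappa> * (L - 2 * s)) has_real_derivative ?D i + 2 * \<kappa>) (at s)"
        by (rule derivative_eq_intros odd_diff_second_deriv[OF C12D(6)[OF h]] refl | simp)+
      show "0 < min s (L / 2 - s)" using s by simp
      show "brandt_gap i h p \<alpha> \<kappa> L z q \<le> brandt_gap i h p \<alpha> \<kappa> L z s"
        if "\<bar>q - s\<bar> < min s (L / 2 - s)" for q
        using max[OF z(1), of q] that by auto
    qed
    then show ?thesis by simp
  qed
  moreover have "(\<Sum>j\<in>UNIV - {i}. ?D j) \<le> (\<Sum>j\<in>UNIV - {i}. 2 * \<alpha>)"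
    using at_max(2) by (intro sum_mono) (simp add: has_C12D(3)[OF derivs] mult.commute)
  then have "(\<Sum>j\<in>UNIV - {i}. ?D j) \<le> 4 * \<alpha>" by (simp add: card_Diff_singleton)
  moreover have "(\<Sum>j\<in>UNIV. ?D j) = ?D i + (\<Sum>j\<in>UNIV - {i}. ?D j)"
    by (simp add: sum.remove[of UNIV i])
  ultimately show ?thesis unfolding odd_diff_heat_op by linarith
qed

lemma abs_odd_diff_le:
  assumes "z \<in> past_cball p (L / 2)" "\<bar>s\<bar> \<le> L / 2" "\<And>y. y \<in> past_cball p L \<Longrightarrow> \<bar>h y\<bar> \<le> A"
  shows "\<bar>odd_diff i h s z\<bar> \<le> A"
proof -
  have "z + \<sigma> *\<^sub>R xdir i \<in> past_cball p L" if "\<bar>\<sigma>\<bar> = \<bar>s\<bar>" for \<sigma>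
    by (rule add_xdir_in_past_cball[OF assms(1)]) (use assms(2) that in linarith)
  from assms(3)[OF this[of s]] assms(3)[OF this[of "- s"]] show ?thesis
    by (simp add: odd_diff_def abs_le_iff field_simps)
qed

lemma brandt_gap_pos_imp_interior:
  assumes L: "0 < L" and \<alpha>: "0 < \<alpha>" "A \<le> \<alpha> * (L / 2)\<^sup>2" and \<kappa>: "\<alpha> \<le> \<kappa>"
    and y: "y \<in> past_cball p (L / 2)" and q: "0 \<le> q" "q \<le> L / 2"
    and odd: "odd_diff i h q y \<le> A" and pos: "0 < brandt_gap i h p \<alpha> \<kappa> L y q"
  shows "0 < q" and "q < L / 2" and "paraboloid p y < (L / 2)\<^sup>2"
proof -
  have \<kappa>_nonneg: "0 \<le> \<kappa> * (q * (L - q))" using \<alpha> \<kappa> q L by auto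
  have \<alpha>_nonneg: "0 \<le> \<alpha> * paraboloid p y" using \<alpha> paraboloid_nonneg[OF y] by simp
  have "q \<noteq> 0" using pos \<alpha>_nonneg by (auto simp: brandt_gap_def)
  with q show "0 < q" by simp
  have "q \<noteq> L / 2"
  proof
    assume "q = L / 2"
    then have "L = 2 * q" by simp
    then have "q * (L - q) = (L / 2)\<^sup>2" by (simp add: power2_eq_square)
    moreover have "\<alpha> * (L / 2)\<^sup>2 \<le> \<kappa> * (L / 2)\<^sup>2" using \<kappa> by (intro mult_right_mono) auto
    ultimately show False using pos odd \<alpha>(2) \<alpha>_nonneg by (simp add: brandt_gap_def)
  qed
  with q show "q < L / 2" by simp
  show "paraboloid p y < (L / 2)\<^sup>2"
  proof (rule ccontr)
    assume "\<not> paraboloid p y < (L / 2)\<^sup>2"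
    then have "\<alpha> * (L / 2)\<^sup>2 \<le> \<alpha> * paraboloid p y" using \<alpha>(1) by (intro mult_left_mono) auto
    then show False using pos odd \<alpha>(2) \<kappa>_nonneg by (simp add: brandt_gap_def)
  qed
qed

lemma brandt_gap_nonpos:
  assumes h: "C12 h" and L: "0 < L" and \<alpha>: "0 < \<alpha>" "A \<le> \<alpha> * (L / 2)\<^sup>2"
    and \<kappa>: "\<alpha> \<le> \<kappa>" "B < 2 * \<kappa> - 5 * \<alpha>"
    and h_le: "\<And>y. y \<in> past_cball p L \<Longrightarrow> \<bar>h y\<bar> \<le> A"
    and heat_le: "\<And>y. y \<in> past_cball p L \<Longrightarrow> \<bar>heat_op h y\<bar> \<le> B"
    and z: "z \<in> past_cball p (L / 2)" and s: "0 \<le> s" "s \<le> L / 2"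
  shows "brandt_gap i h p \<alpha> \<kappa> L z s \<le> 0"
proof -
  define K where "K = past_cball p (L / 2) \<times> {0..L / 2}"
  let ?F = "\<lambda>(z, s). brandt_gap i h p \<alpha> \<kappa> L z s"
  note cont = continuous_on_compose2[OF C12D(1)[OF h]]
  have "continuous_on K ?F"
    unfolding brandt_gap_def odd_diff_def paraboloid_def split_beta
    by (intro continuous_intros cont) auto
  moreover have "compact K" unfolding K_def by (intro compact_Times compact_past_cball) auto
  moreover have "(z, s) \<in> K" using z s by (simp add: K_def)
  ultimately obtain m where m: "m \<in> K" "\<And>k. k \<in> K \<Longrightarrow> ?F k \<le> ?F m"
    using continuous_attains_sup[of K ?F] by (metis empty_iff)
  obtain y q where yq: "m = (y, q)" by (cases m)
  have y: "y \<in> past_cball p (L / 2)" and q: "0 \<le> q" "q \<le> L / 2" using m(1) by (auto simp: K_def yq)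
  have "brandt_gap i h p \<alpha> \<kappa> L y q \<le> 0"
  proof (rule ccontr)
    assume pos: "\<not> brandt_gap i h p \<alpha> \<kappa> L y q \<le> 0"
    have "\<bar>odd_diff i h q y\<bar> \<le> A" by (rule abs_odd_diff_le[OF y _ h_le]) (use q in auto)
    then have "odd_diff i h q y \<le> A" by simp
    note interior = brandt_gap_pos_imp_interior[OF L \<alpha> \<kappa>(1) y q this pos[unfolded not_le]]
    have "2 * \<kappa> - 5 * \<alpha> \<le> odd_diff i (heat_op h) q y"
      by (rule heat_op_at_brandt_gap_max[OF h y interior(3,1,2)])
         (use m(2) in \<open>auto simp: K_def yq\<close>)
    moreover have "\<bar>odd_diff i (heat_op h) q y\<bar> \<le> B"
      by (rule abs_odd_diff_le[OF y _ heat_le]) (use q in auto)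
    ultimately show False using \<kappa>(2) by simp
  qed
  moreover have "brandt_gap i h p \<alpha> \<kappa> L z s \<le> brandt_gap i h p \<alpha> \<kappa> L y q"
    using m(2)[OF \<open>(z, s) \<in> K\<close>] by (simp add: yq)
  ultimately show ?thesis by simp
qed

lemma deriv_le_of_linear_bound:
  fixes f :: "real \<Rightarrow> real"
  assumes f: "(f has_real_derivative d) (at 0)" and zero: "f 0 = 0" and \<eta>: "0 < \<eta>"
    and linear: "\<And>q. 0 < q \<Longrightarrow> q \<le> \<eta> \<Longrightarrow> f q \<le> c * q"
  shows "d \<le> c"
proof (rule ccontr)
  assume "\<not> d \<le> c"
  moreover have "((\<lambda>q. f q - c * q) has_real_derivative d - c) (at 0)"
    by (rule derivative_eq_intros f refl | simp)+
  ultimately obtain \<delta> where \<delta>: "\<delta> > 0" "\<And>q. q > 0 \<Longrightarrow> q < \<delta> \<Longrightarrow> f 0 - c * 0 < f (0 + q) - c * (0 + q)"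
    using DERIV_pos_inc_right[of "\<lambda>q. f q - c * q" "d - c" 0] by auto
  define q where "q = min (\<delta> / 2) \<eta>"
  have "0 < q" "q < \<delta>" "q \<le> \<eta>" using \<delta>(1) \<eta> by (auto simp: q_def min_def)
  with \<delta>(2)[of q] linear[of q] zero show False by simp
qed

lemma interior_gradient_bound_upper:
  assumes h: "C12 h" and L: "L > 0" and A: "A > 0"
    and h_le: "\<And>y. y \<in> past_cball p L \<Longrightarrow> \<bar>h y\<bar> \<le> A"
    and heat_le: "\<And>y. y \<in> past_cball p L \<Longrightarrow> \<bar>heat_op h y\<bar> \<le> B"
  shows "pdv (xdir i) h p \<le> 11 * A / L + B * L"
proof -
  define \<alpha> where "\<alpha> = 4 * A / L\<^sup>2"
  define \<kappa> where "\<kappa> = B + 11 * A / L\<^sup>2"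
  have "0 \<le> B" using order_trans[OF abs_ge_zero heat_le, of p] L by simp
  moreover have "0 < A / L\<^sup>2" using A L by simp
  ultimately have \<kappa>: "0 < \<alpha>" "A \<le> \<alpha> * (L / 2)\<^sup>2" "\<alpha> \<le> \<kappa>" "B < 2 * \<kappa> - 5 * \<alpha>"
    using L by (auto simp: \<alpha>_def \<kappa>_def power2_eq_square)
  have linear: "odd_diff i h q p \<le> (\<kappa> * L) * q" if q: "0 < q" "q \<le> L / 2" for q
  proof -
    have "brandt_gap i h p \<alpha> \<kappa> L p q \<le> 0"
      by (rule brandt_gap_nonpos[OF h L \<kappa> h_le heat_le]) (use q L in auto)
    then have "odd_diff i h q p \<le> \<kappa> * (q * (L - q))" by (simp add: brandt_gap_def)
    also have "\<dots> \<le> \<kappa> * (q * L)" using \<kappa> q by (intro mult_left_mono) auto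
    finally show ?thesis by (simp add: mult_ac)
  qed
  have "((\<lambda>q. odd_diff i h q p) has_real_derivative pdv (xdir i) h p) (at 0)"
    using odd_diff_deriv[OF C12D(4)[OF h], of i p 0] by simp
  then have "pdv (xdir i) h p \<le> \<kappa> * L"
    by (rule deriv_le_of_linear_bound[where \<eta>="L / 2", OF _ odd_diff_zero _ linear])
       (use L in auto)
  also have "\<kappa> * L = 11 * A / L + B * L" using L by (simp add: \<kappa>_def field_simps power2_eq_square)
  finally show ?thesis .
qed

lemma interior_gradient_bound:
  assumes h: "C12 h" and L: "L > 0" and A: "A > 0"
    and h_le: "\<And>y. y \<in> past_cball p L \<Longrightarrow> \<bar>h y\<bar> \<le> A"
    and heat_le: "\<And>y. y \<in> past_cball p L \<Longrightarrow> \<bar>heat_op h y\<bar> \<le> B"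
  shows "\<bar>pdv (xdir i) h p\<bar> \<le> 11 * A / L + B * L"
proof -
  have "pdv (xdir i) (\<lambda>z. -1 * h z) p \<le> 11 * A / L + B * L"
    by (rule interior_gradient_bound_upper[OF C12_cmult[OF h] L A])
       (simp_all add: heat_op_cmult[OF h, of "-1", simplified] h_le heat_le)
  then have "- pdv (xdir i) h p \<le> 11 * A / L + B * L"
    by (simp add: has_C12D(2)[OF has_C12_cmult[OF C12_has_C12[OF h], of "-1"], simplified])
  moreover have "pdv (xdir i) h p \<le> 11 * A / L + B * L"
    by (rule interior_gradient_bound_upper[OF h L A h_le heat_le])
  ultimately show ?thesis by simp
qed

lemma has_pdv_increment_le:
  assumes f: "has_pdv e f g" and M: "\<And>\<sigma>. \<sigma> \<in> closed_segment 0 s \<Longrightarrow> \<bar>g (z + \<sigma> *\<^sub>R e)\<bar> \<le> M"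
  shows "\<bar>f (z + s *\<^sub>R e) - f z\<bar> \<le> M * \<bar>s\<bar>"
proof -
  have "norm (f (z + s *\<^sub>R e) - f (z + 0 *\<^sub>R e)) \<le> M * norm (s - 0)"
    by (rule field_differentiable_bound[where S="closed_segment 0 s" and f'="\<lambda>\<sigma>. g (z + \<sigma> *\<^sub>R e)"])
       (use M in \<open>auto intro: has_field_derivative_at_within has_pdv_at[OF f]\<close>)
  then show ?thesis by simp
qed

lemma abs_le_of_mem_segment: "\<sigma> \<in> closed_segment 0 s \<Longrightarrow> \<bar>\<sigma>\<bar> \<le> \<bar>s::real\<bar>"
  by (auto simp: closed_segment_eq_real_ivl split: if_splits)

lemma spatial_increment_le:
  assumes f: "\<And>i. has_pdv (xdir i) f (g i)"
    and M: "\<And>i x. x \<in> past_cball z r \<Longrightarrow> fst x = fst z \<Longrightarrow> \<bar>g i x\<bar> \<le> M"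
    and y: "y \<in> past_cball z r" "fst y = fst z"
  shows "\<bar>f y - f z\<bar> \<le> 3 * M * r"
proof -
  define w where "w = snd y - snd z"
  define p where "p = (\<lambda>a b c. z + a *\<^sub>R xdir 1 + b *\<^sub>R xdir 2 + c *\<^sub>R xdir 3)"
  have w: "\<bar>w $ i\<bar> \<le> r" for i
    using y(1) by (auto simp: mem_past_cball_iff_box w_def infnorm_le_iff_cart)
  have r: "0 \<le> r" using y(1) by (simp add: mem_past_cball_iff_box)
  have step: "\<bar>f (x + w $ i *\<^sub>R xdir i) - f x\<bar> \<le> M * r"
    if x: "\<And>\<sigma>. \<bar>\<sigma>\<bar> \<le> r \<Longrightarrow> x + \<sigma> *\<^sub>R xdir i \<in> past_cball z r" "fst x = fst z" for x i
  proof -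
    have g: "\<bar>g i (x + \<sigma> *\<^sub>R xdir i)\<bar> \<le> M" if "\<bar>\<sigma>\<bar> \<le> r" for \<sigma> using x that by (intro M) auto
    have "\<bar>f (x + w $ i *\<^sub>R xdir i) - f x\<bar> \<le> M * \<bar>w $ i\<bar>"
      using abs_le_of_mem_segment order_trans[OF _ w]
      by (intro has_pdv_increment_le[OF f] g) blast
    also have "\<dots> \<le> M * r"
      using order_trans[OF abs_ge_zero g[of 0]] r w by (intro mult_left_mono) auto
    finally show ?thesis .
  qed
  have p: "p a b c \<in> past_cball z r" if "\<bar>a\<bar> \<le> r" "\<bar>b\<bar> \<le> r" "\<bar>c\<bar> \<le> r" for a b c
    using that r by (auto simp: p_def mem_past_cball_iff_box infnorm_le_iff_cart forall_3 axis_def)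
  have "\<bar>f (p (w $ 1) 0 0) - f z\<bar> \<le> M * r"
    using step[of z 1] p[of _ 0 0] r by (simp add: p_def)
  moreover have "\<bar>f (p (w $ 1) (w $ 2) 0) - f (p (w $ 1) 0 0)\<bar> \<le> M * r"
    using step[of "p (w $ 1) 0 0" 2] p[of "w $ 1" _ 0] w r by (simp add: p_def)
  moreover have "\<bar>f (p (w $ 1) (w $ 2) (w $ 3)) - f (p (w $ 1) (w $ 2) 0)\<bar> \<le> M * r"
    using step[of "p (w $ 1) (w $ 2) 0" 3] p[of "w $ 1" "w $ 2"] w by (simp add: p_def)
  moreover have "p (w $ 1) (w $ 2) (w $ 3) = y"
    using y(2) by (auto simp: p_def w_def prod_eq_iff vec_eq_iff forall_3 axis_def)
  ultimately show ?thesis by (simp add: algebra_simps)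
qed

lemma taylor_rem_le:
  assumes f: "C12 f" and y: "y \<in> past_cball z r"
    and a: "\<And>x. x \<in> past_cball z r \<Longrightarrow> \<bar>pdv tdir f x\<bar> \<le> a"
    and H: "\<And>x i j. x \<in> past_cball z r \<Longrightarrow> \<bar>pdv (xdir j) (pdv (xdir i) f) x\<bar> \<le> H"
  shows "\<bar>taylor_rem f y z\<bar> \<le> (a + 9 * H) * r\<^sup>2"
proof -
  define y\<^sub>0 where "y\<^sub>0 = (fst z, snd y)"
  define \<tau> where "\<tau> = fst y - fst z"
  have \<tau>: "- r\<^sup>2 \<le> \<tau>" "\<tau> \<le> 0" and y\<^sub>0: "y\<^sub>0 \<in> past_cball z r"
    using y by (auto simp: mem_past_cball_iff_box y\<^sub>0_def \<tau>_def)
  have y_eq: "y = y\<^sub>0 + \<tau> *\<^sub>R tdir" by (simp add: y\<^sub>0_def \<tau>_def tdir_def prod_eq_iff)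
  have "\<bar>taylor_rem f y\<^sub>0 z - taylor_rem f z z\<bar> \<le> 3 * (3 * H * r) * r"
  proof (rule spatial_increment_le)
    show "has_pdv (xdir i) (\<lambda>x. taylor_rem f x z) (\<lambda>x. pdv (xdir i) f x - pdv (xdir i) f z)" for i
      using has_C12_taylor_rem[OF f] by (simp add: has_C12_def)
    show "\<bar>pdv (xdir i) f x - pdv (xdir i) f z\<bar> \<le> 3 * H * r"
      if "x \<in> past_cball z r" "fst x = fst z" for i x
      by (rule spatial_increment_le[OF C12D(6)[OF f] H that])
  qed (use y\<^sub>0 in \<open>simp_all add: y\<^sub>0_def\<close>)
  moreover have "\<bar>f y - f y\<^sub>0\<bar> \<le> a * r\<^sup>2"
  proof -
    have "\<bar>f y - f y\<^sub>0\<bar> \<le> a * \<bar>\<tau>\<bar>"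
      unfolding y_eq
    proof (rule has_pdv_increment_le[OF C12D(2)[OF f] a])
      fix \<sigma> assume "\<sigma> \<in> closed_segment 0 \<tau>"
      then have "- r\<^sup>2 \<le> \<sigma>" "\<sigma> \<le> 0"
        using \<tau> by (auto simp: closed_segment_eq_real_ivl split: if_splits)
      then show "y\<^sub>0 + \<sigma> *\<^sub>R tdir \<in> past_cball z r"
        using y\<^sub>0 by (simp add: mem_past_cball_iff_box y\<^sub>0_def)
    qed
    also have "a * \<bar>\<tau>\<bar> \<le> a * r\<^sup>2"
      using \<tau> order_trans[OF abs_ge_zero a[OF y]] by (intro mult_left_mono) auto
    finally show ?thesis .
  qed
  moreover have "taylor_rem f y z = taylor_rem f y\<^sub>0 z + (f y - f y\<^sub>0)"
    by (simp add: taylor_rem_def y\<^sub>0_def)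
  ultimately show ?thesis by (simp add: power2_eq_square algebra_simps)
qed

lemma C12_derivatives_bounded:
  assumes f: "C12 f" and K: "compact K"
  obtains M where "0 \<le> M" "\<And>y. y \<in> K \<Longrightarrow> \<bar>pdv tdir f y\<bar> \<le> M"
    "\<And>y i j. y \<in> K \<Longrightarrow> \<bar>pdv (xdir j) (pdv (xdir i) f) y\<bar> \<le> M"
proof -
  define S where "S = (\<lambda>y. \<bar>pdv tdir f y\<bar> + (\<Sum>i\<in>UNIV. \<Sum>j\<in>UNIV. \<bar>pdv (xdir j) (pdv (xdir i) f) y\<bar>))"
  have "continuous_on K S"
    unfolding S_def by (intro continuous_intros continuous_on_subset[OF C12D(3)[OF f]]
        continuous_on_subset[OF C12D(7)[OF f]]) auto
  then have "bounded (S ` K)" using K compact_continuous_image compact_imp_bounded by blast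
  then obtain M where M: "\<And>y. y \<in> K \<Longrightarrow> S y \<le> M" unfolding bounded_iff by (auto simp: abs_le_iff)
  have "\<bar>pdv (xdir j) (pdv (xdir i) f) y\<bar>
      \<le> (\<Sum>i\<in>UNIV. \<Sum>j\<in>UNIV. \<bar>pdv (xdir j) (pdv (xdir i) f) y\<bar>)" for i j y
  proof -
    have "\<bar>pdv (xdir j) (pdv (xdir i) f) y\<bar> \<le> (\<Sum>j\<in>UNIV. \<bar>pdv (xdir j) (pdv (xdir i) f) y\<bar>)"
      by (rule member_le_sum) auto
    also have "\<dots> \<le> (\<Sum>i\<in>UNIV. \<Sum>j\<in>UNIV. \<bar>pdv (xdir j) (pdv (xdir i) f) y\<bar>)"
      by (rule member_le_sum) (auto intro: sum_nonneg)
    finally show ?thesis .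
  qed
  then have "\<bar>pdv (xdir j) (pdv (xdir i) f) y\<bar> \<le> S y" for y i j
    unfolding S_def by (rule add_increasing[OF abs_ge_zero])
  moreover have "\<bar>pdv tdir f y\<bar> \<le> S y" for y by (simp add: S_def sum_nonneg)
  ultimately show thesis
    using M by (intro that[of "max 0 M"]) (meson max.cobounded1 max.coboundedI2 order_trans)+
qed

lemma taylor_rem_bounded:
  assumes f: "C12 f"
  obtains M where "0 \<le> M"
    "\<And>x y d. past_cball x d \<subseteq> past_cball z R \<Longrightarrow> y \<in> past_cball x d \<Longrightarrow> \<bar>taylor_rem f y x\<bar> \<le> M * d\<^sup>2"
proof -
  obtain M where M: "0 \<le> M" "\<And>y. y \<in> past_cball z R \<Longrightarrow> \<bar>pdv tdir f y\<bar> \<le> M"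
    "\<And>y i j. y \<in> past_cball z R \<Longrightarrow> \<bar>pdv (xdir j) (pdv (xdir i) f) y\<bar> \<le> M"
    using C12_derivatives_bounded[OF f compact_past_cball] by metis
  have "\<bar>taylor_rem f y x\<bar> \<le> (M + 9 * M) * d\<^sup>2"
    if "past_cball x d \<subseteq> past_cball z R" "y \<in> past_cball x d" for x y d
    using that M(2,3) by (intro taylor_rem_le[OF f]) auto
  with M(1) show thesis by (intro that[of "M + 9 * M"]) auto
qed

lemma second_derivative_bound:
  assumes h: "C12 h" and L: "0 < L" and G: "0 < G"
    and grad: "\<And>y i. y \<in> past_cball z L \<Longrightarrow> \<bar>pdv (xdir i) h y\<bar> \<le> G"
    and q: "0 < q" and lip: "\<And>y s. y \<in> past_cball z L \<Longrightarrow> \<bar>s\<bar> \<le> q \<Longrightarrow>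
      \<bar>heat_op h (y + s *\<^sub>R xdir j) - heat_op h y\<bar> \<le> B * \<bar>s\<bar>"
  shows "\<bar>pdv (xdir j) (pdv (xdir i) h) z\<bar> \<le> 22 * G / L + B * L / 2"
proof -
  have quotient: "\<bar>(pdv (xdir i) h (z + s *\<^sub>R xdir j) - pdv (xdir i) h z) / s\<bar>
      \<le> 22 * G / L + B * L / 2"
    if s: "s \<noteq> 0" "\<bar>s\<bar> \<le> q" "\<bar>s\<bar> \<le> L / 2" for s
  proof -
    define k where "k = (\<lambda>y. (1 / s) * (h (y + s *\<^sub>R xdir j) - h y))"
    note derivs = has_C12_cmult[OF has_C12_diff[OF has_C12_translate[OF C12_has_C12[OF h]]
          C12_has_C12[OF h]], of "1 / s" "s *\<^sub>R xdir j", folded k_def]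
    have heat: "heat_op k y = (1 / s) * (heat_op h (y + s *\<^sub>R xdir j) - heat_op h y)" for y
      unfolding has_C12D(4)[OF derivs] heat_op_def[of h]
      by (simp add: sum_subtractf sum_divide_distrib[symmetric] diff_divide_distrib)
    have "\<bar>pdv (xdir i) k z\<bar> \<le> 11 * G / (L / 2) + B * (L / 2)"
    proof (rule interior_gradient_bound[OF has_C12D(5)[OF derivs] _ G])
      fix y assume y: "y \<in> past_cball z (L / 2)"
      have "\<bar>h (y + s *\<^sub>R xdir j) - h y\<bar> \<le> G * \<bar>s\<bar>"
      proof (rule has_pdv_increment_le[OF C12D(4)[OF h] grad])
        fix \<sigma> assume "\<sigma> \<in> closed_segment 0 s"
        then show "y + \<sigma> *\<^sub>R xdir j \<in> past_cball z L"
          using s(3) abs_le_of_mem_segment[of \<sigma> s] by (intro add_xdir_in_past_cball[OF y]) auto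
      qed
      then show "\<bar>k y\<bar> \<le> G" using s(1) by (simp add: k_def abs_mult field_simps)
      have "\<bar>heat_op h (y + s *\<^sub>R xdir j) - heat_op h y\<bar> \<le> B * \<bar>s\<bar>"
        using past_cball_mono[OF y, of L] L by (intro lip s(2)) auto
      then show "\<bar>heat_op k y\<bar> \<le> B" using s(1) by (simp add: heat abs_mult field_simps)
    qed (use L in simp)
    then show ?thesis by (simp add: has_C12D(2)[OF derivs])
  qed
  have "((\<lambda>s. (pdv (xdir i) h (z + s *\<^sub>R xdir j) - pdv (xdir i) h (z + 0 *\<^sub>R xdir j)) / (s - 0))
      \<longlongrightarrow> pdv (xdir j) (pdv (xdir i) h) z) (at 0)"
    using C12D(6)[OF h, of j i] unfolding has_pdv_def has_field_derivative_iff
    by (auto simp: add.commute)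
  then have "((\<lambda>s. \<bar>(pdv (xdir i) h (z + s *\<^sub>R xdir j) - pdv (xdir i) h z) / s\<bar>)
      \<longlongrightarrow> \<bar>pdv (xdir j) (pdv (xdir i) h) z\<bar>) (at 0)"
    by (intro tendsto_rabs) simp
  moreover have "\<forall>\<^sub>F s in at 0.
      \<bar>(pdv (xdir i) h (z + s *\<^sub>R xdir j) - pdv (xdir i) h z) / s\<bar> \<le> 22 * G / L + B * L / 2"
    unfolding eventually_at
    using q L quotient by (intro exI[of _ "min q (L / 2)"]) (auto simp: dist_real_def)
  ultimately show ?thesis by (rule tendsto_upperbound) simp
qed

context
  fixes h :: "pt \<Rightarrow> real" and L A B B' q :: real and p :: pt
  assumes h: "C12 h" and L: "0 < L" and A: "0 < A"
    and h_le: "\<And>y. y \<in> past_cball p L \<Longrightarrow> \<bar>h y\<bar> \<le> A"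
    and heat_le: "\<And>y. y \<in> past_cball p L \<Longrightarrow> \<bar>heat_op h y\<bar> \<le> B"
    and q: "0 < q" and lip: "\<And>y s j. y \<in> past_cball p L \<Longrightarrow> \<bar>s\<bar> \<le> q \<Longrightarrow>
      \<bar>heat_op h (y + s *\<^sub>R xdir j) - heat_op h y\<bar> \<le> B' * \<bar>s\<bar>"
begin

lemma source_bounds_nonneg: "0 \<le> B" "0 \<le> B'"
proof -
  show "0 \<le> B" using order_trans[OF abs_ge_zero heat_le, of p] L by simp
  have "0 \<le> B' * \<bar>q\<bar>" using order_trans[OF abs_ge_zero lip, of p q] L q by simp
  then show "0 \<le> B'" using q by (simp add: zero_le_mult_iff)
qed

lemma interior_second_derivative_bound:
  assumes z: "z \<in> past_cball p (L / 4)"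
  shows "\<bar>pdv (xdir j) (pdv (xdir i) h) z\<bar> \<le> 1950 * (A / L\<^sup>2 + B + B' * L)"
proof -
  define G where "G = 22 * A / L + B * L / 2"
  have G: "0 < G" using A source_bounds_nonneg L by (auto simp: G_def intro!: add_pos_nonneg)
  have grad: "\<bar>pdv (xdir i) h z\<bar> \<le> G" if z: "z \<in> past_cball p (L / 2)" for z i
  proof -
    have "\<bar>pdv (xdir i) h z\<bar> \<le> 11 * A / (L / 2) + B * (L / 2)"
      by (rule interior_gradient_bound[OF h _ A])
         (use L past_cball_trans[OF _ z, of _ "L / 2" L] h_le heat_le in auto)
    then show ?thesis by (simp add: G_def)
  qed
  have sub: "x \<in> past_cball p (L / 2)" if "x \<in> past_cball z (L / 4)" for x
    using past_cball_trans[OF that z] by simp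
  have "\<bar>pdv (xdir j) (pdv (xdir i) h) z\<bar> \<le> 22 * G / (L / 4) + B' * (L / 4) / 2"
  proof (rule second_derivative_bound[OF h _ G grad[OF sub] q])
    show "\<bar>heat_op h (x + s *\<^sub>R xdir j) - heat_op h x\<bar> \<le> B' * \<bar>s\<bar>"
      if "x \<in> past_cball z (L / 4)" "\<bar>s\<bar> \<le> q" for x s
      using past_cball_mono[OF sub[OF that(1)], of L] L that(2) by (intro lip) auto
  qed (use L in auto)
  also have "\<dots> = 88 * (22 * (A / L\<^sup>2) + B / 2) + B' * L / 8"
    using L by (simp add: G_def field_simps power2_eq_square)
  also have "\<dots> \<le> 1950 * (A / L\<^sup>2 + B + B' * L)"
  proof -
    have "0 \<le> A / L\<^sup>2" "0 \<le> B' * L" using A L source_bounds_nonneg by auto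
    then show ?thesis using source_bounds_nonneg(1) unfolding distrib_left by linarith
  qed
  finally show ?thesis .
qed

lemma interior_taylor:
  assumes r: "r \<le> L / 4" and y: "y \<in> past_cball p r"
  shows "\<bar>taylor_rem h y p\<bar> \<le> 24000 * (A / L\<^sup>2 + B + B' * L) * r\<^sup>2"
proof -
  define H where "H = 1950 * (A / L\<^sup>2 + B + B' * L)"
  have "\<bar>taylor_rem h y p\<bar> \<le> (B + 3 * H + 9 * H) * r\<^sup>2"
  proof (rule taylor_rem_le[OF h y])
    fix z assume z: "z \<in> past_cball p r"
    show H: "\<bar>pdv (xdir j) (pdv (xdir i) h) z\<bar> \<le> H" for i j
      unfolding H_def using past_cball_mono[OF z] r by (intro interior_second_derivative_bound) auto
    have "\<bar>\<Sum>i\<in>UNIV. pdv (xdir i) (pdv (xdir i) h) z * 1\<bar> \<le> real CARD(3) * (H * 1)"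
      by (rule abs_sum_mult_le) (simp_all add: H)
    moreover have "\<bar>heat_op h z\<bar> \<le> B" using past_cball_mono[OF z, of L] r L by (intro heat_le) auto
    ultimately show "\<bar>pdv tdir h z\<bar> \<le> B + 3 * H" by (simp add: heat_op_def)
  qed
  also have "\<dots> \<le> 24000 * (A / L\<^sup>2 + B + B' * L) * r\<^sup>2"
  proof (rule mult_right_mono)
    have "0 \<le> A / L\<^sup>2" "0 \<le> B' * L" using A L source_bounds_nonneg by auto
    then show "B + 3 * H + 9 * H \<le> 24000 * (A / L\<^sup>2 + B + B' * L)"
      using source_bounds_nonneg by (simp add: H_def)
  qed simp
  finally show ?thesis .
qed

end

section \<open>Reconstruction\<close>

text \<open>As \<open>PsiT \<Phi> (2 * S)\<close> is the convolution of \<open>PhiT \<Phi> S\<close> and \<open>PsiT \<Phi> S\<close>, passing from scale \<open>S\<close>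
  to scale \<open>2 * S\<close> only costs the change of base point in the germ; these errors form a geometric
  series.\<close>

lemma uniform_limit_mollify_germ:
  assumes \<Phi>: "kernel \<Phi>" and T: "0 < T" and K: "compact K"
    and F: "continuous_on UNIV (\<lambda>(z, y). F z y)"
  shows "uniform_limit K (\<lambda>j w. mollify \<Phi> (T / 2 ^ j) (F w) w) (\<lambda>w. F w w) sequentially"
proof (rule uniform_limitI)
  fix e :: real assume e: "0 < e"
  define G where "G = (\<lambda>p::pt \<times> pt. F (fst p) (fst p + snd p))"
  have "continuous_on UNIV (\<lambda>p::pt \<times> pt. (fst p, fst p + snd p))" by (intro continuous_intros)
  from continuous_on_compose2[OF F this] have G: "continuous_on UNIV G" by (simp add: G_def)
  have "uniformly_continuous_on (K \<times> past_cball 0 T) G"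
    by (intro compact_uniformly_continuous compact_Times K compact_past_cball)
       (auto intro: continuous_on_subset[OF G])
  then obtain d where d: "d > 0" "\<And>x x'. x \<in> K \<times> past_cball 0 T \<Longrightarrow> x' \<in> K \<times> past_cball 0 T \<Longrightarrow>
      dist x' x < d \<Longrightarrow> dist (G x') (G x) < e / 2"
    unfolding uniformly_continuous_on_def using e by (meson half_gt_zero)
  have "(\<lambda>j. T * (1 / 2) ^ j) \<longlonglongrightarrow> 0"
    using tendsto_mult[OF tendsto_const LIMSEQ_power_zero[of "1 / 2 :: real"], of T] by simp
  then have small: "\<forall>\<^sub>F j in sequentially. T * (1 / 2) ^ j < min 1 (d / 3)"
    by (rule order_tendstoD(2)) (use d(1) in simp)
  show "\<forall>\<^sub>F j in sequentially. \<forall>w\<in>K. dist (mollify \<Phi> (T / 2 ^ j) (F w) w) (F w w) < e"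
    using small
  proof eventually_elim
    case (elim j)
    define S where "S = T / 2 ^ j"
    have S: "0 < S" "S < 1" "S < d / 3" "S \<le> T"
      using T elim one_le_power[of "2::real" j] by (auto simp: S_def field_simps)
    have "\<bar>mollify \<Phi> S (F w) w - F w w\<bar> < e" if w: "w \<in> K" for w
      unfolding mollify_eq_conv[OF \<Phi>]
    proof (rule le_less_trans[OF abs_conv_diff_le[OF PsiT_mollifier[OF \<Phi> S(1)]]])
      have "continuous_on UNIV (\<lambda>y. (w, y))" by (intro continuous_intros)
      from continuous_on_compose2[OF F this] show "continuous_on UNIV (F w)" by simp
      fix y assume "y \<in> past_cball w S"
      then have y: "y - w \<in> past_cball 0 S" by (simp add: diff_in_past_cball_0)
      have "norm (y - w) \<le> S\<^sup>2 + 2 * S" by (rule norm_le_of_past_cball[OF y])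
      also have "\<dots> \<le> S + 2 * S" using S by (simp add: power2_eq_square mult_left_le)
      finally have "dist (w, y - w) (w, 0) < d" using S by (simp add: dist_Pair_Pair)
      moreover have "y - w \<in> past_cball 0 T" using y S(4) by (rule past_cball_mono)
      ultimately have "dist (G (w, y - w)) (G (w, 0)) < e / 2" using w T by (intro d(2)) auto
      then show "\<bar>F w y - F w w\<bar> \<le> e / 2" by (simp add: G_def dist_real_def)
    qed (use e in simp)
    then show ?case by (simp add: S_def dist_real_def)
  qed
qed

context
  fixes \<Phi> :: "pt \<Rightarrow> real" and T M \<gamma> :: real and F :: "pt \<Rightarrow> pt \<Rightarrow> real" and z\<^sub>0 :: pt
  assumes \<Phi>: "kernel \<Phi>" and T: "0 < T" and \<gamma>: "0 < \<gamma>"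
    and F: "continuous_on UNIV (\<lambda>(z, y). F z y)"
    and increment: "\<And>S z w. 0 < S \<Longrightarrow> S \<le> T / 2 \<Longrightarrow> z \<in> past_cball z\<^sub>0 (T - 2 * S) \<Longrightarrow>
      w \<in> past_cball z S \<Longrightarrow> \<bar>mollify \<Phi> S (\<lambda>y. F z y - F w y) w\<bar> \<le> M * S powr \<gamma>"
begin

lemma continuous_on_germ: "continuous_on UNIV (F z)"
  using continuous_on_compose2[OF F, of UNIV "\<lambda>y. (z, y)"] by (simp add: continuous_on_Pair)

lemma reconstruction_step:
  assumes S: "0 < S" "S \<le> T" and z: "z \<in> past_cball z\<^sub>0 (T - S)"
    and B: "\<And>w. w \<in> past_cball z (S / 2) \<Longrightarrow> \<bar>mollify \<Phi> (S / 2) (F w) w\<bar> \<le> B"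
  shows "\<bar>mollify \<Phi> S (F z) z\<bar> \<le> M * (S / 2) powr \<gamma> + B"
  unfolding mollify_semigroup[OF \<Phi> S(1) continuous_on_germ]
proof (rule abs_conv_le)
  note half_pos = half_gt_zero[OF S(1)]
  show "mollifier (S / 2) (PhiT \<Phi> (S / 2))" by (rule PhiT_mollifier_of_kernel[OF \<Phi> half_pos])
  show "continuous_on UNIV (mollify \<Phi> (S / 2) (F z))"
    by (rule continuous_on_mollify[OF \<Phi> half_pos continuous_on_germ])
  fix w assume w: "w \<in> past_cball z (S / 2)"
  have "\<bar>mollify \<Phi> (S / 2) (\<lambda>y. F z y - F w y) w\<bar> \<le> M * (S / 2) powr \<gamma>"
    using S z w by (intro increment[OF half_pos]) auto
  moreover have "mollify \<Phi> (S / 2) (\<lambda>y. F z y - F w y) w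
      = mollify \<Phi> (S / 2) (F z) w - mollify \<Phi> (S / 2) (F w) w"
    unfolding mollify_eq_conv[OF \<Phi>]
    by (rule conv_diff[OF PsiT_Cc[OF \<Phi> half_pos] continuous_on_germ continuous_on_germ])
  ultimately show "\<bar>mollify \<Phi> (S / 2) (F z) w\<bar> \<le> M * (S / 2) powr \<gamma> + B" using B[OF w] by linarith
qed

lemma reconstruction_from_scale:
  assumes "0 < S" "S \<le> T" "z \<in> past_cball z\<^sub>0 (T - S)"
    and "\<And>w. w \<in> past_cball z\<^sub>0 T \<Longrightarrow> \<bar>mollify \<Phi> (S / 2 ^ j) (F w) w\<bar> \<le> B"
  shows "\<bar>mollify \<Phi> S (F z) z\<bar> \<le> B + M / (2 powr \<gamma> - 1) * S powr \<gamma>"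
proof -
  define \<kappa> where "\<kappa> = M / (2 powr \<gamma> - 1)"
  have two: "1 < 2 powr \<gamma>" using \<gamma> by (simp add: gr_one_powr)
  have "0 \<le> M * (T / 2) powr \<gamma>"
    using T by (intro order_trans[OF abs_ge_zero increment[of "T / 2" z\<^sub>0 z\<^sub>0]]) auto
  then have "0 \<le> M" using T by (simp add: zero_le_mult_iff)
  then have \<kappa>: "0 \<le> \<kappa> * S powr \<gamma>" "\<kappa> * (2 powr \<gamma> - 1) = M" for S using two by (auto simp: \<kappa>_def)
  show ?thesis
    unfolding \<kappa>_def[symmetric] using assms
  proof (induction j arbitrary: S z)
    case 0
    then have "\<bar>mollify \<Phi> S (F z) z\<bar> \<le> B" using past_cball_mono[of z z\<^sub>0 "T - S" T] by simp
    with \<kappa>(1)[of S] show ?case by linarith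
  next
    case (Suc j)
    have "\<bar>mollify \<Phi> (S / 2) (F w) w\<bar> \<le> B + \<kappa> * (S / 2) powr \<gamma>"
      if w: "w \<in> past_cball z (S / 2)" for w
    proof (rule Suc.IH[OF half_gt_zero[OF Suc.prems(1)]])
      show "w \<in> past_cball z\<^sub>0 (T - S / 2)" by (rule past_cball_trans[OF w Suc.prems(3)]) simp
    qed (use Suc.prems in auto)
    then have "\<bar>mollify \<Phi> S (F z) z\<bar> \<le> M * (S / 2) powr \<gamma> + (B + \<kappa> * (S / 2) powr \<gamma>)"
      by (rule reconstruction_step[OF Suc.prems(1-3)])
    also have "\<dots> = B + \<kappa> * S powr \<gamma>"
    proof -
      have "M + \<kappa> = \<kappa> * 2 powr \<gamma>" using \<kappa>(2) by (simp add: right_diff_distrib)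
      then have "(M + \<kappa>) * (S / 2) powr \<gamma> = \<kappa> * (2 powr \<gamma> * (S / 2) powr \<gamma>)" by simp
      also have "2 powr \<gamma> * (S / 2) powr \<gamma> = S powr \<gamma>"
        using Suc.prems(1) by (simp flip: powr_mult)
      finally show ?thesis by (simp add: algebra_simps)
    qed
    finally show ?case .
  qed
qed

lemma reconstruction:
  assumes diagonal: "\<And>z. F z z = 0"
  shows "\<bar>mollify \<Phi> T (F z\<^sub>0) z\<^sub>0\<bar> \<le> M / (2 powr \<gamma> - 1) * T powr \<gamma>"
proof (rule field_le_epsilon)
  fix e :: real assume e: "0 < e"
  obtain j where "\<And>w. w \<in> past_cball z\<^sub>0 T \<Longrightarrow> \<bar>mollify \<Phi> (T / 2 ^ j) (F w) w\<bar> < e"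
    using uniform_limitD[OF uniform_limit_mollify_germ[OF \<Phi> T compact_past_cball[of z\<^sub>0 T] F] e]
    by (auto simp: eventually_sequentially diagonal dist_real_def)
  then have "\<bar>mollify \<Phi> T (F z\<^sub>0) z\<^sub>0\<bar> \<le> e + M / (2 powr \<gamma> - 1) * T powr \<gamma>"
    by (intro reconstruction_from_scale[OF T order_refl]) (auto intro: less_imp_le)
  then show "\<bar>mollify \<Phi> T (F z\<^sub>0) z\<^sub>0\<bar> \<le> M / (2 powr \<gamma> - 1) * T powr \<gamma> + e" by simp
qed

end

section \<open>The remainder equation and its scaling\<close>

lemma powr_antimono_exponent: "0 \<le> x \<Longrightarrow> x \<le> 1 \<Longrightarrow> b \<le> a \<Longrightarrow> x powr a \<le> x powr (b::real)"
  by (cases "x = 0") (auto simp: powr_mono')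

definition germ_le :: "(pt \<Rightarrow> real) \<Rightarrow> pt set \<Rightarrow> real \<Rightarrow> real \<Rightarrow> (pt \<Rightarrow> pt \<Rightarrow> real) \<Rightarrow> bool" where
  "germ_le \<Phi> D A a F \<longleftrightarrow>
    (\<forall>z\<in>D. \<forall>T. 0 < T \<longrightarrow> T < 1 \<longrightarrow> \<bar>mollify \<Phi> T (F z) z\<bar> \<le> A * T powr a)"

definition hoelder_le :: "real \<Rightarrow> real \<Rightarrow> (pt \<Rightarrow> real) \<Rightarrow> bool" where
  "hoelder_le A \<alpha> f \<longleftrightarrow> (\<forall>y z. \<bar>f y - f z\<bar> \<le> A * pdist y z powr \<alpha>)"

lemma germ_leI:
  "(\<And>z T. z \<in> D \<Longrightarrow> 0 < T \<Longrightarrow> T < 1 \<Longrightarrow> \<bar>mollify \<Phi> T (F z) z\<bar> \<le> A * T powr a) \<Longrightarrow> germ_le \<Phi> D A a F"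
  by (simp add: germ_le_def)

lemma germ_leD:
  "germ_le \<Phi> D A a F \<Longrightarrow> z \<in> D \<Longrightarrow> 0 < T \<Longrightarrow> T < 1 \<Longrightarrow> \<bar>mollify \<Phi> T (F z) z\<bar> \<le> A * T powr a"
  by (simp add: germ_le_def)

lemma germ_le_subset: "germ_le \<Phi> D A a F \<Longrightarrow> D' \<subseteq> D \<Longrightarrow> germ_le \<Phi> D' A a F"
  by (auto simp: germ_le_def)

lemma dil_amplitude_le:
  assumes "0 < r" "0 \<le> q" "r * q \<le> q'" "real k + a = \<beta>" "0 \<le> \<beta>" "0 \<le> d"
  shows "r ^ k * (q powr \<beta> * (r * d) powr a) \<le> q' powr \<beta> * d powr a"
proof -
  have "r ^ k * r powr a = r powr \<beta>" using assms(1,4) by (simp flip: powr_realpow powr_add)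
  then have "r ^ k * (q powr \<beta> * (r * d) powr a) = (r powr \<beta> * q powr \<beta>) * d powr a"
    using assms by (simp add: powr_mult)
  also have "r powr \<beta> * q powr \<beta> = (r * q) powr \<beta>" using assms by (simp add: powr_mult)
  also have "\<dots> * d powr a \<le> q' powr \<beta> * d powr a"
    using assms by (intro mult_right_mono powr_mono2) auto
  finally show ?thesis .
qed

lemma germ_le_dil:
  assumes \<Phi>: "kernel \<Phi>" and F: "germ_le \<Phi> D (q powr \<beta>) a F"
    and cont: "\<And>z. continuous_on UNIV (F z)"
    and D: "\<And>z. z \<in> D' \<Longrightarrow> p + dil r z \<in> D" and r: "0 < r" "r \<le> 1"
    and q: "0 \<le> q" "r * q \<le> q'" and \<beta>: "real k + a = \<beta>" "0 \<le> \<beta>"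
    and G: "\<And>z y. G z y = r ^ k * F (p + dil r z) (p + dil r y)"
  shows "germ_le \<Phi> D' (q' powr \<beta>) a G"
proof (rule germ_leI)
  fix z T assume z: "z \<in> D'" and T: "0 < (T::real)" "T < 1"
  have "r * T \<le> 1 * T" using r T by (intro mult_right_mono) auto
  then have scaled_T: "0 < r * T" "r * T < 1" using r T by (simp, linarith)
  let ?F = "F (p + dil r z)"
  have "mollify \<Phi> T (G z) z = r ^ k * mollify \<Phi> T (\<lambda>y. ?F (p + dil r y)) z"
    by (simp add: G[abs_def] mollify_def conv_cmult)
  also have "\<dots> = r ^ k * mollify \<Phi> (r * T) ?F (p + dil r z)"
    using mollify_dil[OF \<Phi> r(1) T(1) cont] by simp
  finally have "\<bar>mollify \<Phi> T (G z) z\<bar> = r ^ k * \<bar>mollify \<Phi> (r * T) ?F (p + dil r z)\<bar>"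
    using r by (simp add: abs_mult)
  also have "\<dots> \<le> r ^ k * (q powr \<beta> * (r * T) powr a)"
    using r by (intro mult_left_mono germ_leD[OF F D[OF z] scaled_T]) auto
  also have "\<dots> \<le> q' powr \<beta> * T powr a" using T by (intro dil_amplitude_le r q \<beta>) auto
  finally show "\<bar>mollify \<Phi> T (G z) z\<bar> \<le> q' powr \<beta> * T powr a" .
qed

lemma hoelder_le_dil:
  assumes f: "hoelder_le (q powr \<beta>) a f" and r: "0 < r" and q: "0 \<le> q" "r * q \<le> q'"
    and \<beta>: "real k + a = \<beta>" "0 \<le> \<beta>"
  shows "hoelder_le (q' powr \<beta>) a (\<lambda>z. r ^ k * f (p + dil r z))"
  unfolding hoelder_le_def
proof (intro allI)
  fix y z
  let ?f = "\<lambda>z. f (p + dil r z)"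
  have "\<bar>r ^ k * ?f y - r ^ k * ?f z\<bar> = r ^ k * \<bar>?f y - ?f z\<bar>"
    using r by (simp add: abs_mult flip: right_diff_distrib)
  also have "\<dots> \<le> r ^ k * (q powr \<beta> * pdist (p + dil r y) (p + dil r z) powr a)"
    using r by (intro mult_left_mono f[unfolded hoelder_le_def, rule_format]) auto
  also have "\<dots> \<le> q' powr \<beta> * pdist y z powr a"
    using r dil_amplitude_le[OF r q \<beta> pdist_nonneg[of y z]] by (simp add: pdist_dil)
  finally show "\<bar>r ^ k * ?f y - r ^ k * ?f z\<bar> \<le> q' powr \<beta> * pdist y z powr a" .
qed

text \<open>The size \<open>q\<close> of the noise has the dimension of an inverse length, hence so has the bound \<open>m\<close>
  on \<open>v\<close>; every noise term below has the amplitude dictated by this scaling.\<close>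

locale phi4_solution =
  fixes \<Phi> :: "pt \<Rightarrow> real" and \<epsilon> :: real and D :: "pt set" and m q :: real
    and v Y2 Y3 \<tau>1 \<tau>2 \<tau>3 :: "pt \<Rightarrow> real" and C :: real
  assumes kernel: "kernel \<Phi>" and eps_le: "\<epsilon> \<le> 1 / 2"
    and C12: "C12 v" "C12 Y2" "C12 Y3"
    and cont_noise: "continuous_on UNIV \<tau>1" "continuous_on UNIV \<tau>2" "continuous_on UNIV \<tau>3"
    and heat_v: "z \<in> D \<Longrightarrow> heat_op v z = - (v z ^ 3) - 3 * (v z)\<^sup>2 * \<tau>1 z - 3 * v z * \<tau>2 z - \<tau>3 z
      - 9 * C * (v z + \<tau>1 z)"
    and heat_Y2: "z \<in> D \<Longrightarrow> heat_op Y2 z = \<tau>2 z"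
    and heat_Y3: "z \<in> D \<Longrightarrow> heat_op Y3 z = \<tau>3 z"
    and v_le: "z \<in> D \<Longrightarrow> \<bar>v z\<bar> \<le> m"
    and Y2_noise: "hoelder_le (q powr (2 * (1 / 2 - \<epsilon>))) (1 - 2 * \<epsilon>) Y2"
    and Y3_noise: "hoelder_le (q powr (3 * (1 / 2 - \<epsilon>))) (1 / 2 - 3 * \<epsilon>) Y3"
    and \<tau>1_noise: "germ_le \<Phi> D (q powr (1 * (1 / 2 - \<epsilon>))) (- 1 / 2 - \<epsilon>) (\<lambda>_. \<tau>1)"
    and \<tau>2_noise: "germ_le \<Phi> D (q powr (2 * (1 / 2 - \<epsilon>))) (- 1 - 2 * \<epsilon>) (\<lambda>_. \<tau>2)"
    and \<tau>3_noise: "germ_le \<Phi> D (q powr (3 * (1 / 2 - \<epsilon>))) (- 3 / 2 - 3 * \<epsilon>) (\<lambda>_. \<tau>3)"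
    and X\<tau>2_noise: "germ_le \<Phi> D (q powr (2 * (1 / 2 - \<epsilon>))) (- 2 * \<epsilon>) (\<lambda>z y. snd (y - z) $ i * \<tau>2 y)"
    and Y2\<tau>2_noise: "germ_le \<Phi> D (q powr (4 * (1 / 2 - \<epsilon>))) (- 4 * \<epsilon>)
      (\<lambda>z y. (Y2 y - Y2 z) * \<tau>2 y - C)"
    and Y3\<tau>1_noise: "germ_le \<Phi> D (q powr (4 * (1 / 2 - \<epsilon>))) (- 4 * \<epsilon>) (\<lambda>z y. (Y3 y - Y3 z) * \<tau>1 y)"
    and Y3\<tau>2_noise: "germ_le \<Phi> D (q powr (5 * (1 / 2 - \<epsilon>))) (- 1 / 2 - 5 * \<epsilon>)
      (\<lambda>z y. (Y3 y - Y3 z) * \<tau>2 y - 3 * C * \<tau>1 y)"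
begin

lemma continuous_on_data [continuous_intros]:
  assumes "continuous_on S f"
  shows "continuous_on S (\<lambda>x. v (f x))" "continuous_on S (\<lambda>x. Y2 (f x))"
    "continuous_on S (\<lambda>x. Y3 (f x))" "continuous_on S (\<lambda>x. \<tau>1 (f x))"
    "continuous_on S (\<lambda>x. \<tau>2 (f x))" "continuous_on S (\<lambda>x. \<tau>3 (f x))"
  by (intro continuous_on_compose2[OF _ assms subset_UNIV] C12D(1) C12 cont_noise)+

lemma rescaled_heat_op:
  assumes z: "p + dil r z \<in> D"
  shows "heat_op (\<lambda>z. r * v (p + dil r z)) z = - ((r * v (p + dil r z)) ^ 3)
      - 3 * (r * v (p + dil r z))\<^sup>2 * (r * \<tau>1 (p + dil r z))
      - 3 * (r * v (p + dil r z)) * (r\<^sup>2 * \<tau>2 (p + dil r z)) - r ^ 3 * \<tau>3 (p + dil r z)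
      - 9 * (r\<^sup>2 * C) * (r * v (p + dil r z) + r * \<tau>1 (p + dil r z))"
    and "heat_op (\<lambda>z. Y2 (p + dil r z)) z = r\<^sup>2 * \<tau>2 (p + dil r z)"
    and "heat_op (\<lambda>z. r * Y3 (p + dil r z)) z = r ^ 3 * \<tau>3 (p + dil r z)"
  by (simp_all add: heat_op_cmult[OF C12_dil] heat_op_dil C12 heat_v[OF z] heat_Y2[OF z]
      heat_Y3[OF z] algebra_simps power2_eq_square power3_eq_cube)

lemma rescale:
  assumes r: "0 < r" "r \<le> 1" and D': "\<And>z. z \<in> D' \<Longrightarrow> p + dil r z \<in> D"
    and m': "r * m \<le> m'" and q: "0 \<le> q" "r * q \<le> q'"
  shows "phi4_solution \<Phi> \<epsilon> D' m' q' (\<lambda>z. r * v (p + dil r z)) (\<lambda>z. Y2 (p + dil r z))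
    (\<lambda>z. r * Y3 (p + dil r z)) (\<lambda>z. r * \<tau>1 (p + dil r z)) (\<lambda>z. r\<^sup>2 * \<tau>2 (p + dil r z))
    (\<lambda>z. r ^ 3 * \<tau>3 (p + dil r z)) (r\<^sup>2 * C)"
proof -
  let ?S = "\<lambda>z. p + dil r z"
  have snd_S: "snd (?S y - ?S z) $ i = r * snd (y - z) $ i" for y z i
    by (simp add: dil_def algebra_simps)
  note germ = germ_le_dil[OF kernel _ _ D' r q]
  note powers = power2_eq_square power3_eq_cube
  show ?thesis
  proof
    show "kernel \<Phi>" "\<epsilon> \<le> 1 / 2" by (fact kernel eps_le)+
    show "C12 (\<lambda>z. r * v (?S z))" "C12 (\<lambda>z. Y2 (?S z))" "C12 (\<lambda>z. r * Y3 (?S z))"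
      by (intro C12_cmult C12_dil C12)+
    show "continuous_on UNIV (\<lambda>z. r * \<tau>1 (?S z))" "continuous_on UNIV (\<lambda>z. r\<^sup>2 * \<tau>2 (?S z))"
      "continuous_on UNIV (\<lambda>z. r ^ 3 * \<tau>3 (?S z))" by (intro continuous_intros)+
    show "\<bar>r * v (?S z)\<bar> \<le> m'" if "z \<in> D'" for z
      using order_trans[OF mult_left_mono[OF v_le[OF D'[OF that]]] m'] r by (simp add: abs_mult)
    show "hoelder_le (q' powr (2 * (1 / 2 - \<epsilon>))) (1 - 2 * \<epsilon>) (\<lambda>z. Y2 (?S z))"
      using hoelder_le_dil[OF Y2_noise r(1) q, of 0] eps_le by simp
    show "hoelder_le (q' powr (3 * (1 / 2 - \<epsilon>))) (1 / 2 - 3 * \<epsilon>) (\<lambda>z. r * Y3 (?S z))"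
      using hoelder_le_dil[OF Y3_noise r(1) q, of 1] eps_le by simp
    show "germ_le \<Phi> D' (q' powr (1 * (1 / 2 - \<epsilon>))) (- 1 / 2 - \<epsilon>) (\<lambda>_ z. r * \<tau>1 (?S z))"
      by (rule germ[OF \<tau>1_noise, where k=1]) (use eps_le in \<open>auto intro: cont_noise\<close>)
    show "germ_le \<Phi> D' (q' powr (2 * (1 / 2 - \<epsilon>))) (- 1 - 2 * \<epsilon>) (\<lambda>_ z. r\<^sup>2 * \<tau>2 (?S z))"
      by (rule germ[OF \<tau>2_noise, where k=2]) (use eps_le in \<open>auto intro: cont_noise\<close>)
    show "germ_le \<Phi> D' (q' powr (3 * (1 / 2 - \<epsilon>))) (- 3 / 2 - 3 * \<epsilon>) (\<lambda>_ z. r ^ 3 * \<tau>3 (?S z))"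
      by (rule germ[OF \<tau>3_noise, where k=3]) (use eps_le in \<open>auto intro: cont_noise\<close>)
    show "germ_le \<Phi> D' (q' powr (2 * (1 / 2 - \<epsilon>))) (- 2 * \<epsilon>)
        (\<lambda>z y. snd (y - z) $ i * (r\<^sup>2 * \<tau>2 (?S y)))" for i
    proof (rule germ[OF X\<tau>2_noise, where k=1])
      show "snd (y - z) $ i * (r\<^sup>2 * \<tau>2 (?S y)) = r ^ 1 * (snd (?S y - ?S z) $ i * \<tau>2 (?S y))"
        for y z
        unfolding snd_S by (simp add: powers)
    qed (use eps_le in \<open>auto intro!: continuous_intros\<close>)
    show "germ_le \<Phi> D' (q' powr (4 * (1 / 2 - \<epsilon>))) (- 4 * \<epsilon>)
        (\<lambda>z y. (Y2 (?S y) - Y2 (?S z)) * (r\<^sup>2 * \<tau>2 (?S y)) - r\<^sup>2 * C)"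
      by (rule germ[OF Y2\<tau>2_noise, where k=2], intro continuous_intros)
         (use eps_le in \<open>auto simp: algebra_simps\<close>)
    show "germ_le \<Phi> D' (q' powr (4 * (1 / 2 - \<epsilon>))) (- 4 * \<epsilon>)
        (\<lambda>z y. (r * Y3 (?S y) - r * Y3 (?S z)) * (r * \<tau>1 (?S y)))"
      by (rule germ[OF Y3\<tau>1_noise, where k=2], intro continuous_intros)
         (use eps_le in \<open>auto simp: algebra_simps powers\<close>)
    show "germ_le \<Phi> D' (q' powr (5 * (1 / 2 - \<epsilon>))) (- 1 / 2 - 5 * \<epsilon>)
        (\<lambda>z y. (r * Y3 (?S y) - r * Y3 (?S z)) * (r\<^sup>2 * \<tau>2 (?S y))
          - 3 * (r\<^sup>2 * C) * (r * \<tau>1 (?S y)))"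
      by (rule germ[OF Y3\<tau>2_noise, where k=3], intro continuous_intros)
         (use eps_le in \<open>auto simp: algebra_simps powers\<close>)
  qed (erule rescaled_heat_op[OF D'])+
qed

end

section \<open>The local expansion\<close>

definition expansion_slope :: "(pt \<Rightarrow> real) \<Rightarrow> (pt \<Rightarrow> real) \<Rightarrow> (pt \<Rightarrow> real) \<Rightarrow> 3 \<Rightarrow> pt \<Rightarrow> real" where
  "expansion_slope v Y2 Y3 i z = pdv (xdir i) v z + pdv (xdir i) Y3 z + 3 * v z * pdv (xdir i) Y2 z"

definition expansion_increment :: "(pt \<Rightarrow> real) \<Rightarrow> (pt \<Rightarrow> real) \<Rightarrow> (pt \<Rightarrow> real) \<Rightarrow> pt \<Rightarrow> pt \<Rightarrow> real" where
  "expansion_increment v Y2 Y3 y z = v y - v z + (Y3 y - Y3 z) + 3 * v z * (Y2 y - Y2 z)"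

definition expansion_rem :: "(pt \<Rightarrow> real) \<Rightarrow> (pt \<Rightarrow> real) \<Rightarrow> (pt \<Rightarrow> real) \<Rightarrow> pt \<Rightarrow> pt \<Rightarrow> real" where
  "expansion_rem v Y2 Y3 y z = taylor_rem v y z + taylor_rem Y3 y z + 3 * v z * taylor_rem Y2 y z"

lemma expansion_rem_eq: "expansion_rem v Y2 Y3 y z
    = expansion_increment v Y2 Y3 y z - (\<Sum>i\<in>UNIV. expansion_slope v Y2 Y3 i z * snd (y - z) $ i)"
  by (simp add: expansion_rem_def taylor_rem_def expansion_increment_def expansion_slope_def
      algebra_simps sum.distrib sum_distrib_left sum_subtractf)

lemma expansion_rem_self [simp]: "expansion_rem v Y2 Y3 z z = 0"
  by (simp add: expansion_rem_def)

lemma expansion_rem_dil: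
  assumes "C12 v" "C12 Y2" "C12 Y3"
  shows "expansion_rem (\<lambda>z. r * v (p + dil r z)) (\<lambda>z. Y2 (p + dil r z))
      (\<lambda>z. r * Y3 (p + dil r z)) y z
    = r * expansion_rem v Y2 Y3 (p + dil r y) (p + dil r z)"
  using taylor_rem_cmult_dil[OF assms(2), of 1 p r]
  by (simp add: expansion_rem_def taylor_rem_cmult_dil assms algebra_simps)

lemma expansion_rem_change_base:
  "expansion_rem v Y2 Y3 y z - expansion_rem v Y2 Y3 y w
    = expansion_rem v Y2 Y3 w z + 3 * (v z - v w) * (Y2 y - Y2 w)
     - (\<Sum>i\<in>UNIV. (expansion_slope v Y2 Y3 i z - expansion_slope v Y2 Y3 i w) * snd (y - w) $ i)"
proof -
  have "(\<Sum>i\<in>UNIV. expansion_slope v Y2 Y3 i z * snd (y - z) $ i)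
      = (\<Sum>i\<in>UNIV. expansion_slope v Y2 Y3 i z * snd (y - w) $ i)
        + (\<Sum>i\<in>UNIV. expansion_slope v Y2 Y3 i z * snd (w - z) $ i)"
    by (simp add: sum.distrib[symmetric] algebra_simps)
  then show ?thesis
    unfolding expansion_rem_eq expansion_increment_def
    by (simp add: algebra_simps sum_subtractf sum.distrib)
qed

lemma
  assumes "C12 v" "C12 Y2" "C12 Y3"
  shows expansion_rem_C12: "C12 (\<lambda>y. expansion_rem v Y2 Y3 y p)"
    and heat_op_expansion_rem: "heat_op (\<lambda>y. expansion_rem v Y2 Y3 y p) z
      = heat_op v z + heat_op Y3 z + 3 * v p * heat_op Y2 z"
proof -
  note C = has_C12_add[OF
      has_C12_add[OF has_C12_taylor_rem[OF assms(1)] has_C12_taylor_rem[OF assms(3)]]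
      has_C12_cmult[OF has_C12_taylor_rem[OF assms(2)]], of p p "3 * v p" p,
      folded expansion_rem_def]
  show "C12 (\<lambda>y. expansion_rem v Y2 Y3 y p)" by (rule has_C12D(5)[OF C])
  show "heat_op (\<lambda>y. expansion_rem v Y2 Y3 y p) z
      = heat_op v z + heat_op Y3 z + 3 * v p * heat_op Y2 z"
    unfolding has_C12D(4)[OF C] heat_op_def
    by (simp add: sum.distrib sum_distrib_left algebra_simps)
qed

lemma conv_le_cmult_powr:
  assumes "conv_le \<psi> z f (b * S powr \<beta>)" "\<bar>c\<bar> \<le> a * S powr \<alpha>" "\<gamma> \<le> \<alpha> + \<beta>"
    and "0 < S" "S \<le> 1" "0 \<le> a" "0 \<le> b"
  shows "conv_le \<psi> z (\<lambda>y. c * f y) (a * b * S powr \<gamma>)"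
proof (rule conv_le_mono[OF conv_le_cmult[OF assms(1,2)]])
  have "a * S powr \<alpha> * (b * S powr \<beta>) = a * b * S powr (\<alpha> + \<beta>)" by (simp add: powr_add)
  also have "\<dots> \<le> a * b * S powr \<gamma>" using assms by (intro mult_left_mono powr_antimono_exponent) auto
  finally show "a * S powr \<alpha> * (b * S powr \<beta>) \<le> a * b * S powr \<gamma>" .
qed

lemma conv_le_cong:
  assumes "mollifier r \<psi>" "conv_le \<psi> z g B" "continuous_on UNIV f"
    and "\<And>y. y \<in> past_cball z r \<Longrightarrow> f y = g y"
  shows "conv_le \<psi> z f B"
  using assms conv_cong[OF assms(1,3) _ assms(4)] by (simp add: conv_le_def)

text \<open>For \<open>\<epsilon> < 1 / 100\<close>, noise size at most \<open>1\<close> and scales at most \<open>1\<close>, the exponents may be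
  weakened to fixed ones, which makes all constants below independent of \<open>\<epsilon>\<close>.\<close>

definition noise_level :: "real \<Rightarrow> real" where "noise_level q = q powr (2 / 5)"

locale small_noise = phi4_solution \<Phi> \<epsilon> D 2 q v Y2 Y3 \<tau>1 \<tau>2 \<tau>3 C
  for \<Phi> \<epsilon> D q v Y2 Y3 \<tau>1 \<tau>2 \<tau>3 C +
  assumes eps: "0 < \<epsilon>" "\<epsilon> < 1 / 100" and q: "0 < q" "q \<le> 1"
begin

abbreviation "\<delta> \<equiv> noise_level q"

lemma noise_level_bounds: "0 < \<delta>" "\<delta> \<le> 1"
  using q by (auto simp: noise_level_def intro: powr_le1)

lemma noise_amplitude_le:
  assumes "2 / 5 \<le> \<beta>" "b \<le> a" "0 \<le> d" "d \<le> 1"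
  shows "q powr \<beta> * d powr a \<le> \<delta> * d powr b"
  unfolding noise_level_def using assms q by (intro mult_mono powr_antimono_exponent) auto

lemma hoelder_noise_le:
  assumes f: "hoelder_le (q powr \<beta>) a f" "2 / 5 \<le> \<beta>" "0 \<le> b" "b \<le> a" and S: "pdist y z \<le> S" "S \<le> 1"
  shows "\<bar>f y - f z\<bar> \<le> \<delta> * S powr b"
proof -
  have "\<bar>f y - f z\<bar> \<le> q powr \<beta> * pdist y z powr a" using f(1) by (simp add: hoelder_le_def)
  also have "\<dots> \<le> \<delta> * pdist y z powr b" using f S by (intro noise_amplitude_le) auto
  also have "\<dots> \<le> \<delta> * S powr b"
    using f S noise_level_bounds by (intro mult_left_mono powr_mono2) auto
  finally show ?thesis .
qed

lemma Y2_increment_le: "pdist y z \<le> S \<Longrightarrow> S \<le> 1 \<Longrightarrow> \<bar>Y2 y - Y2 z\<bar> \<le> \<delta> * S powr (19 / 20)"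
  and Y3_increment_le: "pdist y z \<le> S \<Longrightarrow> S \<le> 1 \<Longrightarrow> \<bar>Y3 y - Y3 z\<bar> \<le> \<delta> * S powr (9 / 20)"
  by (rule hoelder_noise_le[OF Y2_noise] hoelder_noise_le[OF Y3_noise]; use eps in simp)+

lemma psi_mollifier: "0 < T \<Longrightarrow> mollifier T (PsiT \<Phi> T)"
  by (rule PsiT_mollifier[OF kernel])

lemma psi_Cc: "0 < T \<Longrightarrow> Cc (PsiT \<Phi> T)"
  by (rule PsiT_Cc[OF kernel])

lemma germ_noise_le:
  assumes F: "germ_le \<Phi> D (q powr \<beta>) a F" "2 / 5 \<le> \<beta>" "b \<le> a" "continuous_on UNIV (F z)"
    and z: "z \<in> D" and T: "0 < T" "T < 1"
  shows "conv_le (PsiT \<Phi> T) z (F z) (\<delta> * T powr b)"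
proof (rule conv_leI[OF psi_Cc[OF T(1)] F(4)])
  have "\<bar>mollify \<Phi> T (F z) z\<bar> \<le> q powr \<beta> * T powr a" by (rule germ_leD[OF F(1) z T])
  also have "\<dots> \<le> \<delta> * T powr b" using F T by (intro noise_amplitude_le) auto
  finally show "\<bar>conv (PsiT \<Phi> T) (F z) z\<bar> \<le> \<delta> * T powr b" by (simp add: mollify_def)
qed

context
  fixes z :: pt and T :: real
  assumes z: "z \<in> D" and T: "0 < T" "T < 1"
begin

lemma \<tau>1_le: "conv_le (PsiT \<Phi> T) z \<tau>1 (\<delta> * T powr (- 11 / 20))"
  and \<tau>2_le: "conv_le (PsiT \<Phi> T) z \<tau>2 (\<delta> * T powr (- 21 / 20))"
  and \<tau>3_le: "conv_le (PsiT \<Phi> T) z \<tau>3 (\<delta> * T powr (- 31 / 20))"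
  by (rule germ_noise_le[OF \<tau>1_noise _ _ _ z T] germ_noise_le[OF \<tau>2_noise _ _ _ z T]
      germ_noise_le[OF \<tau>3_noise _ _ _ z T]; use eps in \<open>simp add: cont_noise\<close>)+

lemma X\<tau>2_le: "conv_le (PsiT \<Phi> T) z (\<lambda>y. snd (y - z) $ i * \<tau>2 y) (\<delta> * T powr (- 1 / 20))"
  by (rule germ_noise_le[OF X\<tau>2_noise _ _ _ z T]) (use eps in \<open>auto intro!: continuous_intros\<close>)

lemma Y2\<tau>2_le: "conv_le (PsiT \<Phi> T) z (\<lambda>y. (Y2 y - Y2 z) * \<tau>2 y - C) (\<delta> * T powr (- 1 / 20))"
  by (rule germ_noise_le[OF Y2\<tau>2_noise _ _ _ z T]) (use eps in \<open>auto intro!: continuous_intros\<close>)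

lemma Y3\<tau>1_le: "conv_le (PsiT \<Phi> T) z (\<lambda>y. (Y3 y - Y3 z) * \<tau>1 y) (\<delta> * T powr (- 1 / 20))"
  by (rule germ_noise_le[OF Y3\<tau>1_noise _ _ _ z T]) (use eps in \<open>auto intro!: continuous_intros\<close>)

lemma Y3\<tau>2_le:
  "conv_le (PsiT \<Phi> T) z (\<lambda>y. (Y3 y - Y3 z) * \<tau>2 y - 3 * C * \<tau>1 y) (\<delta> * T powr (- 11 / 20))"
  by (rule germ_noise_le[OF Y3\<tau>2_noise _ _ _ z T]) (use eps in \<open>auto intro!: continuous_intros\<close>)

end

lemma cont_expansion_rem [continuous_intros]:
  "continuous_on S f \<Longrightarrow> continuous_on S g \<Longrightarrow> continuous_on S (\<lambda>x. expansion_rem v Y2 Y3 (f x) (g x))"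
  unfolding expansion_rem_def by (intro continuous_intros continuous_on_taylor_rem C12)

lemma cont_heat_op [continuous_intros]:
  assumes "continuous_on S f"
  shows "continuous_on S (\<lambda>x. heat_op v (f x))" "continuous_on S (\<lambda>x. heat_op Y2 (f x))"
    "continuous_on S (\<lambda>x. heat_op Y3 (f x))"
  by (intro continuous_on_compose2[OF continuous_on_heat_op assms subset_UNIV] C12)+

end

locale local_solution = small_noise \<Phi> \<epsilon> "past_cball 0 1" q v Y2 Y3 \<tau>1 \<tau>2 \<tau>3 C
  for \<Phi> \<epsilon> q v Y2 Y3 \<tau>1 \<tau>2 \<tau>3 C +
  fixes N :: real
  assumes N: "1 \<le> N"
    and expansion_rem_le: "z \<in> past_cball 0 (1 / 2) \<Longrightarrow> y \<in> past_cball z (1 / 4) \<Longrightarrow>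
      \<bar>expansion_rem v Y2 Y3 y z\<bar> \<le> N * pdist y z powr (5 / 4)"
begin

abbreviation "rem \<equiv> expansion_rem v Y2 Y3"
abbreviation "inc \<equiv> expansion_increment v Y2 Y3"
abbreviation "\<nu> \<equiv> expansion_slope v Y2 Y3"

lemma in_unit_ball: "z \<in> past_cball 0 s \<Longrightarrow> y \<in> past_cball z r \<Longrightarrow> r + s \<le> 1 \<Longrightarrow> y \<in> past_cball 0 1"
  by (rule past_cball_trans)

lemma rem_le:
  assumes "z \<in> past_cball 0 (1 / 2)" "y \<in> past_cball z S" "S \<le> 1 / 4"
  shows "\<bar>rem y z\<bar> \<le> N * S powr (5 / 4)"
proof -
  have "\<bar>rem y z\<bar> \<le> N * pdist y z powr (5 / 4)"
    by (rule expansion_rem_le[OF assms(1) past_cball_mono[OF assms(2,3)]])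
  also have "\<dots> \<le> N * S powr (5 / 4)"
    using assms(2) N by (intro mult_left_mono powr_mono2) (auto simp: mem_past_cball)
  finally show ?thesis .
qed

lemma inc_le:
  assumes y: "y \<in> past_cball 0 1" and z: "z \<in> past_cball 0 1" and d: "pdist y z \<le> 1"
  shows "\<bar>inc y z\<bar> \<le> 11"
proof -
  have "\<bar>Y3 y - Y3 z\<bar> \<le> 1" "\<bar>Y2 y - Y2 z\<bar> \<le> 1"
    using Y3_increment_le[OF d] Y2_increment_le[OF d] noise_level_bounds by simp_all
  moreover from this have "\<bar>3 * v z * (Y2 y - Y2 z)\<bar> \<le> 6 * 1"
    unfolding abs_mult using v_le[OF z] by (intro mult_mono) auto
  ultimately show ?thesis using v_le[OF y] v_le[OF z] unfolding expansion_increment_def by linarith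
qed

lemma slope_at_scale_le:
  assumes z: "z \<in> past_cball 0 (1 / 2)" and s: "0 < s" "s \<le> 1 / 4"
  shows "\<bar>\<nu> i z\<bar> * s \<le> N * s powr (5 / 4) + 11"
proof -
  let ?y = "z + s *\<^sub>R xdir i"
  have y: "?y \<in> past_cball z s" using s by (simp add: mem_past_cball)
  have "?y \<in> past_cball 0 1" "z \<in> past_cball 0 1"
    using in_unit_ball[OF z y] past_cball_mono[OF z] s by auto
  then have "\<bar>inc ?y z\<bar> \<le> 11" using s by (intro inc_le) auto
  moreover have "rem ?y z = inc ?y z - \<nu> i z * s"
    unfolding expansion_rem_eq using sum_mult_xdir[of "\<lambda>j. \<nu> j z" s i] by simp
  ultimately have "\<bar>\<nu> i z * s\<bar> \<le> N * s powr (5 / 4) + 11" using rem_le[OF z y s(2)] by simp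
  then show ?thesis using s by (simp add: abs_mult)
qed

lemma slope_le: assumes "z \<in> past_cball 0 (1 / 2)" shows "\<bar>\<nu> i z\<bar> \<le> 48 * N"
proof -
  have "\<bar>\<nu> i z\<bar> * (1 / 4) \<le> N * (1 / 4) powr (5 / 4) + 11"
    by (rule slope_at_scale_le[OF assms]) auto
  moreover have "N * (1 / 4) powr (5 / 4) \<le> N * 1" using N by (intro mult_left_mono powr_le1) auto
  ultimately show ?thesis using N by linarith
qed

context
  fixes y z :: pt and S :: real
  assumes z: "z \<in> past_cball 0 (1 / 2)" and y: "y \<in> past_cball z S" and S: "S \<le> 1 / 4"
begin

lemma increment_points: "0 \<le> S" "pdist y z \<le> S" "S \<le> 1" "z \<in> past_cball 0 1" "y \<in> past_cball 0 1"
  using y S past_cball_mono[OF z, of 1] in_unit_ball[OF z y]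
  by (auto simp: mem_past_cball intro: order_trans[OF pdist_nonneg])

lemma v_plus_Y3_increment_le:
  "\<bar>v y - v z + (Y3 y - Y3 z)\<bar> \<le> 145 * N * S + 6 * \<delta> * S powr (19 / 20)"
proof -
  have "N * S powr (5 / 4) \<le> N * S powr 1"
    using increment_points N by (intro mult_left_mono powr_antimono_exponent) auto
  then have "\<bar>rem y z\<bar> \<le> N * S" using rem_le[OF z y S] increment_points(1) by simp
  moreover have "\<bar>3 * v z * (Y2 y - Y2 z)\<bar> \<le> 6 * (\<delta> * S powr (19 / 20))"
    unfolding abs_mult using v_le[OF increment_points(4)]
    by (intro mult_mono Y2_increment_le increment_points) auto
  moreover have "\<bar>\<Sum>i\<in>UNIV. \<nu> i z * snd (y - z) $ i\<bar> \<le> real CARD(3) * (48 * N * S)"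
    by (intro abs_sum_mult_le slope_le z order_trans[OF component_le_pdist increment_points(2)])
  moreover have "v y - v z + (Y3 y - Y3 z)
      = rem y z + (\<Sum>i\<in>UNIV. \<nu> i z * snd (y - z) $ i) - 3 * v z * (Y2 y - Y2 z)"
    by (simp add: expansion_rem_eq expansion_increment_def)
  ultimately show ?thesis by simp
qed

lemma v_increment_le: "\<bar>v y - v z\<bar> \<le> 7 * \<delta> * S powr (9 / 20) + 145 * N * S"
proof -
  have "\<delta> * S powr (19 / 20) \<le> \<delta> * S powr (9 / 20)"
    using increment_points noise_level_bounds by (intro mult_left_mono powr_antimono_exponent) auto
  then show ?thesis using v_plus_Y3_increment_le Y3_increment_le[OF increment_points(2,3)] by simp
qed

lemma v_hoelder: "\<bar>v y - v z\<bar> \<le> 152 * N * S powr (9 / 20)"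
proof -
  have "145 * N * S powr 1 \<le> 145 * N * S powr (9 / 20)"
    using increment_points N by (intro mult_left_mono powr_antimono_exponent) auto
  moreover have "7 * \<delta> * S powr (9 / 20) \<le> 7 * N * S powr (9 / 20)"
    using noise_level_bounds N by (intro mult_right_mono) auto
  ultimately show ?thesis using v_increment_le increment_points(1) by simp
qed

text \<open>Bounding one factor of \<open>(v y - v z)\<^sup>2\<close> by \<open>4\<close> keeps the estimate linear in \<open>N\<close>.\<close>

lemma v_increment_square_le: "(v y - v z)\<^sup>2 \<le> 1644 * N * S powr (9 / 10)"
proof -
  define P where "P = S powr (9 / 10)"
  define a where "a = 7 * \<delta> * S powr (9 / 20)"
  define b where "b = 145 * N * S"
  have "S powr 1 \<le> P" unfolding P_def using increment_points by (intro powr_antimono_exponent) auto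
  then have S_le_P: "S \<le> P" "0 \<le> P" using increment_points(1) by (auto simp: P_def)
  have N_P: "P \<le> N * P" "N * S \<le> N * P" using N S_le_P mult_right_mono[OF N S_le_P(2)] by auto
  have \<delta>_square: "\<delta>\<^sup>2 \<le> 1" using noise_level_bounds by (simp add: power_le_one)
  have "a\<^sup>2 = 49 * \<delta>\<^sup>2 * P"
    by (simp add: a_def P_def power_mult_distrib power2_eq_square flip: powr_add)
  then have a_square: "a\<^sup>2 \<le> 49 * P" using mult_right_mono[OF \<delta>_square S_le_P(2)] by simp
  have "\<delta> * S powr (9 / 20) \<le> 1 * 1"
    using noise_level_bounds increment_points by (intro mult_mono powr_le1) auto
  then have a: "0 \<le> a" "a \<le> 7" using noise_level_bounds by (auto simp: a_def)
  have b: "0 \<le> b" using N increment_points by (simp add: b_def)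
  have increment_le: "\<bar>v y - v z\<bar> \<le> a + b" "\<bar>v y - v z\<bar> \<le> 4"
    using v_increment_le v_le[OF increment_points(4)] v_le[OF increment_points(5)]
    by (auto simp: a_def b_def)
  have "(v y - v z)\<^sup>2 = \<bar>v y - v z\<bar> * \<bar>v y - v z\<bar>" by (simp add: power2_eq_square)
  also have "\<dots> \<le> \<bar>v y - v z\<bar> * a + \<bar>v y - v z\<bar> * b"
    using mult_left_mono[OF increment_le(1), of "\<bar>v y - v z\<bar>"] by (simp add: distrib_left)
  also have "\<dots> \<le> (a + b) * a + 4 * b" by (intro add_mono mult_right_mono increment_le a b)
  also have "\<dots> \<le> a\<^sup>2 + 7 * b + 4 * b"
    using mult_right_mono[OF a(2) b] by (simp add: power2_eq_square algebra_simps)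
  also have "\<dots> \<le> 1644 * N * P" using a_square N_P by (simp add: b_def)
  finally show ?thesis by (simp add: P_def)
qed

lemma v_square_increment_le:
  "\<bar>(v y)\<^sup>2 - (v z)\<^sup>2 + 2 * v z * (Y3 y - Y3 z)\<bar> \<le> 2300 * N * S powr (9 / 10)"
proof -
  define P where "P = S powr (9 / 10)"
  have P: "S powr 1 \<le> P" "S powr (19 / 20) \<le> P"
    unfolding P_def using increment_points by (intro powr_antimono_exponent; simp)+
  then have "N * S \<le> N * P" "\<delta> * S powr (19 / 20) \<le> N * P"
    using noise_level_bounds N increment_points by (auto intro!: mult_mono mult_left_mono)
  then have "\<bar>v y - v z + (Y3 y - Y3 z)\<bar> \<le> 151 * N * P" using v_plus_Y3_increment_le by linarith
  then have "\<bar>2 * v z * (v y - v z + (Y3 y - Y3 z))\<bar> \<le> 4 * (151 * N * P)"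
    unfolding abs_mult using v_le[OF increment_points(4)] by (intro mult_mono) auto
  moreover have "(v y)\<^sup>2 - (v z)\<^sup>2 + 2 * v z * (Y3 y - Y3 z)
      = (v y - v z)\<^sup>2 + 2 * v z * (v y - v z + (Y3 y - Y3 z))"
    by (simp add: power2_eq_square algebra_simps)
  moreover have "0 \<le> N * P" using N by (simp add: P_def)
  ultimately show ?thesis
    using v_increment_square_le zero_le_power2[of "v y - v z"] unfolding P_def by linarith
qed

end

lemma two_powr_five_quarters_le: "(2::real) powr (5 / 4) \<le> 3"
proof -
  have "((2::real) powr (5 / 4)) ^ 4 \<le> 3 ^ 4" by (simp add: powr_power)
  then show ?thesis using power_le_imp_le_base[of _ 3 "3::real"] by simp
qed

text \<open>Evaluating the change of base point at \<open>w + S *\<^sub>R xdir i\<close> isolates the slope difference.\<close>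

lemma slope_hoelder:
  assumes z: "z \<in> past_cball 0 (3 / 8)" and w: "w \<in> past_cball z S" and S: "0 < S" "S \<le> 1 / 8"
  shows "\<bar>\<nu> i z - \<nu> i w\<bar> \<le> 461 * N * S powr (1 / 4)"
proof -
  have z_half: "z \<in> past_cball 0 (1 / 2)" using past_cball_mono[OF z] by simp
  have w_half: "w \<in> past_cball 0 (1 / 2)" by (rule past_cball_trans[OF w z]) (use S in simp)
  define y where "y = w + S *\<^sub>R xdir i"
  have y: "y \<in> past_cball w S" "y \<in> past_cball z (2 * S)"
    using S add_xdir_in_past_cball[OF w, of S "2 * S" i] by (auto simp: y_def mem_past_cball)
  define R where "R = N * S powr (5 / 4)"
  have "0 \<le> R" using N by (simp add: R_def)
  have "N * (2 * S) powr (5 / 4) \<le> 3 * R"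
    using N S two_powr_five_quarters_le mult_right_mono[of "2 powr (5 / 4)" 3 R]
    by (simp add: R_def powr_mult mult_ac)
  then have rem: "\<bar>rem w z\<bar> \<le> R" "\<bar>rem y w\<bar> \<le> R" "\<bar>rem y z\<bar> \<le> 3 * R"
    using rem_le[OF z_half w] rem_le[OF w_half y(1)] rem_le[OF z_half y(2)] S
    unfolding R_def by auto
  have product: "\<bar>3 * (v z - v w) * (Y2 y - Y2 w)\<bar> \<le> 456 * R"
  proof -
    have "\<bar>3 * (v z - v w)\<bar> \<le> 456 * N * S powr (9 / 20)"
      using v_hoelder[OF z_half w] S by (simp add: abs_mult abs_minus_commute)
    moreover have "\<bar>Y2 y - Y2 w\<bar> \<le> 1 * S powr (19 / 20)"
      using order_trans[OF Y2_increment_le[of y w S] mult_right_mono[OF noise_level_bounds(2)]]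
        y(1) S by (simp add: mem_past_cball)
    ultimately have "\<bar>3 * (v z - v w) * (Y2 y - Y2 w)\<bar>
        \<le> (456 * N * S powr (9 / 20)) * (1 * S powr (19 / 20))"
      unfolding abs_mult[of "3 * (v z - v w)"] using N by (intro mult_mono) auto
    also have "\<dots> = 456 * N * S powr (7 / 5)" by (simp flip: powr_add)
    also have "\<dots> \<le> 456 * N * S powr (5 / 4)"
      using N S by (intro mult_left_mono powr_antimono_exponent) auto
    finally show ?thesis by (simp add: R_def)
  qed
  have "(\<Sum>j\<in>UNIV. (\<nu> j z - \<nu> j w) * snd (y - w) $ j) = (\<nu> i z - \<nu> i w) * S"
    using sum_mult_xdir[of "\<lambda>j. \<nu> j z - \<nu> j w" S i] by (simp add: y_def)
  with expansion_rem_change_base[of v Y2 Y3 y z w] rem product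
  have "\<bar>(\<nu> i z - \<nu> i w) * S\<bar> \<le> 461 * R"
    by linarith
  also have "\<dots> = 461 * N * S powr (1 / 4) * S" using S powr_add[of S "1 / 4" 1] by (simp add: R_def)
  finally show ?thesis using S by (simp add: abs_mult)
qed

lemma reconstruction_fifth:
  assumes T: "0 < T" and M: "0 \<le> M" and F: "continuous_on UNIV (\<lambda>(z, y). F z y)"
    and diagonal: "\<And>z. F z z = 0"
    and increment: "\<And>S z w. 0 < S \<Longrightarrow> S \<le> T / 2 \<Longrightarrow> z \<in> past_cball z\<^sub>0 (T - 2 * S) \<Longrightarrow>
      w \<in> past_cball z S \<Longrightarrow> conv_le (PsiT \<Phi> S) w (\<lambda>y. F z y - F w y) (M * S powr (1 / 5))"
  shows "conv_le (PsiT \<Phi> T) z\<^sub>0 (F z\<^sub>0) (7 * M * T powr (1 / 5))"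
proof (rule conv_leI[OF psi_Cc[OF T]])
  show "continuous_on UNIV (F z\<^sub>0)"
    using continuous_on_compose2[OF F, of UNIV "\<lambda>y. (z\<^sub>0, y)"] by (simp add: continuous_on_Pair)
  have "((2::real) powr (1 / 5)) ^ 5 = 2" by (simp add: powr_power)
  then have "(8 / 7) ^ Suc 4 \<le> ((2::real) powr (1 / 5)) ^ Suc 4" by (simp add: power_divide)
  then have "(8 / 7 :: real) \<le> 2 powr (1 / 5)" by (rule power_le_imp_le_base) simp
  then have "M / (2 powr (1 / 5) - 1) \<le> M / (1 / 7)" using M by (intro divide_left_mono) auto
  then have "M / (2 powr (1 / 5) - 1) * T powr (1 / 5) \<le> 7 * M * T powr (1 / 5)"
    by (intro mult_right_mono) auto
  moreover have "\<bar>mollify \<Phi> T (F z\<^sub>0) z\<^sub>0\<bar> \<le> M / (2 powr (1 / 5) - 1) * T powr (1 / 5)"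
  proof (rule reconstruction[OF kernel T _ F _ diagonal])
    show "\<bar>mollify \<Phi> S (\<lambda>y. F z y - F w y) w\<bar> \<le> M * S powr (1 / 5)"
      if "0 < S" "S \<le> T / 2" "z \<in> past_cball z\<^sub>0 (T - 2 * S)" "w \<in> past_cball z S" for S z w
      using conv_leD[OF increment[OF that]] by (simp add: mollify_def)
  qed simp
  ultimately show "\<bar>conv (PsiT \<Phi> T) (F z\<^sub>0) z\<^sub>0\<bar> \<le> 7 * M * T powr (1 / 5)"
    by (simp add: mollify_def)
qed

context
  fixes z\<^sub>0 z w :: pt and S T :: real
  assumes z\<^sub>0: "z\<^sub>0 \<in> past_cball 0 (1 / 4)" and T: "T \<le> 1 / 8" and S: "0 < S" "S \<le> T / 2"
    and z: "z \<in> past_cball z\<^sub>0 (T - 2 * S)" and w: "w \<in> past_cball z S"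
begin

lemma germ_points: "z \<in> past_cball 0 (3 / 8)" "z \<in> past_cball 0 (1 / 2)" "w \<in> past_cball 0 1"
  "S \<le> 1 / 16" "S < 1" "S \<le> 1"
proof -
  show S_le: "S \<le> 1 / 16" "S < 1" "S \<le> 1" using S T by auto
  show z_ball: "z \<in> past_cball 0 (3 / 8)" by (rule past_cball_trans[OF z z\<^sub>0]) (use S T in simp)
  then show "z \<in> past_cball 0 (1 / 2)" by (rule past_cball_mono) simp
  show "w \<in> past_cball 0 1" by (rule in_unit_ball[OF z_ball w]) (use S_le in simp)
qed

lemma rem_\<tau>2_germ_increment_le:
  "conv_le (PsiT \<Phi> S) w (\<lambda>y. rem y z * \<tau>2 y + 3 * C * (v y - v z)
    - (rem y w * \<tau>2 y + 3 * C * (v y - v w))) (1840 * N * \<delta> * S powr (1 / 5))"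
proof -
  have base_change: "(\<lambda>y. rem y z * \<tau>2 y + 3 * C * (v y - v z)
      - (rem y w * \<tau>2 y + 3 * C * (v y - v w)))
    = (\<lambda>y. rem w z * \<tau>2 y + 3 * (v z - v w) * ((Y2 y - Y2 w) * \<tau>2 y - C)
      - (\<Sum>i\<in>UNIV. (\<nu> i z - \<nu> i w) * (snd (y - w) $ i * \<tau>2 y)))"
  proof
    fix y
    have "rem y z * \<tau>2 y + 3 * C * (v y - v z) - (rem y w * \<tau>2 y + 3 * C * (v y - v w))
        = (rem y z - rem y w) * \<tau>2 y - 3 * C * (v z - v w)" by (simp add: algebra_simps)
    also have "\<dots> = rem w z * \<tau>2 y + 3 * (v z - v w) * ((Y2 y - Y2 w) * \<tau>2 y - C)
        - (\<Sum>i\<in>UNIV. (\<nu> i z - \<nu> i w) * snd (y - w) $ i) * \<tau>2 y"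
      unfolding expansion_rem_change_base[of v Y2 Y3 y z w] by (simp add: algebra_simps)
    finally show "rem y z * \<tau>2 y + 3 * C * (v y - v z) - (rem y w * \<tau>2 y + 3 * C * (v y - v w))
        = rem w z * \<tau>2 y + 3 * (v z - v w) * ((Y2 y - Y2 w) * \<tau>2 y - C)
          - (\<Sum>i\<in>UNIV. (\<nu> i z - \<nu> i w) * (snd (y - w) $ i * \<tau>2 y))"
      by (simp add: sum_distrib_right mult.assoc)
  qed
  note pts = germ_points
  have rem: "conv_le (PsiT \<Phi> S) w (\<lambda>y. rem w z * \<tau>2 y) (N * \<delta> * S powr (1 / 5))"
    by (rule conv_le_cmult_powr[OF \<tau>2_le[OF pts(3) S(1) pts(5)] rem_le[OF pts(2) w]])
       (use S pts N noise_level_bounds in auto)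
  have "\<bar>3 * (v z - v w)\<bar> \<le> (456 * N) * S powr (9 / 20)"
    using v_hoelder[OF pts(2) w] pts by (simp add: abs_mult abs_minus_commute)
  then have v: "conv_le (PsiT \<Phi> S) w (\<lambda>y. 3 * (v z - v w) * ((Y2 y - Y2 w) * \<tau>2 y - C))
      ((456 * N) * \<delta> * S powr (1 / 5))"
    by (rule conv_le_cmult_powr[OF Y2\<tau>2_le[OF pts(3) S(1) pts(5)]])
       (use S pts N noise_level_bounds in auto)
  have "\<bar>\<nu> i z - \<nu> i w\<bar> \<le> (461 * N) * S powr (1 / 4)" for i
    by (rule slope_hoelder[OF pts(1) w S(1)]) (use pts in simp)
  then have slope: "conv_le (PsiT \<Phi> S) w (\<lambda>y. (\<nu> i z - \<nu> i w) * (snd (y - w) $ i * \<tau>2 y))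
      ((461 * N) * \<delta> * S powr (1 / 5))" for i
    by (rule conv_le_cmult_powr[OF X\<tau>2_le[OF pts(3) S(1) pts(5)]])
       (use S pts N noise_level_bounds in auto)
  show ?thesis unfolding base_change
    by (rule conv_le_mono[OF conv_le_diff[OF conv_le_add[OF rem v] conv_le_sum[OF slope]]]) simp
qed

lemma square_\<tau>1_germ_increment_le:
  "conv_le (PsiT \<Phi> S) w (\<lambda>y. ((v y)\<^sup>2 - (v z)\<^sup>2 + 2 * v z * (Y3 y - Y3 z)) * \<tau>1 y
    - ((v y)\<^sup>2 - (v w)\<^sup>2 + 2 * v w * (Y3 y - Y3 w)) * \<tau>1 y) (2604 * N * \<delta> * S powr (1 / 5))"
proof -
  let ?W = "(v w)\<^sup>2 - (v z)\<^sup>2 + 2 * v z * (Y3 w - Y3 z)"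
  have base_change: "(\<lambda>y. ((v y)\<^sup>2 - (v z)\<^sup>2 + 2 * v z * (Y3 y - Y3 z)) * \<tau>1 y
      - ((v y)\<^sup>2 - (v w)\<^sup>2 + 2 * v w * (Y3 y - Y3 w)) * \<tau>1 y)
    = (\<lambda>y. ?W * \<tau>1 y + 2 * (v z - v w) * ((Y3 y - Y3 w) * \<tau>1 y))"
    by (auto simp: algebra_simps)
  note pts = germ_points
  have square: "conv_le (PsiT \<Phi> S) w (\<lambda>y. ?W * \<tau>1 y) ((2300 * N) * \<delta> * S powr (1 / 5))"
    by (rule conv_le_cmult_powr[OF \<tau>1_le[OF pts(3) S(1) pts(5)] v_square_increment_le[OF pts(2) w]])
       (use S pts N noise_level_bounds in auto)
  have "\<bar>2 * (v z - v w)\<bar> \<le> (304 * N) * S powr (9 / 20)"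
    using v_hoelder[OF pts(2) w] pts by (simp add: abs_mult abs_minus_commute)
  then have "conv_le (PsiT \<Phi> S) w (\<lambda>y. 2 * (v z - v w) * ((Y3 y - Y3 w) * \<tau>1 y))
      ((304 * N) * \<delta> * S powr (1 / 5))"
    by (rule conv_le_cmult_powr[OF Y3\<tau>1_le[OF pts(3) S(1) pts(5)]])
       (use S pts N noise_level_bounds in auto)
  from conv_le_add[OF square this] show ?thesis unfolding base_change by (rule conv_le_mono) simp
qed

end

context
  fixes z :: pt and T :: real
  assumes z: "z \<in> past_cball 0 (1 / 4)" and T: "0 < T" "T \<le> 1 / 8"
begin

lemma rem_\<tau>2_germ_le: "conv_le (PsiT \<Phi> T) z (\<lambda>y. rem y z * \<tau>2 y + 3 * C * (v y - v z))
    (7 * (1840 * N * \<delta>) * T powr (1 / 5))"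
  by (rule reconstruction_fifth[where F="\<lambda>z y. rem y z * \<tau>2 y + 3 * C * (v y - v z)", OF T(1)
        _ _ _ rem_\<tau>2_germ_increment_le[OF z T(2)]])
     (use N noise_level_bounds in \<open>auto simp: split_beta intro!: continuous_intros\<close>)

lemma square_\<tau>1_germ_le:
  "conv_le (PsiT \<Phi> T) z (\<lambda>y. ((v y)\<^sup>2 - (v z)\<^sup>2 + 2 * v z * (Y3 y - Y3 z)) * \<tau>1 y)
    (7 * (2604 * N * \<delta>) * T powr (1 / 5))"
  by (rule reconstruction_fifth[where
        F="\<lambda>z y. ((v y)\<^sup>2 - (v z)\<^sup>2 + 2 * v z * (Y3 y - Y3 z)) * \<tau>1 y",
        OF T(1) _ _ _ square_\<tau>1_germ_increment_le[OF z T(2)]])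
     (use N noise_level_bounds in \<open>auto simp: split_beta intro!: continuous_intros\<close>)

lemma slope_term_le:
  "conv_le (PsiT \<Phi> T) z (\<lambda>y. 3 * \<nu> i z * (snd (y - z) $ i * \<tau>2 y))
    (144 * (N * \<delta> * T powr (- 11 / 20)))"
proof (rule conv_le_mono[OF conv_le_cmult[OF X\<tau>2_le]])
  show "\<bar>3 * \<nu> i z\<bar> \<le> 144 * N"
    using slope_le[of z i] past_cball_mono[OF z] by (simp add: abs_mult)
  show "144 * N * (\<delta> * T powr (- 1 / 20)) \<le> 144 * (N * \<delta> * T powr (- 11 / 20))"
    using T N noise_level_bounds
    by (simp add: mult.assoc) (intro mult_left_mono powr_antimono_exponent; simp)
qed (use T past_cball_mono[OF z] in auto)

text \<open>In each product with a noise, \<open>v y\<close> is replaced by its expansion at \<open>z\<close>; the renormalisation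
  \<open>- 9 * C * (v y + \<tau>1 y)\<close> is distributed over the products that need it.\<close>

lemma rhs_expansion:
  assumes y: "y \<in> past_cball 0 1"
  shows "heat_op v y + heat_op Y3 y + 3 * v z * heat_op Y2 y + v y ^ 3 =
    - 3 * (v z)\<^sup>2 * \<tau>1 y + 6 * v z * ((Y3 y - Y3 z) * \<tau>1 y)
    - 3 * (((v y)\<^sup>2 - (v z)\<^sup>2 + 2 * v z * (Y3 y - Y3 z)) * \<tau>1 y)
    + 3 * ((Y3 y - Y3 z) * \<tau>2 y - 3 * C * \<tau>1 y) + 9 * v z * ((Y2 y - Y2 z) * \<tau>2 y - C)
    - 3 * (rem y z * \<tau>2 y + 3 * C * (v y - v z)) - (\<Sum>i\<in>UNIV. 3 * \<nu> i z * (snd (y - z) $ i * \<tau>2 y))"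
proof -
  have "(\<Sum>i\<in>UNIV. 3 * \<nu> i z * (snd (y - z) $ i * \<tau>2 y)) = 3 * (inc y z - rem y z) * \<tau>2 y"
    unfolding expansion_rem_eq by (simp add: sum_distrib_right sum_distrib_left mult_ac)
  then show ?thesis
    unfolding heat_v[OF y] heat_Y2[OF y] heat_Y3[OF y] expansion_increment_def by algebra
qed

lemma mollified_rhs_le:
  "conv_le (PsiT \<Phi> T) z (\<lambda>y. heat_op v y + heat_op Y3 y + 3 * v z * heat_op Y2 y + v y ^ 3)
    (100000 * N * \<delta> * T powr (- 11 / 20))"
proof -
  have T_less_1: "T < 1" and z_unit: "z \<in> past_cball 0 1"
    using T past_cball_mono[OF z, of 1] by auto
  have near: "y \<in> past_cball 0 1" if "y \<in> past_cball z T" for y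
    by (rule in_unit_ball[OF z that]) (use T in simp)
  define P where "P = N * \<delta> * T powr (- 11 / 20)"
  have \<delta>N: "\<delta> \<le> N * \<delta>" using mult_right_mono[OF N, of \<delta>] noise_level_bounds by simp
  have to_P: "\<delta> * T powr a \<le> P" if "- 11 / 20 \<le> a" for a
    unfolding P_def
    using T \<delta>N noise_level_bounds that by (intro mult_mono powr_antimono_exponent) auto
  have germ_to_P: "k * (N * \<delta>) * T powr (1 / 5) \<le> k * P" if "0 \<le> k" for k
    unfolding P_def mult.assoc using T N noise_level_bounds that
    by (intro mult_left_mono powr_antimono_exponent) auto
  have v_le_2: "\<bar>v z\<bar> \<le> 2" by (rule v_le[OF z_unit])
  have v_square: "(v z)\<^sup>2 \<le> 4" using power_mono[OF v_le_2, of 2] by simp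
  note le_P = conv_le_mono[OF _ to_P]
  have "conv_le (PsiT \<Phi> T) z (\<lambda>y. - 3 * (v z)\<^sup>2 * \<tau>1 y + 6 * v z * ((Y3 y - Y3 z) * \<tau>1 y)
      - 3 * (((v y)\<^sup>2 - (v z)\<^sup>2 + 2 * v z * (Y3 y - Y3 z)) * \<tau>1 y)
      + 3 * ((Y3 y - Y3 z) * \<tau>2 y - 3 * C * \<tau>1 y) + 9 * v z * ((Y2 y - Y2 z) * \<tau>2 y - C)
      - 3 * (rem y z * \<tau>2 y + 3 * C * (v y - v z))
      - (\<Sum>i\<in>UNIV. 3 * \<nu> i z * (snd (y - z) $ i * \<tau>2 y)))
    (12 * P + 12 * P + 3 * (18228 * P) + 3 * P + 18 * P + 3 * (12880 * P)
      + real CARD(3) * (144 * P))"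
    by (intro conv_le_diff conv_le_add conv_le_sum[OF slope_term_le[folded P_def]]
        conv_le_cmult[OF le_P[OF \<tau>1_le[OF z_unit T(1) T_less_1]]]
        conv_le_cmult[OF le_P[OF Y3\<tau>1_le[OF z_unit T(1) T_less_1]]]
        conv_le_cmult[OF le_P[OF Y3\<tau>2_le[OF z_unit T(1) T_less_1]]]
        conv_le_cmult[OF le_P[OF Y2\<tau>2_le[OF z_unit T(1) T_less_1]]]
        conv_le_cmult[OF conv_le_mono[OF square_\<tau>1_germ_le]]
        conv_le_cmult[OF conv_le_mono[OF rem_\<tau>2_germ_le]])
       (use v_le_2 v_square germ_to_P[of 18228] germ_to_P[of 12880] in \<open>simp_all add: abs_mult\<close>)
  then have "conv_le (PsiT \<Phi> T) z
    (\<lambda>y. heat_op v y + heat_op Y3 y + 3 * v z * heat_op Y2 y + v y ^ 3)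
    (12 * P + 12 * P + 3 * (18228 * P) + 3 * P + 18 * P + 3 * (12880 * P)
      + real CARD(3) * (144 * P))"
    by (rule conv_le_cong[OF psi_mollifier[OF T(1)] _ _ rhs_expansion[OF near]])
       (intro continuous_intros)
  then show ?thesis by (rule conv_le_mono) (use N noise_level_bounds in \<open>simp add: P_def\<close>)
qed

end

lemma mollified_frozen_rhs_le:
  assumes z: "z \<in> past_cball 0 L" and L: "L \<le> 1 / 4" and T: "0 < T" "T \<le> 1 / 8"
  shows "conv_le (PsiT \<Phi> T) z (\<lambda>y. heat_op v y + heat_op Y3 y + 3 * v 0 * heat_op Y2 y)
    (8 + 100000 * N * \<delta> * (T powr (- 11 / 20) + L powr (9 / 20) * T powr (- 21 / 20)))"
proof -
  have T_less_1: "T < 1" and z_quarter: "z \<in> past_cball 0 (1 / 4)" and z_unit: "z \<in> past_cball 0 1"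
    using T past_cball_mono[OF z L] past_cball_mono[OF z, of 1] L by auto
  have y: "y \<in> past_cball 0 1" if "y \<in> past_cball z T" for y
    by (rule in_unit_ball[OF z that]) (use L T in simp)
  have cube: "conv_le (PsiT \<Phi> T) z (\<lambda>y. v y ^ 3) 8"
  proof (rule conv_leI[OF psi_Cc[OF T(1)]])
    have "\<bar>v y ^ 3\<bar> \<le> 8" if "y \<in> past_cball z T" for y
      using power_mono[OF v_le[OF y[OF that]], of 3] by (simp add: power_abs)
    then show "\<bar>conv (PsiT \<Phi> T) (\<lambda>y. v y ^ 3) z\<bar> \<le> 8"
      by (intro abs_conv_le[OF psi_mollifier[OF T(1)]] continuous_intros)
  qed (intro continuous_intros)
  have "conv_le (PsiT \<Phi> T) z (heat_op Y2) (\<delta> * T powr (- 21 / 20))"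
    by (rule conv_le_cong[OF psi_mollifier[OF T(1)] \<tau>2_le[OF z_unit T(1) T_less_1]])
       (auto intro!: continuous_on_heat_op C12 heat_Y2 y)
  moreover have "\<bar>3 * (v 0 - v z)\<bar> \<le> 456 * N * L powr (9 / 20)"
    using v_hoelder[of 0 z L] z L by (simp add: abs_mult abs_minus_commute)
  ultimately have base: "conv_le (PsiT \<Phi> T) z (\<lambda>y. 3 * (v 0 - v z) * heat_op Y2 y)
      (456 * N * L powr (9 / 20) * (\<delta> * T powr (- 21 / 20)))"
    by (rule conv_le_cmult)
  have "conv_le (PsiT \<Phi> T) z (\<lambda>y. (heat_op v y + heat_op Y3 y + 3 * v z * heat_op Y2 y + v y ^ 3)
      - v y ^ 3 + 3 * (v 0 - v z) * heat_op Y2 y)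
      (8 + 100000 * N * \<delta> * (T powr (- 11 / 20) + L powr (9 / 20) * T powr (- 21 / 20)))"
  proof (rule conv_le_mono[OF
        conv_le_add[OF conv_le_diff[OF mollified_rhs_le[OF z_quarter T] cube] base]])
    have "456 * (N * \<delta> * (L powr (9 / 20) * T powr (- 21 / 20)))
        \<le> 100000 * (N * \<delta> * (L powr (9 / 20) * T powr (- 21 / 20)))"
      using N noise_level_bounds by (intro mult_right_mono) auto
    then show "100000 * N * \<delta> * T powr (- 11 / 20) + 8
        + 456 * N * L powr (9 / 20) * (\<delta> * T powr (- 21 / 20))
        \<le> 8 + 100000 * N * \<delta> * (T powr (- 11 / 20) + L powr (9 / 20) * T powr (- 21 / 20))"
      by (simp add: algebra_simps)
  qed
  then show ?thesis by (simp add: algebra_simps)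
qed

end

section \<open>Affine approximation at one scale\<close>

text \<open>At radius \<open>r\<close> the remainder is mollified at the smaller scale \<open>l * r\<close>, and the interior
  estimate is used on the larger ball of radius \<open>r / l\<close>. A small ratio \<open>l\<close> makes the contribution of
  the remainder itself small; smallness of the noise then beats the negative powers of \<open>l\<close>.\<close>

locale local_solution_at_scale = local_solution \<Phi> \<epsilon> q v Y2 Y3 \<tau>1 \<tau>2 \<tau>3 C N
  for \<Phi> \<epsilon> q v Y2 Y3 \<tau>1 \<tau>2 \<tau>3 C N +
  fixes \<Lambda> l r :: real
  assumes lip: "mollify_lipschitz \<Phi> \<Lambda>" and l: "0 < l" "l \<le> 1 / 4" and r: "0 < r" "r \<le> l / 8"
begin

definition L where "L = r / l"
definition T where "T = l * r"
definition noise_growth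
  where "noise_growth = T powr (- 11 / 20) + L powr (9 / 20) * T powr (- 21 / 20)"
definition rhs_bound where "rhs_bound = 8 + 1000000 * N * \<delta> * noise_growth"
definition rhs where "rhs = (\<lambda>y. heat_op v y + heat_op Y3 y + 3 * v 0 * heat_op Y2 y)"
definition mrem where "mrem = mollify \<Phi> T (\<lambda>y. rem y 0)"

lemma scales: "0 < L" "L \<le> 1 / 8" "0 < T" "T \<le> L / 16" "T \<le> r" "r \<le> L / 4" "r \<le> 1 / 32"
proof -
  show L: "0 < L" "L \<le> 1 / 8" using l r by (auto simp: L_def field_simps)
  have "l * l \<le> 1 / 4 * (1 / 4)" using l by (intro mult_mono) auto
  moreover have "T = l * l * L" using l by (simp add: T_def L_def)
  ultimately show "T \<le> L / 16" using L(1) mult_right_mono[of "l * l" "1 / 16" L] by simp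
  show "0 < T" "T \<le> r" "r \<le> 1 / 32" using l r by (auto simp: T_def intro: mult_left_le_one_le)
  show "r \<le> L / 4" using l r by (simp add: L_def field_simps)
qed

lemma continuous_on_rhs: "continuous_on UNIV rhs"
  unfolding rhs_def by (intro continuous_intros)

lemma mrem_C12: "C12 mrem"
  and heat_op_mrem: "heat_op mrem z = mollify \<Phi> T rhs z"
  unfolding mrem_def rhs_def mollify_eq_conv[OF kernel]
  by (auto intro!: C12_conv psi_Cc scales expansion_rem_C12 C12
      simp: heat_op_conv[OF psi_Cc[OF scales(3)] expansion_rem_C12[OF C12]]
        heat_op_expansion_rem[OF C12, abs_def])

lemma mrem_le: assumes z: "z \<in> past_cball 0 L" shows "\<bar>mrem z\<bar> \<le> N * (2 * L) powr (5 / 4)"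
  unfolding mrem_def mollify_eq_conv[OF kernel]
proof (rule abs_conv_le[OF psi_mollifier[OF scales(3)]])
  fix y assume "y \<in> past_cball z T"
  then have "y \<in> past_cball 0 (2 * L)" by (rule past_cball_trans[OF _ z]) (use scales in linarith)
  then show "\<bar>rem y 0\<bar> \<le> N * (2 * L) powr (5 / 4)" by (rule rem_le[rotated]) (use scales in auto)
qed (intro continuous_intros)

lemma mollify_rhs_le:
  assumes z: "z \<in> past_cball 0 (2 * L)" and S: "T / 2 \<le> S" "S \<le> T"
  shows "\<bar>mollify \<Phi> S rhs z\<bar> \<le> rhs_bound"
proof -
  have S_pos: "0 < S" "S \<le> 1 / 8" "2 * L \<le> 1 / 4" using S scales by auto
  have negative: "S powr (- a) \<le> 4 * T powr (- a)" if "0 \<le> a" "a \<le> 2" for a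
  proof -
    have "S powr (- a) \<le> (T / 2) powr (- a)" using S scales that by (intro powr_mono2') auto
    also have "\<dots> = 2 powr a * T powr (- a)"
      using scales by (simp add: powr_divide powr_minus_divide)
    also have "\<dots> \<le> 2 powr 2 * T powr (- a)" using that by (intro mult_right_mono powr_mono) auto
    finally show ?thesis by simp
  qed
  have "(2 * L) powr (9 / 20) = 2 powr (9 / 20) * L powr (9 / 20)"
    using scales by (simp add: powr_mult)
  also have "\<dots> \<le> 2 powr 1 * L powr (9 / 20)" by (intro mult_right_mono powr_mono) auto
  finally have "(2 * L) powr (9 / 20) * S powr (- 21 / 20)
      \<le> (2 * L powr (9 / 20)) * (4 * T powr (- 21 / 20))"
    using negative[of "21 / 20"] by (intro mult_mono) auto
  also have "\<dots> = 8 * (L powr (9 / 20) * T powr (- 21 / 20))" by simp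
  finally have "(2 * L) powr (9 / 20) * S powr (- 21 / 20)
      \<le> 10 * (L powr (9 / 20) * T powr (- 21 / 20))"
    by (rule order_trans) (intro mult_right_mono; simp)
  moreover have "S powr (- 11 / 20) \<le> 10 * T powr (- 11 / 20)"
    using order_trans[OF negative[of "11 / 20"], of "10 * T powr (- (11 / 20))"] by simp
  ultimately have "S powr (- 11 / 20) + (2 * L) powr (9 / 20) * S powr (- 21 / 20)
      \<le> 10 * noise_growth"
    unfolding noise_growth_def distrib_left by (intro add_mono)
  then have "100000 * N * \<delta> * (S powr (- 11 / 20) + (2 * L) powr (9 / 20) * S powr (- 21 / 20))
      \<le> 100000 * N * \<delta> * (10 * noise_growth)"
    using N noise_level_bounds by (intro mult_left_mono) auto
  with conv_leD[OF mollified_frozen_rhs_le[OF z S_pos(3,1,2)]] show ?thesis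
    by (simp add: rhs_bound_def rhs_def mollify_def)
qed

lemma heat_op_mrem_le: "z \<in> past_cball 0 L \<Longrightarrow> \<bar>heat_op mrem z\<bar> \<le> rhs_bound"
  unfolding heat_op_mrem by (rule mollify_rhs_le) (use scales in \<open>auto elim: past_cball_mono\<close>)

lemma heat_op_mrem_lipschitz:
  assumes z: "z \<in> past_cball 0 L" and s: "\<bar>s\<bar> \<le> T"
  shows "\<bar>heat_op mrem (z + s *\<^sub>R xdir i) - heat_op mrem z\<bar> \<le> \<Lambda> * rhs_bound / T * \<bar>s\<bar>"
  unfolding heat_op_mrem
proof (rule mollify_lipschitzD[OF lip scales(3) continuous_on_rhs s])
  fix y assume "y \<in> past_cball z (2 * T)"
  then have "y \<in> past_cball 0 (2 * L)" by (rule past_cball_trans[OF _ z]) (use scales in linarith)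
  then show "\<bar>mollify \<Phi> (T / 2) rhs y\<bar> \<le> rhs_bound" by (rule mollify_rhs_le) (use scales in auto)
qed

lemma taylor_rem_mrem_le:
  assumes y: "y \<in> past_cball 0 r"
  shows "\<bar>taylor_rem mrem y 0\<bar>
    \<le> 24000 * (N * (2 * L) powr (5 / 4) / L\<^sup>2 + rhs_bound + \<Lambda> * rhs_bound / T * L) * r\<^sup>2"
  by (rule interior_taylor[OF mrem_C12 scales(1) _ mrem_le heat_op_mrem_le scales(3)
        heat_op_mrem_lipschitz scales(6) y])
     (use N scales in auto)

lemma powr_scales: "L powr a = l powr (- a) * r powr a" "T powr a = l powr a * r powr a"
  using l r by (simp_all add: L_def T_def powr_divide powr_mult powr_minus_divide)

lemma rem_term_le: "N * (2 * L) powr (5 / 4) / L\<^sup>2 * r\<^sup>2 \<le> 3 * N * l powr (3 / 4) * r powr (5 / 4)"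
proof -
  have "N * (2 * L) powr (5 / 4) / L\<^sup>2 * r\<^sup>2
      = 2 powr (5 / 4) * N * (L powr (5 / 4) / L\<^sup>2 * r\<^sup>2)"
    using scales by (simp add: powr_mult)
  also have "L powr (5 / 4) / L\<^sup>2 = L powr (- 3 / 4)" using scales powr_diff[of L "5 / 4" 2] by simp
  also have "L powr (- 3 / 4) * r\<^sup>2 = l powr (3 / 4) * r powr (5 / 4)"
    using r powr_add[of r "- 3 / 4" 2] by (simp add: powr_scales mult.assoc)
  also have "2 powr (5 / 4) * N * (l powr (3 / 4) * r powr (5 / 4))
      \<le> 3 * N * (l powr (3 / 4) * r powr (5 / 4))"
    using N by (intro mult_right_mono two_powr_five_quarters_le) auto
  finally show ?thesis by (simp add: mult.assoc)
qed

lemma noise_term_le: "rhs_bound * r\<^sup>2 \<le> (8 + 2000000 * N * \<delta> / l\<^sup>2) * r powr (5 / 4)"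
proof -
  have l_le: "l powr a \<le> 1 / l\<^sup>2" if "- 2 \<le> a" for a
    using powr_antimono_exponent[of l "- 2" a] l that by (simp add: powr_minus_divide)
  have r_le: "r powr a \<le> r powr (5 / 4)" if "5 / 4 \<le> a" for a
    using r scales that by (intro powr_antimono_exponent) auto
  have "T powr (- 11 / 20) * r\<^sup>2 = l powr (- 11 / 20) * r powr (29 / 20)"
    using r powr_add[of r "- 11 / 20" 2] by (simp add: powr_scales mult.assoc)
  also have "\<dots> \<le> 1 / l\<^sup>2 * r powr (5 / 4)" by (intro mult_mono l_le r_le) auto
  finally have first: "T powr (- 11 / 20) * r\<^sup>2 \<le> 1 / l\<^sup>2 * r powr (5 / 4)" .
  have "L powr (9 / 20) * T powr (- 21 / 20) * r\<^sup>2
      = (l powr (- 9 / 20) * l powr (- 21 / 20))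
        * (r powr (9 / 20) * r powr (- 21 / 20) * r powr 2)"
    using r by (simp add: powr_scales mult_ac)
  also have "\<dots> = l powr (- 3 / 2) * r powr (7 / 5)" by (simp flip: powr_add)
  also have "\<dots> \<le> 1 / l\<^sup>2 * r powr (5 / 4)" by (intro mult_mono l_le r_le) auto
  finally have "noise_growth * r\<^sup>2 \<le> 2 * (1 / l\<^sup>2 * r powr (5 / 4))"
    using first by (simp add: noise_growth_def distrib_right)
  then have "1000000 * N * \<delta> * (noise_growth * r\<^sup>2)
      \<le> 1000000 * N * \<delta> * (2 * (1 / l\<^sup>2 * r powr (5 / 4)))"
    using N noise_level_bounds by (intro mult_left_mono) auto
  moreover have "r\<^sup>2 \<le> r powr (5 / 4)" using r_le[of 2] r by simp
  ultimately show ?thesis by (simp add: rhs_bound_def distrib_right)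
qed

lemma taylor_error_le:
  "24000 * (N * (2 * L) powr (5 / 4) / L\<^sup>2 + rhs_bound + \<Lambda> * rhs_bound / T * L) * r\<^sup>2
    \<le> 24000 * (3 * N * l powr (3 / 4) + (1 + \<Lambda> / l\<^sup>2) * (8 + 2000000 * N * \<delta> / l\<^sup>2))
      * r powr (5 / 4)"
proof -
  have "\<Lambda> * rhs_bound / T * L * r\<^sup>2 = \<Lambda> / l\<^sup>2 * (rhs_bound * r\<^sup>2)"
    using l r by (simp add: L_def T_def power2_eq_square)
  then have "24000 * (N * (2 * L) powr (5 / 4) / L\<^sup>2 + rhs_bound + \<Lambda> * rhs_bound / T * L) * r\<^sup>2
      = 24000 * (N * (2 * L) powr (5 / 4) / L\<^sup>2 * r\<^sup>2 + (1 + \<Lambda> / l\<^sup>2) * (rhs_bound * r\<^sup>2))"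
    by (simp only: distrib_right distrib_left mult.assoc mult_1)
  also have "\<dots> \<le> 24000 * (3 * N * l powr (3 / 4) * r powr (5 / 4)
      + (1 + \<Lambda> / l\<^sup>2) * ((8 + 2000000 * N * \<delta> / l\<^sup>2) * r powr (5 / 4)))"
    using lip by (intro mult_left_mono add_mono rem_term_le noise_term_le)
      (auto simp: mollify_lipschitz_def)
  finally show ?thesis by (simp only: distrib_right mult.assoc)
qed

lemma rem_change_base_le:
  assumes y: "y \<in> past_cball 0 r"
  shows "conv_le (PsiT \<Phi> T) y (\<lambda>w. rem w y + 3 * (v 0 - v y) * (Y2 w - Y2 y))
    (N * T powr (5 / 4) + 456 * N * r powr (9 / 20) * (\<delta> * T powr (19 / 20)))"
proof (rule conv_leI[OF psi_Cc[OF scales(3)]])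
  have zero: "(0::pt) \<in> past_cball 0 (1 / 2)" and y_half: "y \<in> past_cball 0 (1 / 2)"
    using past_cball_mono[OF y] scales by auto
  show "\<bar>conv (PsiT \<Phi> T) (\<lambda>w. rem w y + 3 * (v 0 - v y) * (Y2 w - Y2 y)) y\<bar>
      \<le> N * T powr (5 / 4) + 456 * N * r powr (9 / 20) * (\<delta> * T powr (19 / 20))"
  proof (rule abs_conv_le[OF psi_mollifier[OF scales(3)]])
    fix w assume w: "w \<in> past_cball y T"
    have "\<bar>3 * (v 0 - v y)\<bar> \<le> 456 * N * r powr (9 / 20)"
      using v_hoelder[OF zero y] scales by (simp add: abs_mult abs_minus_commute)
    moreover have "\<bar>Y2 w - Y2 y\<bar> \<le> \<delta> * T powr (19 / 20)"
      using w scales by (intro Y2_increment_le) (auto simp: mem_past_cball)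
    ultimately have "\<bar>3 * (v 0 - v y) * (Y2 w - Y2 y)\<bar>
        \<le> 456 * N * r powr (9 / 20) * (\<delta> * T powr (19 / 20))"
      unfolding abs_mult[of "3 * (v 0 - v y)"] using N by (intro mult_mono) auto
    moreover have "\<bar>rem w y\<bar> \<le> N * T powr (5 / 4)"
      by (rule rem_le[OF y_half w]) (use scales in simp)
    ultimately show "\<bar>rem w y + 3 * (v 0 - v y) * (Y2 w - Y2 y)\<bar>
        \<le> N * T powr (5 / 4) + 456 * N * r powr (9 / 20) * (\<delta> * T powr (19 / 20))" by linarith
  qed (intro continuous_intros)
qed (intro continuous_intros)

lemma mrem_close:
  assumes y: "y \<in> past_cball 0 r"
  shows "\<bar>mrem y - rem y 0\<bar> \<le> (N * l powr (5 / 4) + 456 * N * \<delta>) * r powr (5 / 4)"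
proof -
  let ?g = "\<lambda>w. rem w y + 3 * (v 0 - v y) * (Y2 w - Y2 y)"
  let ?slope = "\<lambda>i w. (\<nu> i 0 - \<nu> i y) * snd (w - y) $ i"
  note psi = psi_mollifier[OF scales(3)] psi_Cc[OF scales(3)]
  have "conv_le (PsiT \<Phi> T) y (\<lambda>w. snd (w - y) $ i) 0" for i
    by (rule conv_leI[OF psi(2)], intro continuous_intros)
       (simp only: conv_coordinate[OF psi(1)] abs_zero order_refl)
  from conv_le_cmult[OF this order_refl]
  have slope: "conv_le (PsiT \<Phi> T) y (\<lambda>w. \<Sum>i\<in>UNIV. ?slope i w) (real CARD(3) * 0)"
    by (intro conv_le_sum) simp
  note difference = conv_leD[OF conv_le_diff[OF rem_change_base_le[OF y] slope]]
  have "(\<lambda>w. rem w 0 - rem y 0) = (\<lambda>w. ?g w - (\<Sum>i\<in>UNIV. ?slope i w))"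
    using expansion_rem_change_base[of v Y2 Y3 _ 0 y] by (auto simp: fun_eq_iff algebra_simps)
  with difference have "\<bar>conv (PsiT \<Phi> T) (\<lambda>w. rem w 0 - rem y 0) y\<bar>
      \<le> N * T powr (5 / 4) + 456 * N * r powr (9 / 20) * (\<delta> * T powr (19 / 20))" by simp
  also have "conv (PsiT \<Phi> T) (\<lambda>w. rem w 0 - rem y 0) y = mrem y - rem y 0"
    by (subst conv_diff[OF psi(2)]; (intro continuous_intros)?)
       (simp add: conv_const[OF psi(1)] mrem_def mollify_def)
  also have "N * T powr (5 / 4) + 456 * N * r powr (9 / 20) * (\<delta> * T powr (19 / 20))
      \<le> N * (l powr (5 / 4) * r powr (5 / 4)) + 456 * N * \<delta> * r powr (5 / 4)"
  proof (rule add_mono)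
    have "r powr (9 / 20) * T powr (19 / 20) \<le> r powr (9 / 20) * r powr (19 / 20)"
      using scales by (intro mult_left_mono powr_mono2) auto
    also have "\<dots> = r powr (7 / 5)" by (simp flip: powr_add)
    also have "\<dots> \<le> r powr (5 / 4)" using r scales by (intro powr_antimono_exponent) auto
    finally have "456 * N * \<delta> * (r powr (9 / 20) * T powr (19 / 20)) \<le> 456 * N * \<delta> * r powr (5 / 4)"
      using N noise_level_bounds by (intro mult_left_mono) auto
    then show "456 * N * r powr (9 / 20) * (\<delta> * T powr (19 / 20)) \<le> 456 * N * \<delta> * r powr (5 / 4)"
      by (simp add: mult_ac)
  qed (simp add: powr_scales)
  finally show ?thesis by (simp add: distrib_right mult.assoc)
qed

lemma affine_approximation:
  "\<exists>a c. \<forall>y\<in>past_cball 0 r. \<bar>rem y 0 - c - (\<Sum>i\<in>UNIV. a i * snd (y - 0) $ i)\<bar>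
    \<le> (24000 * (3 * N * l powr (3 / 4) + (1 + \<Lambda> / l\<^sup>2) * (8 + 2000000 * N * \<delta> / l\<^sup>2))
      + N * l powr (5 / 4) + 456 * N * \<delta>) * r powr (5 / 4)"
proof (intro exI ballI)
  fix y assume y: "y \<in> past_cball 0 r"
  have "rem y 0 - mrem 0 - (\<Sum>i\<in>UNIV. pdv (xdir i) mrem 0 * snd (y - 0) $ i)
      = taylor_rem mrem y 0 - (mrem y - rem y 0)" by (simp add: taylor_rem_def)
  then show "\<bar>rem y 0 - mrem 0 - (\<Sum>i\<in>UNIV. pdv (xdir i) mrem 0 * snd (y - 0) $ i)\<bar>
    \<le> (24000 * (3 * N * l powr (3 / 4) + (1 + \<Lambda> / l\<^sup>2) * (8 + 2000000 * N * \<delta> / l\<^sup>2))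
      + N * l powr (5 / 4) + 456 * N * \<delta>) * r powr (5 / 4)"
    using order_trans[OF taylor_rem_mrem_le[OF y] taylor_error_le] mrem_close[OF y]
    by (simp only: distrib_right[of _ _ "r powr (5 / 4)"] abs_le_iff) linarith
qed

end

section \<open>Campanato iteration\<close>

context
  fixes u :: "pt \<Rightarrow> real" and z\<^sub>0 :: pt and \<alpha> \<omega> \<rho> N :: real and a :: "real \<Rightarrow> 3 \<Rightarrow> real"
  assumes \<alpha>: "1 < \<alpha>"
    and apriori: "\<And>y. y \<in> past_cball z\<^sub>0 \<rho> \<Longrightarrow> \<bar>u y\<bar> \<le> N * pdist y z\<^sub>0 powr \<alpha>"
    and slopes: "\<And>r y. 0 < r \<Longrightarrow> r \<le> \<rho> \<Longrightarrow> y \<in> past_cball z\<^sub>0 r \<Longrightarrow>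
      \<bar>u y - (\<Sum>i\<in>UNIV. a r i * snd (y - z\<^sub>0) $ i)\<bar> \<le> 2 * \<omega> * r powr \<alpha>"
begin

lemma slope_on_axis:
  assumes "0 < r" "r \<le> \<rho>" "0 \<le> s" "s \<le> r"
  shows "\<bar>u (z\<^sub>0 + s *\<^sub>R xdir i) - a r i * s\<bar> \<le> 2 * \<omega> * r powr \<alpha>"
proof -
  have "z\<^sub>0 + s *\<^sub>R xdir i \<in> past_cball z\<^sub>0 r" using assms by (simp add: mem_past_cball)
  from slopes[OF assms(1,2) this] show ?thesis using sum_mult_xdir[of "a r" s i] by simp
qed

lemma slope_halving:
  assumes r: "0 < r" "r \<le> \<rho>" and \<omega>: "0 \<le> \<omega>"
  shows "\<bar>a r i - a (r / 2) i\<bar> \<le> 8 * \<omega> * r powr (\<alpha> - 1)"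
proof -
  have "2 * \<omega> * (r / 2) powr \<alpha> \<le> 2 * \<omega> * r powr \<alpha>"
    using r \<omega> \<alpha> by (intro mult_left_mono powr_mono2) auto
  moreover have "\<bar>u (z\<^sub>0 + (r / 2) *\<^sub>R xdir i) - a r i * (r / 2)\<bar> \<le> 2 * \<omega> * r powr \<alpha>"
    "\<bar>u (z\<^sub>0 + (r / 2) *\<^sub>R xdir i) - a (r / 2) i * (r / 2)\<bar> \<le> 2 * \<omega> * (r / 2) powr \<alpha>"
    by (rule slope_on_axis; use r in simp)+
  ultimately have "\<bar>a r i * (r / 2) - a (r / 2) i * (r / 2)\<bar> \<le> 4 * \<omega> * r powr \<alpha>" by linarith
  also have "r powr \<alpha> = r powr (\<alpha> - 1) * r" using r powr_add[of r "\<alpha> - 1" 1] by simp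
  also have "a r i * (r / 2) - a (r / 2) i * (r / 2) = (a r i - a (r / 2) i) * (r / 2)"
    by (simp add: algebra_simps)
  finally have "\<bar>a r i - a (r / 2) i\<bar> * (r / 2) \<le> 8 * \<omega> * r powr (\<alpha> - 1) * (r / 2)"
    using r by (simp add: abs_mult)
  then show ?thesis using r by (simp only: mult_le_cancel_right_pos half_gt_zero)
qed

lemma slope_geometric_bound:
  assumes "0 < r" "r \<le> \<rho>" and \<omega>: "0 \<le> \<omega>"
  shows "\<bar>a r i\<bar>
    \<le> (8 / (1 - 2 powr (1 - \<alpha>)) * \<omega> + (N + 2 * \<omega>) * (2 powr (1 - \<alpha>)) ^ m) * r powr (\<alpha> - 1)"
  using assms(1,2)
proof (induction m arbitrary: r)
  case (0 r)
  have "z\<^sub>0 + r *\<^sub>R xdir i \<in> past_cball z\<^sub>0 \<rho>" using 0 by (simp add: mem_past_cball)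
  then have "\<bar>u (z\<^sub>0 + r *\<^sub>R xdir i)\<bar> \<le> N * r powr \<alpha>" using apriori 0 by fastforce
  with slope_on_axis[OF 0, of r i] 0 have "\<bar>a r i * r\<bar> \<le> (N + 2 * \<omega>) * r powr \<alpha>"
    by (simp add: distrib_right)
  also have "r powr \<alpha> = r powr (\<alpha> - 1) * r" using 0 powr_add[of r "\<alpha> - 1" 1] by simp
  finally have "\<bar>a r i\<bar> \<le> (N + 2 * \<omega>) * r powr (\<alpha> - 1)" using 0 by (simp add: abs_mult)
  moreover have "0 \<le> 8 / (1 - 2 powr (1 - \<alpha>)) * \<omega> * r powr (\<alpha> - 1)"
    using \<omega> \<alpha> powr_less_one[of 2 "1 - \<alpha>"] by auto
  ultimately show ?case by (simp add: distrib_right)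
next
  case (Suc m r)
  define \<theta> where "\<theta> = 2 powr (1 - \<alpha>)"
  define \<kappa> where "\<kappa> = 8 / (1 - \<theta>)"
  have "\<theta> < 1" using \<alpha> by (simp add: \<theta>_def powr_less_one)
  then have "\<kappa> * (1 - \<theta>) = 8" using nonzero_eq_divide_eq[of "1 - \<theta>" \<kappa> 8] \<kappa>_def by simp
  moreover have "\<kappa> * (\<theta> * x) + \<kappa> * (1 - \<theta>) * x = \<kappa> * x" for x by (simp add: algebra_simps)
  ultimately have \<kappa>: "\<kappa> * (\<theta> * x) + 8 * x = \<kappa> * x" for x by simp
  have half: "(r / 2) powr (\<alpha> - 1) = \<theta> * r powr (\<alpha> - 1)"
    using Suc.prems powr_divide[of r 2 "\<alpha> - 1"] powr_minus_divide[of 2 "\<alpha> - 1"] by (simp add: \<theta>_def)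
  have "\<bar>a (r / 2) i\<bar> \<le> (\<kappa> * \<omega> + (N + 2 * \<omega>) * \<theta> ^ m) * (\<theta> * r powr (\<alpha> - 1))"
    using Suc.IH[of "r / 2"] Suc.prems by (simp add: half flip: \<kappa>_def \<theta>_def)
  then have "\<bar>a r i\<bar>
      \<le> (\<kappa> * \<omega> + (N + 2 * \<omega>) * \<theta> ^ m) * (\<theta> * r powr (\<alpha> - 1)) + 8 * \<omega> * r powr (\<alpha> - 1)"
    using slope_halving[OF Suc.prems \<omega>, of i] by linarith
  also have "\<dots> = (\<kappa> * \<omega> + (N + 2 * \<omega>) * \<theta> ^ Suc m) * r powr (\<alpha> - 1)"
    using \<kappa>[of "\<omega> * r powr (\<alpha> - 1)"] by (simp add: algebra_simps)
  finally show ?case by (simp add: \<kappa>_def \<theta>_def)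
qed

lemma slope_bound:
  assumes r: "0 < r" "r \<le> \<rho>" and \<omega>: "0 \<le> \<omega>"
  shows "\<bar>a r i\<bar> \<le> 8 / (1 - 2 powr (1 - \<alpha>)) * \<omega> * r powr (\<alpha> - 1)"
proof (rule LIMSEQ_le_const)
  have "(\<lambda>m. (2 powr (1 - \<alpha>)) ^ m :: real) \<longlonglongrightarrow> 0"
    using \<alpha> by (intro LIMSEQ_power_zero) (simp add: powr_less_one)
  from tendsto_mult[OF tendsto_add[OF tendsto_const tendsto_mult[OF tendsto_const this]]
    tendsto_const,
      of "8 / (1 - 2 powr (1 - \<alpha>)) * \<omega>" "N + 2 * \<omega>" "r powr (\<alpha> - 1)"]
  show "(\<lambda>m. (8 / (1 - 2 powr (1 - \<alpha>)) * \<omega> + (N + 2 * \<omega>) * (2 powr (1 - \<alpha>)) ^ m) * r powr (\<alpha> - 1))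
      \<longlonglongrightarrow> 8 / (1 - 2 powr (1 - \<alpha>)) * \<omega> * r powr (\<alpha> - 1)" by simp
qed (use slope_geometric_bound[OF r \<omega>] in blast)

end

lemma campanato:
  fixes u :: "pt \<Rightarrow> real"
  assumes \<alpha>: "1 < \<alpha>" and zero: "u z\<^sub>0 = 0"
    and apriori: "\<And>y. y \<in> past_cball z\<^sub>0 \<rho> \<Longrightarrow> \<bar>u y\<bar> \<le> N * pdist y z\<^sub>0 powr \<alpha>"
    and approx: "\<And>r. 0 < r \<Longrightarrow> r \<le> \<rho> \<Longrightarrow> \<exists>a c. \<forall>y\<in>past_cball z\<^sub>0 r.
      \<bar>u y - c - (\<Sum>i\<in>UNIV. a i * snd (y - z\<^sub>0) $ i)\<bar> \<le> \<omega> * r powr \<alpha>"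
    and y: "y \<in> past_cball z\<^sub>0 \<rho>"
  shows "\<bar>u y\<bar> \<le> (2 + 24 / (1 - 2 powr (1 - \<alpha>))) * \<omega> * pdist y z\<^sub>0 powr \<alpha>"
proof (cases "y = z\<^sub>0")
  case False
  have "\<exists>a. \<forall>y\<in>past_cball z\<^sub>0 r. \<bar>u y - (\<Sum>i\<in>UNIV. a i * snd (y - z\<^sub>0) $ i)\<bar> \<le> 2 * \<omega> * r powr \<alpha>"
    if r: "0 < r" "r \<le> \<rho>" for r
  proof -
    obtain a c where ac: "\<And>y. y \<in> past_cball z\<^sub>0 r \<Longrightarrow>
        \<bar>u y - c - (\<Sum>i\<in>UNIV. a i * snd (y - z\<^sub>0) $ i)\<bar> \<le> \<omega> * r powr \<alpha>"
      using approx[OF r] by blast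
    have "\<bar>c\<bar> \<le> \<omega> * r powr \<alpha>" using ac[of z\<^sub>0] r by (simp add: zero)
    then have "\<bar>u y - (\<Sum>i\<in>UNIV. a i * snd (y - z\<^sub>0) $ i)\<bar> \<le> 2 * \<omega> * r powr \<alpha>"
      if "y \<in> past_cball z\<^sub>0 r" for y using ac[OF that] by linarith
    then show ?thesis by blast
  qed
  then obtain a where a: "\<And>r y. 0 < r \<Longrightarrow> r \<le> \<rho> \<Longrightarrow> y \<in> past_cball z\<^sub>0 r \<Longrightarrow>
      \<bar>u y - (\<Sum>i\<in>UNIV. a r i * snd (y - z\<^sub>0) $ i)\<bar> \<le> 2 * \<omega> * r powr \<alpha>" by metis
  define d where "d = pdist y z\<^sub>0"
  have d: "0 < d" "d \<le> \<rho>" "y \<in> past_cball z\<^sub>0 d"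
    using False y by (auto simp: d_def pdist_pos mem_past_cball)
  have "0 \<le> 2 * \<omega> * d powr \<alpha>" using order_trans[OF abs_ge_zero a[of d z\<^sub>0]] d by simp
  then have \<omega>: "0 \<le> \<omega>" using d by (simp add: zero_le_mult_iff)
  define \<kappa> where "\<kappa> = 8 / (1 - 2 powr (1 - \<alpha>))"
  have "\<bar>\<Sum>i\<in>UNIV. a d i * snd (y - z\<^sub>0) $ i\<bar> \<le> real CARD(3) * (\<kappa> * \<omega> * d powr (\<alpha> - 1) * d)"
    unfolding \<kappa>_def d_def
    by (rule abs_sum_mult_le[OF slope_bound[OF \<alpha> apriori a d(1,2)[unfolded d_def] \<omega>]
      component_le_pdist])
  also have "\<dots> = 3 * \<kappa> * \<omega> * d powr \<alpha>" using d powr_add[of d "\<alpha> - 1" 1] by simp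
  finally have "\<bar>u y\<bar> \<le> 2 * \<omega> * d powr \<alpha> + 3 * \<kappa> * \<omega> * d powr \<alpha>" using a[OF d] by linarith
  then show ?thesis by (simp add: \<kappa>_def d_def algebra_simps)
qed (simp add: zero)

section \<open>Improvement of the remainder bound\<close>

definition scale_ratio :: real where "scale_ratio = 1 / 10 ^ 16"

definition slope_scale :: real where "slope_scale = (scale_ratio\<^sup>2 / 2000) ^ 4"

definition noise_const :: "real \<Rightarrow> real" where
  "noise_const \<Lambda> = 24000 * (1 + \<Lambda> / scale_ratio\<^sup>2) * (2000000 / scale_ratio\<^sup>2) + 456"

definition improvement_const :: "real \<Rightarrow> real" where
  "improvement_const \<Lambda>
    = 194 * (192000 * (1 + \<Lambda> / scale_ratio\<^sup>2)) + 64 / scale_ratio\<^sup>2 * (11 + 17 / slope_scale)"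

lemma scale_ratio_bounds: "0 < scale_ratio" "scale_ratio \<le> 1 / 4"
  by (simp_all add: scale_ratio_def)

lemma scale_ratio_powr: "scale_ratio powr (3 / 4) = 1 / 10 ^ 12"
proof -
  have "scale_ratio powr (3 / 4) = ((1 / 10000) powr 4) powr (3 / 4)"
    by (simp add: scale_ratio_def power_divide)
  also have "\<dots> = (1 / 10000) powr 3" unfolding powr_powr by simp
  also have "\<dots> = 1 / 10 ^ 12" by (simp add: power_divide)
  finally show ?thesis .
qed

lemma slope_scale_bounds: "0 < slope_scale" "slope_scale \<le> 1 / 4"
  by (simp_all add: slope_scale_def scale_ratio_def power_divide)

lemma slope_scale_powr: "slope_scale powr (1 / 4) = scale_ratio\<^sup>2 / 2000"
  using scale_ratio_bounds powr_powr[of "scale_ratio\<^sup>2 / 2000" 4 "1 / 4"]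
  by (simp add: slope_scale_def)

lemma improvement_const_ge_1: "0 \<le> \<Lambda> \<Longrightarrow> 1 \<le> improvement_const \<Lambda>"
proof -
  assume "0 \<le> \<Lambda>"
  then have "0 \<le> \<Lambda> / scale_ratio\<^sup>2" "0 \<le> 64 / scale_ratio\<^sup>2 * (11 + 17 / slope_scale)"
    using slope_scale_bounds by auto
  then show ?thesis by (simp add: improvement_const_def distrib_left)
qed

lemma campanato_const_le: "2 + 24 / (1 - 2 powr (1 - 5 / 4)) \<le> (194 :: real)"
proof -
  have "((2::real) powr (1 - 5 / 4)) ^ Suc 3 = 1 / 2"
    by (subst powr_power) (auto simp: powr_minus_divide)
  also have "\<dots> \<le> (7 / 8) ^ Suc 3" by (simp add: power_divide)
  finally have "(2::real) powr (1 - 5 / 4) \<le> 7 / 8" by (rule power_le_imp_le_base) simp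
  then have "24 / (1 - 2 powr (1 - 5 / 4)) \<le> 24 / (1 / 8 :: real)" by (intro divide_left_mono) auto
  then show ?thesis by simp
qed

context local_solution
begin

lemma rem_le_by_increment:
  assumes y: "y \<in> past_cball 0 (1 / 2)" and s: "0 < s" "s \<le> 1 / 4"
  shows "\<bar>rem y 0\<bar> \<le> 11 + 3 / 2 * N * s powr (1 / 4) + 17 / s"
proof -
  have zero: "(0::pt) \<in> past_cball 0 (1 / 2)" by simp
  have slope: "\<bar>\<nu> i 0\<bar> \<le> N * s powr (1 / 4) + 11 / s" for i
  proof -
    have "\<bar>\<nu> i 0\<bar> * s \<le> N * s powr (5 / 4) + 11" by (rule slope_at_scale_le[OF zero s])
    also have "\<dots> = (N * s powr (1 / 4) + 11 / s) * s"
      using s powr_add[of s "1 / 4" 1] by (simp add: distrib_right)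
    finally show ?thesis using s by simp
  qed
  have d: "pdist y 0 \<le> 1 / 2" using y by (simp add: mem_past_cball)
  have "\<bar>\<Sum>i\<in>UNIV. \<nu> i 0 * snd (y - 0) $ i\<bar>
      \<le> real CARD(3) * ((N * s powr (1 / 4) + 11 / s) * (1 / 2))"
    by (intro abs_sum_mult_le slope order_trans[OF component_le_pdist d])
  also have "\<dots> \<le> 3 / 2 * N * s powr (1 / 4) + 17 / s" using s by (simp add: field_simps)
  finally have "\<bar>\<Sum>i\<in>UNIV. \<nu> i 0 * snd (y - 0) $ i\<bar> \<le> 3 / 2 * N * s powr (1 / 4) + 17 / s" .
  moreover have "\<bar>inc y 0\<bar> \<le> 11" using d past_cball_mono[OF y] by (intro inc_le) auto
  ultimately show ?thesis unfolding expansion_rem_eq by linarith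
qed

lemma rem_le_far:
  assumes y: "y \<in> past_cball 0 (1 / 2)" and far: "scale_ratio / 8 \<le> pdist y 0"
  shows "\<bar>rem y 0\<bar>
    \<le> (N / 20 + 64 / scale_ratio\<^sup>2 * (11 + 17 / slope_scale)) * pdist y 0 powr (5 / 4)"
proof -
  define d where "d = pdist y 0"
  have d: "0 < d" "d \<le> 1" "scale_ratio / 8 \<le> d"
    using y far scale_ratio_bounds by (auto simp: d_def mem_past_cball)
  have "(scale_ratio / 8)\<^sup>2 \<le> d powr 2" using power_mono[OF d(3), of 2] scale_ratio_bounds d by simp
  also have "\<dots> \<le> d powr (5 / 4)" using d by (intro powr_antimono_exponent) auto
  finally have one_le: "1 \<le> 64 / scale_ratio\<^sup>2 * d powr (5 / 4)"
    using scale_ratio_bounds by (simp add: field_simps)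
  let ?b = "11 + 3 / 2 * N * (scale_ratio\<^sup>2 / 2000) + 17 / slope_scale"
  have "0 \<le> ?b" using N slope_scale_bounds by (intro add_nonneg_nonneg) auto
  have "\<bar>rem y 0\<bar> \<le> ?b"
    using rem_le_by_increment[OF y slope_scale_bounds] by (simp only: slope_scale_powr)
  also have "\<dots> \<le> ?b * (64 / scale_ratio\<^sup>2 * d powr (5 / 4))"
    using mult_left_mono[OF one_le \<open>0 \<le> ?b\<close>] by simp
  also have "\<dots>
      = (3 / 2 * (64 / 2000) * N + 64 / scale_ratio\<^sup>2 * (11 + 17 / slope_scale)) * d powr (5 / 4)"
    using scale_ratio_bounds by (simp add: field_simps)
  also have "\<dots> \<le> (N / 20 + 64 / scale_ratio\<^sup>2 * (11 + 17 / slope_scale)) * d powr (5 / 4)"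
    using N by (intro mult_right_mono add_right_mono) auto
  finally show ?thesis by (simp add: d_def)
qed

context
  fixes \<Lambda> :: real
  assumes lip: "mollify_lipschitz \<Phi> \<Lambda>" and small: "\<delta> * noise_const \<Lambda> \<le> 1 / 10 ^ 7"
begin

lemma affine_error_le:
  "24000 * (3 * N * scale_ratio powr (3 / 4)
      + (1 + \<Lambda> / scale_ratio\<^sup>2) * (8 + 2000000 * N * \<delta> / scale_ratio\<^sup>2))
    + N * scale_ratio powr (5 / 4) + 456 * N * \<delta> \<le> N / 10 ^ 6 + 192000 * (1 + \<Lambda> / scale_ratio\<^sup>2)"
proof -
  define G where "G = 1 + \<Lambda> / scale_ratio\<^sup>2"
  have "scale_ratio powr (5 / 4) \<le> scale_ratio powr (3 / 4)"
    using scale_ratio_bounds by (intro powr_antimono_exponent) auto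
  then have "N * scale_ratio powr (5 / 4) \<le> N * (1 / 10 ^ 12)"
    using N by (intro mult_left_mono) (auto simp: scale_ratio_powr)
  moreover have "N * (\<delta> * (24000 * G * (2000000 / scale_ratio\<^sup>2) + 456)) \<le> N * (1 / 10 ^ 7)"
    using small N unfolding noise_const_def G_def by (intro mult_left_mono) auto
  moreover have "24000 * (3 * N * (1 / 10 ^ 12) + G * (8 + 2000000 * N * \<delta> / scale_ratio\<^sup>2))
      + 456 * N * \<delta>
      = 72000 * N / 10 ^ 12 + 192000 * G + N * (\<delta> * (24000 * G * (2000000 / scale_ratio\<^sup>2) + 456))"
    by (simp add: algebra_simps)
  moreover have "72000 * N / 10 ^ 12 + N * (1 / 10 ^ 7) + N * (1 / 10 ^ 12) \<le> N / 10 ^ 6"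
    using N by simp
  ultimately show ?thesis unfolding scale_ratio_powr G_def[symmetric] by linarith
qed

lemma rem_le_near:
  assumes y: "y \<in> past_cball 0 (scale_ratio / 8)"
  shows "\<bar>rem y 0\<bar> \<le> 194 * (N / 10 ^ 6 + 192000 * (1 + \<Lambda> / scale_ratio\<^sup>2)) * pdist y 0 powr (5 / 4)"
proof -
  let ?\<omega> = "N / 10 ^ 6 + 192000 * (1 + \<Lambda> / scale_ratio\<^sup>2)"
  have "\<bar>rem y 0\<bar> \<le> (2 + 24 / (1 - 2 powr (1 - 5 / 4))) * ?\<omega> * pdist y 0 powr (5 / 4)"
  proof (rule campanato[OF _ expansion_rem_self _ _ y])
    fix w assume "w \<in> past_cball (0::pt) (scale_ratio / 8)"
    then have "w \<in> past_cball 0 (1 / 4)" by (rule past_cball_mono) (use scale_ratio_bounds in simp)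
    then show "\<bar>rem w 0\<bar> \<le> N * pdist w 0 powr (5 / 4)" by (intro expansion_rem_le) auto
  next
    fix r :: real assume r: "0 < r" "r \<le> scale_ratio / 8"
    interpret local_solution_at_scale \<Phi> \<epsilon> q v Y2 Y3 \<tau>1 \<tau>2 \<tau>3 C N \<Lambda> scale_ratio r
      by unfold_locales (use lip scale_ratio_bounds r in auto)
    have "\<bar>w\<bar> \<le> ?\<omega> * r powr (5 / 4)" if "\<bar>w\<bar> \<le> (24000 * (3 * N * scale_ratio powr (3 / 4)
        + (1 + \<Lambda> / scale_ratio\<^sup>2) * (8 + 2000000 * N * \<delta> / scale_ratio\<^sup>2))
        + N * scale_ratio powr (5 / 4) + 456 * N * \<delta>) * r powr (5 / 4)" for w
      using order_trans[OF that mult_right_mono[OF affine_error_le]] by simp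
    then show "\<exists>a c. \<forall>y\<in>past_cball 0 r.
        \<bar>rem y 0 - c - (\<Sum>i\<in>UNIV. a i * snd (y - 0) $ i)\<bar> \<le> ?\<omega> * r powr (5 / 4)"
      using affine_approximation by meson
  qed simp
  also have "\<dots> \<le> 194 * ?\<omega> * pdist y 0 powr (5 / 4)"
    using N lip by (intro mult_right_mono campanato_const_le) (auto simp: mollify_lipschitz_def)
  finally show ?thesis .
qed

lemma rem_improvement:
  assumes y: "y \<in> past_cball 0 (1 / 2)"
  shows "\<bar>rem y 0\<bar> \<le> (N / 20 + improvement_const \<Lambda>) * pdist y 0 powr (5 / 4)"
proof -
  define near where "near = 194 * (192000 * (1 + \<Lambda> / scale_ratio\<^sup>2))"
  define far where "far = 64 / scale_ratio\<^sup>2 * (11 + 17 / slope_scale)"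
  have nonneg: "0 \<le> near" "0 \<le> far"
    using lip slope_scale_bounds by (auto simp: near_def far_def mollify_lipschitz_def)
  consider "pdist y 0 \<le> scale_ratio / 8" | "scale_ratio / 8 \<le> pdist y 0" by linarith
  then have "\<exists>c \<le> N / 20 + (near + far). \<bar>rem y 0\<bar> \<le> c * pdist y 0 powr (5 / 4)"
  proof cases
    case 1
    then have "y \<in> past_cball 0 (scale_ratio / 8)" using y by (simp add: mem_past_cball)
    moreover have "194 * (N / 10 ^ 6 + 192000 * (1 + \<Lambda> / scale_ratio\<^sup>2)) \<le> N / 20 + (near + far)"
      using nonneg N unfolding near_def by (simp add: distrib_left)
    ultimately show ?thesis using rem_le_near by blast
  next
    case 2
    moreover have "N / 20 + far \<le> N / 20 + (near + far)" using nonneg by simp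
    ultimately show ?thesis using rem_le_far[OF y, folded far_def] by blast
  qed
  then obtain c where "c \<le> N / 20 + (near + far)" "\<bar>rem y 0\<bar> \<le> c * pdist y 0 powr (5 / 4)" by blast
  moreover from this(1) have "c * pdist y 0 powr (5 / 4)
      \<le> (N / 20 + (near + far)) * pdist y 0 powr (5 / 4)"
    by (rule mult_right_mono) simp
  ultimately show ?thesis by (simp add: improvement_const_def near_def far_def)
qed

end

end

section \<open>Absorbing the cubic term\<close>

lemma cubic_comparison:
  assumes h: "C12 h" and m: "0 < m" and M: "0 < M" and a: "0 \<le> a"
    and h_le: "\<And>z. z \<in> past_cball p m \<Longrightarrow> h z \<le> M"
    and heat_le: "\<And>z. z \<in> past_cball p m \<Longrightarrow> heat_op h z + h z ^ 3 \<le> e"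
    and gap: "e + 7 * (M / m\<^sup>2) < a ^ 3"
  shows "h p \<le> a"
proof -
  define b where "b = M / m\<^sup>2"
  have b: "0 < b" "b * m\<^sup>2 = M" using m M by (auto simp: b_def)
  define w where "w = (\<lambda>z. h z - b * paraboloid p z)"
  note derivs = has_C12_diff[OF C12_has_C12[OF h]
      has_C12_cmult[OF has_C12_paraboloid[of p], of b], folded w_def]
  note w = has_C12D(5)[OF derivs]
  have "past_cball p m \<noteq> {}" using m by (metis center_in_past_cball empty_iff less_imp_le)
  then obtain z where z: "z \<in> past_cball p m" and max: "\<And>y. y \<in> past_cball p m \<Longrightarrow> w y \<le> w z"
    using continuous_attains_sup[OF compact_past_cball _
        continuous_on_subset[OF C12D(1)[OF w] subset_UNIV]] by metis
  have "w z \<le> a"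
  proof (rule ccontr)
    assume pos: "\<not> w z \<le> a"
    have "b * paraboloid p z < b * m\<^sup>2" using pos a h_le[OF z] unfolding w_def b by linarith
    then have less: "paraboloid p z < m\<^sup>2" using b(1) by simp
    note at_max = derivatives_at_max_past_cball[OF w z max less]
    have "pdv (xdir i) (pdv (xdir i) h) z \<le> 2 * b" for i
      using at_max(2)[of i] unfolding has_C12D(3)[OF derivs] by simp
    then have "(\<Sum>i\<in>UNIV. pdv (xdir i) (pdv (xdir i) h) z) \<le> (\<Sum>i\<in>(UNIV :: 3 set). 2 * b)"
      by (rule sum_mono)
    moreover have "- b \<le> pdv tdir h z" using at_max(1) unfolding has_C12D(1)[OF derivs] by simp
    ultimately have "- 7 * b \<le> heat_op h z" unfolding heat_op_def by simp
    moreover have "a < h z"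
      using pos mult_nonneg_nonneg[OF less_imp_le[OF b(1)] paraboloid_nonneg[OF z]]
      unfolding w_def by linarith
    then have "a ^ 3 < h z ^ 3" using a by (intro power_strict_mono) auto
    ultimately show False using heat_le[OF z] gap unfolding b_def by linarith
  qed
  then show ?thesis using max[of p] m by (simp add: w_def)
qed

lemma abs_cubic_comparison:
  assumes h: "C12 h" and "0 < m" "0 < M" "0 \<le> a"
    and h_le: "\<And>z. z \<in> past_cball p m \<Longrightarrow> \<bar>h z\<bar> \<le> M"
    and heat_le: "\<And>z. z \<in> past_cball p m \<Longrightarrow> \<bar>heat_op h z + h z ^ 3\<bar> \<le> e"
    and gap: "e + 7 * (M / m\<^sup>2) < a ^ 3"
  shows "\<bar>h p\<bar> \<le> a"
proof -
  have "h p \<le> a"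
    by (rule cubic_comparison[OF assms(1-4) _ _ gap]) (use h_le heat_le in \<open>auto simp: abs_le_iff\<close>)
  moreover have "- 1 * h p \<le> a"
  proof (rule cubic_comparison[OF C12_cmult[OF h] assms(2-4) _ _ gap])
    fix z assume z: "z \<in> past_cball p m"
    show "- 1 * h z \<le> M" using h_le[OF z] by simp
    have "heat_op (\<lambda>z. - 1 * h z) z + (- 1 * h z) ^ 3 = - (heat_op h z + h z ^ 3)"
      unfolding heat_op_cmult[OF h] by simp
    then show "heat_op (\<lambda>z. - 1 * h z) z + (- 1 * h z) ^ 3 \<le> e" using heat_le[OF z] by linarith
  qed
  ultimately show ?thesis by (simp add: abs_le_iff)
qed

section \<open>Iteration of the remainder bound\<close>

context small_noise
begin

text \<open>The weight \<open>r powr (9 / 4)\<close> is the one under which the remainder is invariant when the ball of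
  radius \<open>r\<close> is rescaled to the unit ball; it also makes the quantity finite a priori.\<close>

definition remainder_bound :: "real \<Rightarrow> bool" where
  "remainder_bound N \<longleftrightarrow> (\<forall>x r y. 0 < r \<longrightarrow> r \<le> 1 \<longrightarrow> past_cball x r \<subseteq> D \<longrightarrow> y \<in> past_cball x (r / 2) \<longrightarrow>
    r powr (9 / 4) * \<bar>expansion_rem v Y2 Y3 y x\<bar> \<le> N * pdist y x powr (5 / 4))"

lemma remainder_boundD:
  assumes "remainder_bound N" "0 < r" "r \<le> 1" "past_cball x r \<subseteq> D" "y \<in> past_cball x (r / 2)"
  shows "r powr (9 / 4) * \<bar>expansion_rem v Y2 Y3 y x\<bar> \<le> N * pdist y x powr (5 / 4)"
  using assms unfolding remainder_bound_def by blast

lemma remainder_bound_mono: "remainder_bound N \<Longrightarrow> N \<le> N' \<Longrightarrow> remainder_bound N'"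
  unfolding remainder_bound_def by (meson mult_right_mono order_trans powr_ge_zero)

lemma remainder_bound_exists:
  assumes D: "D \<subseteq> past_cball p R"
  obtains N where "1 \<le> N" "remainder_bound N"
proof -
  obtain Mv M2 M3 where M: "0 \<le> Mv" "0 \<le> M2" "0 \<le> M3"
    and taylor: "\<And>x y d. past_cball x d \<subseteq> past_cball p R \<Longrightarrow> y \<in> past_cball x d \<Longrightarrow>
      \<bar>taylor_rem v y x\<bar> \<le> Mv * d\<^sup>2 \<and> \<bar>taylor_rem Y2 y x\<bar> \<le> M2 * d\<^sup>2
        \<and> \<bar>taylor_rem Y3 y x\<bar> \<le> M3 * d\<^sup>2"
    using taylor_rem_bounded[OF C12(1), of p R] taylor_rem_bounded[OF C12(2), of p R]
      taylor_rem_bounded[OF C12(3), of p R] by metis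
  define N where "N = Mv + M3 + 6 * M2"
  have "remainder_bound N"
    unfolding remainder_bound_def
  proof (intro allI impI)
    fix x y and r :: real
    assume r: "0 < r" "r \<le> 1" "past_cball x r \<subseteq> D" and y: "y \<in> past_cball x (r / 2)"
    define d where "d = pdist y x"
    have d: "0 \<le> d" "d \<le> r" "y \<in> past_cball x d" using y r by (auto simp: d_def mem_past_cball)
    have "past_cball x d \<subseteq> past_cball p R" using past_cball_mono[of _ x d r] d(2) r(3) D by blast
    note rem = taylor[OF this d(3)]
    have "\<bar>v x\<bar> \<le> 2" using r by (intro v_le) auto
    then have "\<bar>3 * v x * taylor_rem Y2 y x\<bar> \<le> 6 * (M2 * d\<^sup>2)"
      unfolding abs_mult[of "3 * v x"] using rem by (intro mult_mono) auto
    then have "\<bar>expansion_rem v Y2 Y3 y x\<bar> \<le> N * d\<^sup>2"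
      using rem unfolding expansion_rem_def N_def distrib_right by linarith
    moreover have "N * d\<^sup>2 \<le> N * d powr (5 / 4)"
      using powr_antimono_exponent[of d "5 / 4" 2] d r M
      by (intro mult_left_mono) (auto simp: N_def)
    moreover have "r powr (9 / 4) * \<bar>expansion_rem v Y2 Y3 y x\<bar> \<le> 1 * \<bar>expansion_rem v Y2 Y3 y x\<bar>"
      using r by (intro mult_right_mono powr_le1) auto
    ultimately show "r powr (9 / 4) * \<bar>expansion_rem v Y2 Y3 y x\<bar> \<le> N * pdist y x powr (5 / 4)"
      by (simp add: d_def)
  qed
  then show thesis using remainder_bound_mono[of N "max 1 N"] by (intro that[of "max 1 N"]) auto
qed

context
  fixes r :: real and x :: pt
  assumes r: "0 < r" "r \<le> 1" and ball: "past_cball x r \<subseteq> D"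
begin

lemma rescaled_rem:
  "expansion_rem (\<lambda>z. r * v (x + dil r z)) (\<lambda>z. Y2 (x + dil r z)) (\<lambda>z. r * Y3 (x + dil r z)) y z
    = r * expansion_rem v Y2 Y3 (x + dil r y) (x + dil r z)"
  by (rule expansion_rem_dil[OF C12])

lemma rescaled_rem_le:
  assumes N: "remainder_bound N" and z: "z \<in> past_cball 0 (1 / 2)" and y: "y \<in> past_cball z (1 / 4)"
  shows "r * \<bar>expansion_rem v Y2 Y3 (x + dil r y) (x + dil r z)\<bar>
      \<le> 2 powr (9 / 4) * N * pdist y z powr (5 / 4)"
proof -
  let ?y = "x + dil r y" and ?z = "x + dil r z"
  have z': "?z \<in> past_cball x (r / 2)"
    using blow_up_in_past_cball[OF r(1), of x z "1 / 2"] z by simp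
  have y': "?y \<in> past_cball ?z (r / 2 / 2)"
    using dil_in_past_cball[OF r(1), of y z "1 / 4"] y by (simp add: past_cball_translate)
  have "past_cball ?z (r / 2) \<subseteq> D" using past_cball_trans[OF _ z', of _ "r / 2" r] ball by auto
  from remainder_boundD[OF N _ _ this y'] r
  have "(r / 2) powr (9 / 4) * \<bar>expansion_rem v Y2 Y3 ?y ?z\<bar>
      \<le> N * (r powr (5 / 4) * pdist y z powr (5 / 4))"
    by (simp add: pdist_dil powr_mult)
  moreover have "(r / 2) powr (9 / 4) = r powr (5 / 4) * r / 2 powr (9 / 4)"
    using r powr_add[of r "5 / 4" 1] by (simp add: powr_divide)
  ultimately have "r powr (5 / 4) * (r * \<bar>expansion_rem v Y2 Y3 ?y ?z\<bar>)
      \<le> r powr (5 / 4) * (2 powr (9 / 4) * N * pdist y z powr (5 / 4))"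
    by (simp add: field_simps)
  then show ?thesis using r by (simp add: mult_le_cancel_left_pos)
qed

lemma rescaled_local_solution:
  assumes N: "remainder_bound N" "1 \<le> N"
  shows "local_solution \<Phi> \<epsilon> q (\<lambda>z. r * v (x + dil r z)) (\<lambda>z. Y2 (x + dil r z))
    (\<lambda>z. r * Y3 (x + dil r z)) (\<lambda>z. r * \<tau>1 (x + dil r z)) (\<lambda>z. r\<^sup>2 * \<tau>2 (x + dil r z))
    (\<lambda>z. r ^ 3 * \<tau>3 (x + dil r z)) (r\<^sup>2 * C) (5 * N)"
proof (intro local_solution.intro small_noise.intro small_noise_axioms.intro
    local_solution_axioms.intro)
  show "phi4_solution \<Phi> \<epsilon> (past_cball 0 1) 2 q (\<lambda>z. r * v (x + dil r z)) (\<lambda>z. Y2 (x + dil r z))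
    (\<lambda>z. r * Y3 (x + dil r z)) (\<lambda>z. r * \<tau>1 (x + dil r z)) (\<lambda>z. r\<^sup>2 * \<tau>2 (x + dil r z))
    (\<lambda>z. r ^ 3 * \<tau>3 (x + dil r z)) (r\<^sup>2 * C)"
  proof (rule rescale[OF r])
    show "x + dil r z \<in> D" if "z \<in> past_cball 0 1" for z
      using blow_up_in_past_cball[OF r(1), of x z 1] that ball by auto
  qed (use r q in \<open>auto intro: mult_left_le_one_le\<close>)
  fix z y :: pt assume z: "z \<in> past_cball 0 (1 / 2)" and y: "y \<in> past_cball z (1 / 4)"
  have "((2::real) powr (9 / 4)) ^ Suc 3 \<le> 5 ^ Suc 3" by (subst powr_power) auto
  then have "(2::real) powr (9 / 4) \<le> 5" by (rule power_le_imp_le_base) simp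
  then have "2 powr (9 / 4) * N * pdist y z powr (5 / 4) \<le> 5 * N * pdist y z powr (5 / 4)"
    using N by (intro mult_right_mono) auto
  with rescaled_rem_le[OF N(1) z y]
  show "\<bar>expansion_rem (\<lambda>z. r * v (x + dil r z)) (\<lambda>z. Y2 (x + dil r z))
        (\<lambda>z. r * Y3 (x + dil r z)) y z\<bar>
      \<le> 5 * N * pdist y z powr (5 / 4)"
    using r by (simp add: rescaled_rem abs_mult)
qed (use eps q N in auto)

end

context
  fixes \<Lambda> :: real
  assumes lip: "mollify_lipschitz \<Phi> \<Lambda>" and small: "\<delta> * noise_const \<Lambda> \<le> 1 / 10 ^ 7"
begin

lemma remainder_bound_improvement:
  assumes N: "remainder_bound N" "1 \<le> N"
  shows "remainder_bound (N / 4 + improvement_const \<Lambda>)"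
  unfolding remainder_bound_def
proof (intro allI impI)
  let ?K = "N / 4 + improvement_const \<Lambda>"
  fix x y and r :: real
  assume r: "0 < r" "r \<le> 1" "past_cball x r \<subseteq> D" and y: "y \<in> past_cball x (r / 2)"
  interpret p: local_solution \<Phi> \<epsilon> q "\<lambda>z. r * v (x + dil r z)" "\<lambda>z. Y2 (x + dil r z)"
    "\<lambda>z. r * Y3 (x + dil r z)" "\<lambda>z. r * \<tau>1 (x + dil r z)" "\<lambda>z. r\<^sup>2 * \<tau>2 (x + dil r z)"
    "\<lambda>z. r ^ 3 * \<tau>3 (x + dil r z)" "r\<^sup>2 * C" "5 * N"
    by (rule rescaled_local_solution[OF r N])
  define y' where "y' = dil (1 / r) (y - x)"
  have y_eq: "x + dil r y' = y" using r by (simp add: y'_def)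
  then have "y' \<in> past_cball 0 (1 / 2)"
    using blow_up_in_past_cball[OF r(1), of x y' "1 / 2"] y by simp
  from p.rem_improvement[OF lip small this]
  have "r * \<bar>expansion_rem v Y2 Y3 y x\<bar> \<le> ?K * pdist y' 0 powr (5 / 4)"
    using r by (simp add: rescaled_rem[OF r] y_eq abs_mult)
  then have "r powr (5 / 4) * (r * \<bar>expansion_rem v Y2 Y3 y x\<bar>)
      \<le> r powr (5 / 4) * (?K * pdist y' 0 powr (5 / 4))"
    by (intro mult_left_mono) auto
  also have "\<dots> = ?K * (r * pdist y' 0) powr (5 / 4)" using r by (simp add: powr_mult)
  also have "r * pdist y' 0 = pdist y x"
    using pdist_dil[of r y' 0] r pdist_translate[of x "dil r y'" 0] by (simp add: y_eq)
  also have "r powr (5 / 4) * (r * \<bar>expansion_rem v Y2 Y3 y x\<bar>)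
      = r powr (9 / 4) * \<bar>expansion_rem v Y2 Y3 y x\<bar>"
    using r powr_add[of r "5 / 4" 1] by simp
  finally show "r powr (9 / 4) * \<bar>expansion_rem v Y2 Y3 y x\<bar> \<le> ?K * pdist y x powr (5 / 4)" .
qed

lemma remainder_bound_const:
  assumes D: "D \<subseteq> past_cball p R"
  shows "remainder_bound (2 * improvement_const \<Lambda> + 1)"
proof -
  let ?K = "improvement_const \<Lambda>"
  have K: "1 \<le> ?K" using lip by (intro improvement_const_ge_1) (simp add: mollify_lipschitz_def)
  obtain N where N: "1 \<le> N" "remainder_bound N" by (rule remainder_bound_exists[OF D])
  have "remainder_bound (2 * ?K + N * (1 / 4) ^ j)" for j
  proof (induction j)
    case 0
    show ?case by (rule remainder_bound_mono[OF N(2)]) (use K in simp)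
  next
    case (Suc j)
    have "0 \<le> N * (1 / 4) ^ j" using N by simp
    then have "1 \<le> 2 * ?K + N * (1 / 4) ^ j" using K by linarith
    from remainder_bound_improvement[OF Suc this] show ?case
      by (rule remainder_bound_mono) (use K in \<open>simp add: field_simps\<close>)
  qed
  moreover obtain j
    where "(1 / 4) ^ j < 1 / N" using real_arch_pow_inv[of "1 / N" "1 / 4"] N by auto
  then have "N * (1 / 4) ^ j \<le> 1" using N by (simp add: field_simps)
  ultimately show ?thesis using remainder_bound_mono by (metis add_left_mono)
qed

end

end

section \<open>Boundedness at unit scale\<close>

lemma abs_power3_diff_le:
  fixes a b :: real
  assumes "\<bar>a\<bar> \<le> M" "\<bar>b\<bar> \<le> M" shows "\<bar>a ^ 3 - b ^ 3\<bar> \<le> 3 * M\<^sup>2 * \<bar>a - b\<bar>"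
proof -
  have "\<bar>a * a\<bar> \<le> M\<^sup>2" "\<bar>a * b\<bar> \<le> M\<^sup>2" "\<bar>b * b\<bar> \<le> M\<^sup>2"
    unfolding abs_mult power2_eq_square by (intro mult_mono; use assms in linarith)+
  then have "\<bar>a * a + a * b + b * b\<bar> \<le> 3 * M\<^sup>2" by linarith
  then have "\<bar>a * a + a * b + b * b\<bar> * \<bar>a - b\<bar> \<le> 3 * M\<^sup>2 * \<bar>a - b\<bar>" by (rule mult_right_mono) simp
  moreover have "a ^ 3 - b ^ 3 = (a * a + a * b + b * b) * (a - b)"
    by (simp add: power3_eq_cube algebra_simps)
  ultimately show ?thesis by (simp add: abs_mult)
qed

context small_noise
begin

context
  fixes N :: real and z :: pt
  assumes N: "remainder_bound N" "1 \<le> N" and ball: "past_cball z 1 \<subseteq> D"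
begin

lemma translated_local_solution:
  "local_solution \<Phi> \<epsilon> q (\<lambda>y. v (z + y)) (\<lambda>y. Y2 (z + y)) (\<lambda>y. Y3 (z + y))
    (\<lambda>y. \<tau>1 (z + y)) (\<lambda>y. \<tau>2 (z + y)) (\<lambda>y. \<tau>3 (z + y)) C (5 * N)"
  using rescaled_local_solution[OF _ _ ball N] by simp

lemma v_hoelder_in_domain:
  assumes y: "y \<in> past_cball z S" and S: "S \<le> 1 / 4"
  shows "\<bar>v y - v z\<bar> \<le> 760 * N * S powr (9 / 20)"
proof -
  interpret p: local_solution \<Phi> \<epsilon> q "\<lambda>y. v (z + y)" "\<lambda>y. Y2 (z + y)" "\<lambda>y. Y3 (z + y)"
    "\<lambda>y. \<tau>1 (z + y)" "\<lambda>y. \<tau>2 (z + y)" "\<lambda>y. \<tau>3 (z + y)" C "5 * N"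
    by (rule translated_local_solution)
  have "y - z \<in> past_cball 0 S" using y by (simp add: diff_in_past_cball_0)
  from p.v_hoelder[OF _ this S] show ?thesis by simp
qed

lemma mollified_rhs_in_domain:
  assumes T: "0 < T" "T \<le> 1 / 8"
  shows "conv_le (PsiT \<Phi> T) z (\<lambda>y. heat_op v y + heat_op Y3 y + 3 * v z * heat_op Y2 y + v y ^ 3)
    (500000 * N * \<delta> * T powr (- 11 / 20))"
proof (rule conv_leI[OF psi_Cc[OF T(1)]])
  interpret p: local_solution \<Phi> \<epsilon> q "\<lambda>y. v (z + y)" "\<lambda>y. Y2 (z + y)" "\<lambda>y. Y3 (z + y)"
    "\<lambda>y. \<tau>1 (z + y)" "\<lambda>y. \<tau>2 (z + y)" "\<lambda>y. \<tau>3 (z + y)" C "5 * N"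
    by (rule translated_local_solution)
  let ?F = "\<lambda>y. heat_op v y + heat_op Y3 y + 3 * v z * heat_op Y2 y + v y ^ 3"
  show F: "continuous_on UNIV ?F" by (intro continuous_intros)
  have heat_translate: "heat_op (\<lambda>y. f (z + y)) y = heat_op f (z + y)" if "C12 f" for f y
    using heat_op_dil[OF that, of z 1 y] by simp
  have "conv (PsiT \<Phi> T) (\<lambda>y. ?F (z + y)) 0 = conv (PsiT \<Phi> T) ?F z"
    using mollify_dil[OF kernel _ T(1) F, of 1 z 0] by (simp add: mollify_def)
  with conv_leD[OF p.mollified_rhs_le[OF _ T, of 0]]
  show "\<bar>conv (PsiT \<Phi> T) ?F z\<bar> \<le> 500000 * N * \<delta> * T powr (- 11 / 20)"
    by (simp add: heat_translate C12)
qed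

context
  fixes T :: real
  assumes T: "0 < T" "T \<le> 1 / 8" and T_small: "18240 * N * T powr (9 / 20) \<le> 1 / 32"
begin

lemma in_domain: "y \<in> past_cball z T \<Longrightarrow> y \<in> D" "z \<in> D" "z \<in> past_cball z T"
  using T ball past_cball_mono[of y z T 1] by auto

lemma v_oscillation_le: "y \<in> past_cball z T \<Longrightarrow> \<bar>v y - v z\<bar> \<le> 1 / 768"
  using v_hoelder_in_domain[of y T] T T_small by simp

lemma v_mollify_close: "\<bar>mollify \<Phi> T v z - v z\<bar> \<le> 1 / 768"
  unfolding mollify_def
  by (rule abs_conv_diff_le[OF psi_mollifier[OF T(1)] _ v_oscillation_le]) (intro continuous_intros)

lemma v_mollify_le: "\<bar>mollify \<Phi> T v z\<bar> \<le> 2"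
  unfolding mollify_def
  by (rule abs_conv_le[OF psi_mollifier[OF T(1)] _ v_le[OF in_domain(1)]]) (intro continuous_intros)

lemma v_cube_close:
  assumes "\<bar>a\<bar> \<le> 2" "\<bar>a - v z\<bar> \<le> 1 / 768" shows "\<bar>a ^ 3 - v z ^ 3\<bar> \<le> 1 / 64"
  using abs_power3_diff_le[OF assms(1) v_le[OF in_domain(2)]] assms(2) by simp

lemma mollified_heat_op_v_le:
  assumes T_noise: "1000000 * N * \<delta> * T powr (- 31 / 20) \<le> 1 / 32"
  shows "\<bar>heat_op (mollify \<Phi> T v) z + mollify \<Phi> T v z ^ 3\<bar> \<le> 1 / 16"
proof -
  define P where "P = N * \<delta> * T powr (- 31 / 20)"
  have T_less_1: "T < 1" using T by simp
  have \<delta>N: "\<delta> \<le> N * \<delta>" using mult_right_mono[OF N(2), of \<delta>] noise_level_bounds by simp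
  have to_P: "\<delta> * T powr a \<le> P" if "- 31 / 20 \<le> a" for a
    unfolding P_def using T \<delta>N noise_level_bounds that
    by (intro mult_mono powr_antimono_exponent) auto
  note psi = psi_mollifier[OF T(1)]
  have "conv_le (PsiT \<Phi> T) z (heat_op Y3) P"
    by (rule conv_le_cong[OF psi conv_le_mono[OF \<tau>3_le[OF in_domain(2) T(1) T_less_1] to_P]])
       (auto intro!: continuous_on_heat_op C12 heat_Y3 in_domain)
  moreover have "conv_le (PsiT \<Phi> T) z (heat_op Y2) P"
    by (rule conv_le_cong[OF psi conv_le_mono[OF \<tau>2_le[OF in_domain(2) T(1) T_less_1] to_P]])
       (auto intro!: continuous_on_heat_op C12 heat_Y2 in_domain)
  then have "conv_le (PsiT \<Phi> T) z (\<lambda>y. 3 * v z * heat_op Y2 y) (6 * P)"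
    by (rule conv_le_cmult) (use v_le[OF in_domain(2)] in \<open>simp add: abs_mult\<close>)
  moreover have "conv_le (PsiT \<Phi> T) z
      (\<lambda>y. heat_op v y + heat_op Y3 y + 3 * v z * heat_op Y2 y + v y ^ 3) (500000 * P)"
  proof (rule conv_le_mono[OF mollified_rhs_in_domain[OF T]])
    show "500000 * N * \<delta> * T powr (- 11 / 20) \<le> 500000 * P"
      unfolding P_def mult.assoc using T N noise_level_bounds
      by (intro mult_left_mono powr_antimono_exponent) auto
  qed
  moreover have "conv_le (PsiT \<Phi> T) z (\<lambda>y. v y ^ 3 - v z ^ 3) (1 / 64)"
    by (intro conv_leI psi_Cc T abs_conv_le[OF psi] v_cube_close v_le v_oscillation_le in_domain
        continuous_intros)
  ultimately have "conv_le (PsiT \<Phi> T) z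
      (\<lambda>y. heat_op v y + heat_op Y3 y + 3 * v z * heat_op Y2 y + v y ^ 3 - heat_op Y3 y
        - 3 * v z * heat_op Y2 y - (v y ^ 3 - v z ^ 3)) (500000 * P + P + 6 * P + 1 / 64)"
    by (intro conv_le_diff)
  then have "\<bar>conv (PsiT \<Phi> T) (\<lambda>y. heat_op v y + v z ^ 3) z\<bar> \<le> 500000 * P + P + 6 * P + 1 / 64"
    by (auto dest: conv_leD)
  moreover have "conv (PsiT \<Phi> T) (\<lambda>y. heat_op v y + v z ^ 3) z
      = heat_op (mollify \<Phi> T v) z + v z ^ 3"
    unfolding mollify_eq_conv[OF kernel] heat_op_conv[OF psi_Cc[OF T(1)] C12(1)]
    by (simp add: conv_add[OF psi_Cc[OF T(1)] continuous_on_heat_op[OF C12(1)] continuous_on_const]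
        conv_const[OF psi])
  moreover have "\<bar>mollify \<Phi> T v z ^ 3 - v z ^ 3\<bar> \<le> 1 / 64"
    by (intro v_cube_close v_mollify_le v_mollify_close)
  moreover have "1000000 * P \<le> 1 / 32" "0 \<le> P"
    using T_noise N noise_level_bounds by (auto simp: P_def)
  ultimately show ?thesis by linarith
qed

end

end

lemma v_center_less_1:
  assumes D: "D = past_cball p 17" and N: "remainder_bound N" "1 \<le> N"
    and T: "0 < T" "T \<le> 1 / 8" "18240 * N * T powr (9 / 20) \<le> 1 / 32"
      "1000000 * N * \<delta> * T powr (- 31 / 20) \<le> 1 / 32"
  shows "\<bar>v p\<bar> < 1"
proof -
  have ball: "past_cball z 1 \<subseteq> D" if "z \<in> past_cball p 16" for z
    unfolding D using past_cball_trans[OF _ that, of _ 1 17] by auto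
  have "\<bar>mollify \<Phi> T v p\<bar> \<le> 1 / 2"
  proof (rule abs_cubic_comparison)
    show "C12 (mollify \<Phi> T v)" unfolding mollify_eq_conv[OF kernel] by (intro C12_conv psi_Cc T C12)
    show "\<bar>mollify \<Phi> T v z\<bar> \<le> 2" if "z \<in> past_cball p 16" for z
      by (rule v_mollify_le[OF N ball[OF that] T(1-3)])
    show "\<bar>heat_op (mollify \<Phi> T v) z + mollify \<Phi> T v z ^ 3\<bar> \<le> 1 / 16" if "z \<in> past_cball p 16" for z
      by (rule mollified_heat_op_v_le[OF N ball[OF that] T])
  qed (simp_all add: power_divide)
  moreover have "\<bar>mollify \<Phi> T v p - v p\<bar> \<le> 1 / 768" by (rule v_mollify_close[OF N ball T(1-3)]) simp
  ultimately show ?thesis by linarith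
qed

end

definition noise_threshold :: "(pt \<Rightarrow> real) \<Rightarrow> real \<Rightarrow> real \<Rightarrow> bool" where
  "noise_threshold \<Phi> \<epsilon> q\<^sub>0 \<longleftrightarrow> 0 < q\<^sub>0 \<and> (\<forall>q p v Y2 Y3 \<tau>1 \<tau>2 \<tau>3 C. 0 < q \<longrightarrow> q \<le> q\<^sub>0 \<longrightarrow>
    phi4_solution \<Phi> \<epsilon> (past_cball p 17) 2 q v Y2 Y3 \<tau>1 \<tau>2 \<tau>3 C \<longrightarrow> \<bar>v p\<bar> < 1)"

lemma noise_threshold_exists:
  assumes \<Phi>: "kernel \<Phi>" and \<epsilon>: "0 < \<epsilon>" "\<epsilon> < 1 / 100"
  shows "\<exists>q\<^sub>0. noise_threshold \<Phi> \<epsilon> q\<^sub>0"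
proof -
  obtain \<Lambda> where \<Lambda>: "mollify_lipschitz \<Phi> \<Lambda>" using mollify_lipschitz_exists[OF \<Phi>] by blast
  then have "0 \<le> \<Lambda>" by (simp add: mollify_lipschitz_def)
  define N where "N = 2 * improvement_const \<Lambda> + 1"
  have N: "1 \<le> N" using improvement_const_ge_1[OF \<open>0 \<le> \<Lambda>\<close>] by (simp add: N_def)
  define T where "T = (1 / (1000000 * N)) powr (20 / 9)"
  have T: "0 < T" "18240 * N * T powr (9 / 20) \<le> 1 / 32" using N by (auto simp: T_def powr_powr)
  have "T \<le> (1 / 8) powr (20 / 9)"
    unfolding T_def using N by (intro powr_mono2) (auto simp: field_simps)
  also have "\<dots> \<le> (1 / 8) powr 1" by (intro powr_antimono_exponent) auto
  finally have T_le: "T \<le> 1 / 8" by simp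
  define \<delta>\<^sub>1 where "\<delta>\<^sub>1 = 1 / (10 ^ 7 * noise_const \<Lambda>)"
  define \<delta>\<^sub>2 where "\<delta>\<^sub>2 = 1 / (32 * (1000000 * N * T powr (- 31 / 20)))"
  have const_pos: "0 < noise_const \<Lambda>" "0 < 1000000 * N * T powr (- 31 / 20)"
    using N T \<open>0 \<le> \<Lambda>\<close> by (auto simp: noise_const_def intro!: add_nonneg_pos)
  define q\<^sub>0 where "q\<^sub>0 = min 1 (min \<delta>\<^sub>1 \<delta>\<^sub>2) powr (5 / 2)"
  have \<delta>: "0 < min 1 (min \<delta>\<^sub>1 \<delta>\<^sub>2)" using const_pos by (simp add: \<delta>\<^sub>1_def \<delta>\<^sub>2_def)
  then have "q\<^sub>0 \<le> 1" by (auto simp: q\<^sub>0_def intro: powr_le1)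
  have "\<bar>v p\<bar> < 1" if q_le: "0 < q" "q \<le> q\<^sub>0"
    and sol: "phi4_solution \<Phi> \<epsilon> (past_cball p 17) 2 q v Y2 Y3 \<tau>1 \<tau>2 \<tau>3 C"
    for q p v Y2 Y3 \<tau>1 \<tau>2 \<tau>3 C
  proof -
    interpret small_noise \<Phi> \<epsilon> "past_cball p 17" q v Y2 Y3 \<tau>1 \<tau>2 \<tau>3 C
      by (intro small_noise.intro small_noise_axioms.intro sol) (use \<epsilon> q_le \<open>q\<^sub>0 \<le> 1\<close> in auto)
    have "noise_level q \<le> q\<^sub>0 powr (2 / 5)"
      unfolding noise_level_def using q_le by (intro powr_mono2) auto
    also have "\<dots> = min 1 (min \<delta>\<^sub>1 \<delta>\<^sub>2)" using \<delta> by (simp add: q\<^sub>0_def powr_powr)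
    finally have "noise_level q \<le> \<delta>\<^sub>1" "noise_level q \<le> \<delta>\<^sub>2" by auto
    then have small: "noise_level q * noise_const \<Lambda> \<le> 1 / 10 ^ 7"
      "1000000 * N * noise_level q * T powr (- 31 / 20) \<le> 1 / 32"
      using const_pos by (auto simp: \<delta>\<^sub>1_def \<delta>\<^sub>2_def field_simps)
    show "\<bar>v p\<bar> < 1"
      by (rule v_center_less_1[OF refl remainder_bound_const[OF \<Lambda> small(1) order_refl, folded N_def]
            N T(1) T_le T(2) small(2)])
  qed
  moreover have "0 < q\<^sub>0" using \<delta> by (auto simp: q\<^sub>0_def)
  ultimately show ?thesis unfolding noise_threshold_def by blast
qed

section \<open>From the norms to the noise bounds\<close>

lemma epow_le_imp:
  assumes "epow Q (1 / \<beta>) \<le> ereal x" "0 < \<beta>" "0 < x"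
  shows "Q \<le> ereal (x powr \<beta>)"
proof (cases Q)
  case (real c)
  show ?thesis
  proof (cases "c \<le> 0")
    case True
    then show ?thesis using real by (simp add: order_trans[OF True])
  next
    case False
    then have "(c powr (1 / \<beta>)) powr \<beta> \<le> x powr \<beta>"
      using assms real by (intro powr_mono2) (auto simp: epow_def)
    then show ?thesis using False assms real by (simp add: powr_powr)
  qed
qed (use assms in \<open>auto simp: epow_def\<close>)

lemma germ_le_if_SUP_le:
  assumes "(SUP z\<in>D. SUP T\<in>{0<..<1}. ereal (T powr a * \<bar>mollify \<Phi> T (F z) z\<bar>)) \<le> ereal A"
  shows "germ_le \<Phi> D A (- a) F"
proof (rule germ_leI)
  fix z T assume "z \<in> D" "0 < (T::real)" "T < 1"
  then have "T powr a * \<bar>mollify \<Phi> T (F z) z\<bar> \<le> A" "0 < T" using assms by (auto simp: SUP_le_iff)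
  then show "\<bar>mollify \<Phi> T (F z) z\<bar> \<le> A * T powr (- a)" by (simp add: powr_minus field_simps)
qed

lemma negnorm_imp_germ_le:
  assumes "negnorm \<Phi> \<alpha> f \<le> ereal A" shows "germ_le \<Phi> Pset A \<alpha> (\<lambda>_. f)"
  using assms germ_le_if_SUP_le[where a="- \<alpha>" and F="\<lambda>_. f"] by (auto simp: negnorm_def SUP_le_iff)

lemma wsup_imp_germ_le:
  assumes "wsup \<Phi> a F \<le> ereal A" shows "germ_le \<Phi> Pset A (- a) F"
  by (rule germ_le_if_SUP_le) (use assms in \<open>simp add: wsup_def mollify_def conv_def mult.commute\<close>)

lemma wsupX_imp_germ_le:
  assumes \<Phi>: "kernel \<Phi>" and g: "continuous_on UNIV g" and norm_le: "wsupX \<Phi> a g \<le> ereal A"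
  shows "germ_le \<Phi> Pset A (- a) (\<lambda>z y. snd (y - z) $ i * g y)"
proof (rule germ_le_if_SUP_le, intro SUP_least)
  fix z T assume z: "z \<in> Pset" and "T \<in> {0<..<1::real}"
  then have T: "0 < T" "T < 1" by auto
  let ?F = "\<lambda>y. (g y * PsiT \<Phi> T (z - y)) *\<^sub>R snd (y - z)"
  have component: "?F y $ j = PsiT \<Phi> T (z - y) * (snd (y - z) $ j * g y)" for y j by simp
  have "(\<lambda>y. ?F y $ j) integrable_on UNIV" for j
  proof -
    have "continuous_on UNIV (\<lambda>y. snd (y - z) $ j * g y)" by (intro continuous_intros g)
    from conv_integrable[OF PsiT_Cc[OF \<Phi> T(1)] this] show ?thesis
      unfolding component using has_integral_integral_lborel integrable_on_def by blast
  qed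
  then have "?F integrable_on UNIV"
    unfolding integrable_componentwise_iff[of ?F] Basis_vec_def
    by (auto simp: inner_axis mult.assoc)
  then have "mollify \<Phi> T (\<lambda>y. snd (y - z) $ i * g y) z = integral UNIV ?F $ i"
    by (simp only: integral_component_eq_cart[symmetric] component mollify_def conv_def)
  then have "T powr a * \<bar>mollify \<Phi> T (\<lambda>y. snd (y - z) $ i * g y) z\<bar>
      \<le> T powr a * infnorm (integral UNIV ?F)"
    using component_le_infnorm_cart[of "integral UNIV ?F" i] by (intro mult_left_mono) auto
  moreover have "T powr a * infnorm (integral UNIV ?F) \<le> A"
    using norm_le z T by (auto simp: wsupX_def SUP_le_iff)
  ultimately show "ereal (T powr a * \<bar>mollify \<Phi> T (\<lambda>y. snd (y - z) $ i * g y) z\<bar>) \<le> ereal A" by simp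
qed

lemma hoelder_imp_hoelder_le:
  assumes "hoelder \<alpha> f \<le> ereal A" shows "hoelder_le A \<alpha> f"
  unfolding hoelder_le_def
proof (intro allI)
  fix y z
  show "\<bar>f y - f z\<bar> \<le> A * pdist y z powr \<alpha>"
  proof (cases "y = z")
    case False
    then have "(y, z) \<in> {(z, w). z \<noteq> w}" by simp
    then have "ereal (\<bar>f (fst (y, z)) - f (snd (y, z))\<bar> / pdist (fst (y, z)) (snd (y, z)) powr \<alpha>)
        \<le> ereal A"
      by (rule order_trans[OF SUP_upper assms[unfolded hoelder_def]])
    then have "\<bar>f y - f z\<bar> / pdist y z powr \<alpha> \<le> A" by simp
    then show ?thesis using pdist_pos[OF False] by (simp add: divide_le_eq)
  qed simp
qed

section \<open>The blow-up point\<close>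

definition boundary_dist :: "pt \<Rightarrow> real" where
  "boundary_dist z = min (sqrt (fst z)) (1 - infnorm (snd z))"

lemma boundary_dist_PRset: "z \<in> PRset R \<Longrightarrow> 0 \<le> R \<Longrightarrow> R \<le> boundary_dist z"
  by (auto simp: PRset_def boundary_dist_def intro!: real_le_rsqrt)

lemma Pset_if_boundary_dist_pos: "0 < boundary_dist z \<Longrightarrow> fst z < 1 \<Longrightarrow> z \<in> Pset"
  by (auto simp: Pset_def boundary_dist_def split_beta)

lemma boundary_dist_past_cball:
  assumes z: "z \<in> past_cball p r" and r: "r \<le> boundary_dist p"
  shows "boundary_dist p - r \<le> boundary_dist z"
proof -
  have box: "0 \<le> r" "fst p - r\<^sup>2 \<le> fst z" "infnorm (snd z - snd p) \<le> r"
    using z by (auto simp: mem_past_cball_iff_box)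
  have "0 \<le> fst z"
    using r box sqrt_ge_absD[of r "fst p"] by (auto simp: boundary_dist_def)
  then have "sqrt (fst z + r\<^sup>2) \<le> sqrt (fst z) + r"
    using box sqrt_add_le_add_sqrt[of "fst z" "r\<^sup>2"] by simp
  moreover have "sqrt (fst p) \<le> sqrt (fst z + r\<^sup>2)" using box by simp
  ultimately have "sqrt (fst p) \<le> sqrt (fst z) + r" by linarith
  moreover have "infnorm (snd z) \<le> infnorm (snd p) + r"
    using box infnorm_triangle[of "snd z - snd p" "snd p"] by simp
  ultimately show ?thesis using box(1) by (auto simp: boundary_dist_def)
qed

text \<open>The point maximises \<open>\<bar>v\<bar>\<close> weighted with the distance to the boundary; capping the weight
  at \<open>R\<close> keeps \<open>\<bar>v p\<bar>\<close> from falling below \<open>\<bar>v z\<bar>\<close>.\<close>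

lemma doubling_point:
  assumes v: "continuous_on UNIV v" and R: "0 < R" and z: "z \<in> PRset R" and "v z \<noteq> 0"
  obtains p s where "0 < s" "\<bar>v z\<bar> \<le> \<bar>v p\<bar>" "\<bar>v z\<bar> * R \<le> \<bar>v p\<bar> * s" "past_cball p (s / 2) \<subseteq> Pset"
    "\<And>y. y \<in> past_cball p (s / 2) \<Longrightarrow> \<bar>v y\<bar> \<le> 2 * \<bar>v p\<bar>"
proof -
  define K where "K = {y::pt. 0 \<le> fst y \<and> fst y \<le> fst z \<and> infnorm (snd y) \<le> 1}"
  define d where "d = (\<lambda>y. min (boundary_dist y) R)"
  have "K = cbox (0, \<chi> i. - 1) (fst z, \<chi> i. 1)"
    unfolding K_def
    by (auto simp: cbox_Pair_eq mem_box_cart infnorm_le_iff_cart abs_le_iff minus_le_iff)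
  then have "compact K" by simp
  have z': "fst z < 1" "z \<in> K" "d z = R"
    using z R boundary_dist_PRset[OF z] order_trans[OF zero_le_power2[of R], of "fst z"]
    by (auto simp: PRset_def K_def d_def split_beta)
  have cont: "continuous_on K (\<lambda>y. \<bar>v y\<bar> * d y)"
    unfolding d_def boundary_dist_def
    by (intro continuous_intros continuous_on_subset[OF v]) auto
  have "K \<noteq> {}" using z'(2) by blast
  from continuous_attains_sup[OF \<open>compact K\<close> this cont]
  obtain p where p: "p \<in> K" and max: "\<And>y. y \<in> K \<Longrightarrow> \<bar>v y\<bar> * d y \<le> \<bar>v p\<bar> * d p" by blast
  have vz: "\<bar>v z\<bar> * R \<le> \<bar>v p\<bar> * d p" using max[OF z'(2)] z'(3) by simp
  moreover have "0 < \<bar>v z\<bar> * R" using R \<open>v z \<noteq> 0\<close> by simp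
  ultimately have "0 < \<bar>v p\<bar> * d p" by linarith
  then have pos: "0 < d p" by (auto simp: zero_less_mult_iff)
  have "\<bar>v p\<bar> * d p \<le> \<bar>v p\<bar> * R" by (intro mult_left_mono) (auto simp: d_def)
  then have vp: "\<bar>v z\<bar> \<le> \<bar>v p\<bar>" using vz R by (meson mult_le_cancel_right_pos order_trans)
  have half_ball: "y \<in> Pset \<and> \<bar>v y\<bar> \<le> 2 * \<bar>v p\<bar>" if y: "y \<in> past_cball p (d p / 2)" for y
  proof -
    have "boundary_dist p - d p / 2 \<le> boundary_dist y"
      by (rule boundary_dist_past_cball[OF y]) (use pos in \<open>auto simp: d_def\<close>)
    then have dist: "d p / 2 \<le> boundary_dist y" "d p / 2 \<le> d y" using pos by (auto simp: d_def)
    have "fst y \<le> fst z" using y p by (auto simp: mem_past_cball K_def)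
    then have in_sets: "y \<in> Pset" "y \<in> K"
      using dist(1) pos z'(1) Pset_if_boundary_dist_pos[of y]
      by (auto simp: K_def Pset_def split_beta)
    have "\<bar>v y\<bar> * (d p / 2) \<le> \<bar>v y\<bar> * d y" using dist by (intro mult_left_mono) auto
    also have "\<dots> \<le> 2 * \<bar>v p\<bar> * (d p / 2)" using max[OF in_sets(2)] by simp
    finally show ?thesis using in_sets(1) pos by (simp only: mult_le_cancel_right_pos half_gt_zero)
  qed
  show thesis by (rule that[OF pos vp vz]) (use half_ball in blast)+
qed

section \<open>The main bound\<close>

locale phi4_data =
  fixes \<Phi> :: "pt \<Rightarrow> real" and \<epsilon> :: real and \<zeta> \<tau>1 Y2 Y3 u :: "pt \<Rightarrow> real" and C1 C2 :: real
  assumes kernel: "kernel \<Phi>" and eps: "0 < \<epsilon>" "\<epsilon> < 1 / 100"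
    and smooth: "smooth \<tau>1" "smooth Y2" "smooth Y3" "smooth u"
    and heat_\<tau>1: "z \<in> Pset \<Longrightarrow> heat \<tau>1 z = \<zeta> z"
    and heat_Y2: "z \<in> Pset \<Longrightarrow> heat Y2 z = (\<tau>1 z)\<^sup>2 - C1"
    and heat_Y3: "z \<in> Pset \<Longrightarrow> heat Y3 z = \<tau>1 z ^ 3 - 3 * C1 * \<tau>1 z"
    and heat_u: "z \<in> Pset \<Longrightarrow> heat u z = - (u z ^ 3) + \<zeta> z + (3 * C1 - 9 * C2) * u z"
begin

abbreviation "\<tau>2 \<equiv> \<lambda>z. (\<tau>1 z)\<^sup>2 - C1"
abbreviation "\<tau>3 \<equiv> \<lambda>z. \<tau>1 z ^ 3 - 3 * C1 * \<tau>1 z"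
abbreviation "v \<equiv> \<lambda>z. u z - \<tau>1 z"

definition noise_sizes :: "ereal set" where
  "noise_sizes = (let e = (\<lambda>n::nat. 1 / (real n * (1 / 2 - \<epsilon>))) in
    {epow (negnorm \<Phi> (- 1 / 2 - \<epsilon>) \<tau>1) (e 1), epow (negnorm \<Phi> (- 1 - 2 * \<epsilon>) \<tau>2) (e 2),
     epow (negnorm \<Phi> (- 3 / 2 - 3 * \<epsilon>) \<tau>3) (e 3), epow (hoelder (1 - 2 * \<epsilon>) Y2) (e 2),
     epow (hoelder (1 / 2 - 3 * \<epsilon>) Y3) (e 3), epow (wsupX \<Phi> (2 * \<epsilon>) \<tau>2) (e 2),
     epow (wsup \<Phi> (4 * \<epsilon>) (\<lambda>x y. Y2 y * \<tau>2 y - C2 - Y2 x * \<tau>2 y)) (e 4),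
     epow (wsup \<Phi> (4 * \<epsilon>) (\<lambda>x y. Y3 y * \<tau>1 y - Y3 x * \<tau>1 y)) (e 4),
     epow (wsup \<Phi> (1 / 2 + 5 * \<epsilon>) (\<lambda>x y. Y3 y * \<tau>2 y - 3 * C2 * \<tau>1 y - Y3 x * \<tau>2 y)) (e 5)})"

lemma v_C12: "C12 v"
  by (intro C12_diff smooth_C12 smooth)

lemma heat_op_v:
  assumes z: "z \<in> Pset"
  shows "heat_op v z
    = - (v z ^ 3) - 3 * (v z)\<^sup>2 * \<tau>1 z - 3 * v z * \<tau>2 z - \<tau>3 z - 9 * C2 * (v z + \<tau>1 z)"
proof -
  have "heat_op v z = heat u z - heat \<tau>1 z"
    by (simp add: heat_op_diff smooth_C12 smooth smooth_heat_op)
  then show ?thesis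
    unfolding heat_u[OF z] heat_\<tau>1[OF z]
    by (simp add: algebra_simps power2_eq_square power3_eq_cube)
qed

context
  fixes X :: real
  assumes X: "0 < X" and sizes: "\<And>Q. Q \<in> noise_sizes \<Longrightarrow> Q \<le> ereal X"
begin

lemma norm_le_of_noise_size:
  assumes "epow Q (1 / (real n * (1 / 2 - \<epsilon>))) \<in> noise_sizes" "0 < n"
  shows "Q \<le> ereal (X powr (real n * (1 / 2 - \<epsilon>)))"
  by (rule epow_le_imp[OF sizes[OF assms(1)] _ X]) (use eps assms(2) in simp)

lemma noise_norms_le:
  "negnorm \<Phi> (- 1 / 2 - \<epsilon>) \<tau>1 \<le> ereal (X powr (real 1 * (1 / 2 - \<epsilon>)))"
  "negnorm \<Phi> (- 1 - 2 * \<epsilon>) \<tau>2 \<le> ereal (X powr (real 2 * (1 / 2 - \<epsilon>)))"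
  "negnorm \<Phi> (- 3 / 2 - 3 * \<epsilon>) \<tau>3 \<le> ereal (X powr (real 3 * (1 / 2 - \<epsilon>)))"
  "hoelder (1 - 2 * \<epsilon>) Y2 \<le> ereal (X powr (real 2 * (1 / 2 - \<epsilon>)))"
  "hoelder (1 / 2 - 3 * \<epsilon>) Y3 \<le> ereal (X powr (real 3 * (1 / 2 - \<epsilon>)))"
  "wsupX \<Phi> (2 * \<epsilon>) \<tau>2 \<le> ereal (X powr (real 2 * (1 / 2 - \<epsilon>)))"
  "wsup \<Phi> (4 * \<epsilon>) (\<lambda>x y. Y2 y * \<tau>2 y - C2 - Y2 x * \<tau>2 y) \<le> ereal (X powr (real 4 * (1 / 2 - \<epsilon>)))"
  "wsup \<Phi> (4 * \<epsilon>) (\<lambda>x y. Y3 y * \<tau>1 y - Y3 x * \<tau>1 y) \<le> ereal (X powr (real 4 * (1 / 2 - \<epsilon>)))"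
  "wsup \<Phi> (1 / 2 + 5 * \<epsilon>) (\<lambda>x y. Y3 y * \<tau>2 y - 3 * C2 * \<tau>1 y - Y3 x * \<tau>2 y)
    \<le> ereal (X powr (real 5 * (1 / 2 - \<epsilon>)))"
  by (rule norm_le_of_noise_size; simp add: noise_sizes_def Let_def)+

lemma phi4_solution_on_subset:
  assumes D: "D \<subseteq> Pset" and v: "\<And>z. z \<in> D \<Longrightarrow> \<bar>v z\<bar> \<le> m"
  shows "phi4_solution \<Phi> \<epsilon> D m X v Y2 Y3 \<tau>1 \<tau>2 \<tau>3 C2"
proof
  have cont: "continuous_on UNIV \<tau>1" by (intro smooth_continuous smooth)
  have cont_\<tau>2: "continuous_on UNIV \<tau>2" by (intro continuous_intros cont)
  note germ = germ_le_subset[OF _ D]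
  note products = algebra_simps fun_eq_iff
  show "kernel \<Phi>" "\<epsilon> \<le> 1 / 2" using kernel eps by auto
  show "C12 v" "C12 Y2" "C12 Y3" by (intro v_C12 smooth_C12 smooth)+
  show "continuous_on UNIV \<tau>1" "continuous_on UNIV \<tau>2" "continuous_on UNIV \<tau>3"
    by (intro continuous_intros cont)+
  show "heat_op v z = - (v z ^ 3) - 3 * (v z)\<^sup>2 * \<tau>1 z - 3 * v z * \<tau>2 z - \<tau>3 z
      - 9 * C2 * (v z + \<tau>1 z)" if "z \<in> D" for z using heat_op_v D that by blast
  show "heat_op Y2 z = \<tau>2 z" "heat_op Y3 z = \<tau>3 z" if "z \<in> D" for z
    using heat_Y2[of z] heat_Y3[of z] subsetD[OF D that] by (simp_all add: smooth_heat_op smooth)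
  show "\<bar>v z\<bar> \<le> m" if "z \<in> D" for z by (rule v[OF that])
  show "hoelder_le (X powr (2 * (1 / 2 - \<epsilon>))) (1 - 2 * \<epsilon>) Y2"
    "hoelder_le (X powr (3 * (1 / 2 - \<epsilon>))) (1 / 2 - 3 * \<epsilon>) Y3"
    using noise_norms_le(4,5)[THEN hoelder_imp_hoelder_le] by simp_all
  show "germ_le \<Phi> D (X powr (1 * (1 / 2 - \<epsilon>))) (- 1 / 2 - \<epsilon>) (\<lambda>_. \<tau>1)"
    "germ_le \<Phi> D (X powr (2 * (1 / 2 - \<epsilon>))) (- 1 - 2 * \<epsilon>) (\<lambda>_. \<tau>2)"
    "germ_le \<Phi> D (X powr (3 * (1 / 2 - \<epsilon>))) (- 3 / 2 - 3 * \<epsilon>) (\<lambda>_. \<tau>3)"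
    using noise_norms_le(1-3)[THEN negnorm_imp_germ_le, THEN germ] by simp_all
  show "germ_le \<Phi> D (X powr (2 * (1 / 2 - \<epsilon>))) (- 2 * \<epsilon>) (\<lambda>z y. snd (y - z) $ i * \<tau>2 y)" for i
    using wsupX_imp_germ_le[OF kernel cont_\<tau>2 noise_norms_le(6), THEN germ] by simp
  have "(\<lambda>z y. (Y2 y - Y2 z) * \<tau>2 y - C2) = (\<lambda>x y. Y2 y * \<tau>2 y - C2 - Y2 x * \<tau>2 y)"
    by (auto simp: products)
  with germ[OF wsup_imp_germ_le[OF noise_norms_le(7)]]
  show "germ_le \<Phi> D (X powr (4 * (1 / 2 - \<epsilon>))) (- 4 * \<epsilon>) (\<lambda>z y. (Y2 y - Y2 z) * \<tau>2 y - C2)" by simp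
  have "(\<lambda>z y. (Y3 y - Y3 z) * \<tau>1 y) = (\<lambda>x y. Y3 y * \<tau>1 y - Y3 x * \<tau>1 y)"
    by (auto simp: products)
  with germ[OF wsup_imp_germ_le[OF noise_norms_le(8)]]
  show "germ_le \<Phi> D (X powr (4 * (1 / 2 - \<epsilon>))) (- 4 * \<epsilon>) (\<lambda>z y. (Y3 y - Y3 z) * \<tau>1 y)" by simp
  have "(\<lambda>z y. (Y3 y - Y3 z) * \<tau>2 y - 3 * C2 * \<tau>1 y)
      = (\<lambda>x y. Y3 y * \<tau>2 y - 3 * C2 * \<tau>1 y - Y3 x * \<tau>2 y)" by (auto simp: products)
  with germ[OF wsup_imp_germ_le[OF noise_norms_le(9)]]
  show "germ_le \<Phi> D (X powr (5 * (1 / 2 - \<epsilon>))) (- 1 / 2 - 5 * \<epsilon>)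
      (\<lambda>z y. (Y3 y - Y3 z) * \<tau>2 y - 3 * C2 * \<tau>1 y)" by simp
qed

end

context
  fixes q\<^sub>0 :: real
  assumes threshold: "noise_threshold \<Phi> \<epsilon> q\<^sub>0"
begin

lemma v_le_noise:
  assumes R: "0 < R" "R < 1" and z: "z \<in> PRset R"
    and X: "1 / R \<le> X" "\<And>Q. Q \<in> noise_sizes \<Longrightarrow> Q \<le> ereal X"
  shows "\<bar>v z\<bar> \<le> max 34 (1 / q\<^sub>0) * X"
proof (rule ccontr)
  let ?K = "max 34 (1 / q\<^sub>0)"
  assume "\<not> \<bar>v z\<bar> \<le> ?K * X"
  then have large: "?K * X < \<bar>v z\<bar>" by simp
  have "0 < X" using R X(1) by (auto intro: less_le_trans[of _ "1 / R"])
  have "1 \<le> X * R" using R X(1) by (simp add: field_simps)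
  have "34 \<le> 34 * (X * R)" using \<open>1 \<le> X * R\<close> by simp
  also have "\<dots> \<le> ?K * X * R" using \<open>1 \<le> X * R\<close> by (simp add: mult.assoc mult_right_mono)
  also have "\<dots> \<le> \<bar>v z\<bar> * R" using large R by (intro mult_right_mono) auto
  finally have vzR: "34 \<le> \<bar>v z\<bar> * R" .
  then have "v z \<noteq> 0" by auto
  then obtain p s where s: "0 < s" and vp: "\<bar>v z\<bar> \<le> \<bar>v p\<bar>" "\<bar>v z\<bar> * R \<le> \<bar>v p\<bar> * s"
    and ball: "past_cball p (s / 2) \<subseteq> Pset" "\<And>y. y \<in> past_cball p (s / 2) \<Longrightarrow> \<bar>v y\<bar> \<le> 2 * \<bar>v p\<bar>"
    by (rule doubling_point[OF C12D(1)[OF v_C12] R(1) z]) blast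
  define M where "M = \<bar>v p\<bar>"
  have "\<bar>v z\<bar> * R \<le> \<bar>v z\<bar> * 1" using R by (intro mult_left_mono) auto
  then have M: "34 \<le> M" "34 \<le> M * s" using vzR vp by (auto simp: M_def)
  then have radius: "17 / M \<le> s / 2" by (simp add: field_simps)
  have sub: "past_cball p (17 / M) \<subseteq> past_cball p (s / 2)"
    using past_cball_mono[OF _ radius] by blast
  have "phi4_solution \<Phi> \<epsilon> (past_cball p (17 / M)) (2 * M) X v Y2 Y3 \<tau>1 \<tau>2 \<tau>3 C2"
    by (rule phi4_solution_on_subset[OF \<open>0 < X\<close> X(2)]) (use sub ball in \<open>auto simp: M_def\<close>)
  then interpret phi4_solution \<Phi> \<epsilon> "past_cball p (17 / M)" "2 * M" X v Y2 Y3 \<tau>1 \<tau>2 \<tau>3 C2 .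
  have "phi4_solution \<Phi> \<epsilon> (past_cball 0 17) 2 (1 / ?K) (\<lambda>z. 1 / M * v (p + dil (1 / M) z))
    (\<lambda>z. Y2 (p + dil (1 / M) z)) (\<lambda>z. 1 / M * Y3 (p + dil (1 / M) z))
    (\<lambda>z. 1 / M * \<tau>1 (p + dil (1 / M) z)) (\<lambda>z. (1 / M)\<^sup>2 * \<tau>2 (p + dil (1 / M) z))
    (\<lambda>z. (1 / M) ^ 3 * \<tau>3 (p + dil (1 / M) z)) ((1 / M)\<^sup>2 * C2)"
  proof (rule rescale)
    show "p + dil (1 / M) y \<in> past_cball p (17 / M)" if "y \<in> past_cball 0 17" for y
      using blow_up_in_past_cball[of "1 / M" p y 17] that M by simp
    have "?K * X \<le> M" using large vp by (simp add: M_def)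
    then show "1 / M * X \<le> 1 / ?K" using M by (simp add: field_simps)
  qed (use M \<open>0 < X\<close> in auto)
  moreover have "0 < 1 / ?K" "1 / ?K \<le> q\<^sub>0"
    using threshold by (simp_all add: noise_threshold_def field_simps max_def)
  ultimately have "\<bar>1 / M * v (p + dil (1 / M) 0)\<bar> < 1"
    using threshold unfolding noise_threshold_def by blast
  moreover have "\<bar>1 / M * v (p + dil (1 / M) 0)\<bar> = 1"
    using M(1) by (simp add: abs_mult M_def[symmetric])
  ultimately show False by linarith
qed

lemma SUP_v_le:
  assumes R: "0 < R" "R < 1"
  shows "(SUP z\<in>PRset R. ereal \<bar>v z\<bar>)
    \<le> ereal (max 34 (1 / q\<^sub>0)) * Max (insert (ereal (1 / R)) noise_sizes)"
proof -
  define K where "K = max 34 (1 / q\<^sub>0)"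
  let ?A = "insert (ereal (1 / R)) noise_sizes"
  have K: "0 < K" by (simp add: K_def less_max_iff_disj)
  have "finite ?A" by (simp add: noise_sizes_def Let_def)
  then have le_Max: "Q \<le> Max ?A" if "Q \<in> ?A" for Q using that by (rule Max_ge)
  then have ge: "ereal (1 / R) \<le> Max ?A" by simp
  have "(SUP z\<in>PRset R. ereal \<bar>v z\<bar>) \<le> ereal K * Max ?A"
  proof (cases "Max ?A")
    case (real X)
    have "\<bar>v z\<bar> \<le> K * X" if "z \<in> PRset R" for z
      unfolding K_def using v_le_noise[OF R that] le_Max ge real by auto
    then show ?thesis by (intro SUP_least) (simp add: real)
  next
    case PInf
    then show ?thesis using K by simp
  next
    case MInf
    then show ?thesis using ge by simp
  qed
  then show ?thesis by (simp only: K_def)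
qed

lemmas SUP_v_le_norms = SUP_v_le[unfolded noise_sizes_def Let_def]

end

end

theorem theorem2p1:
  fixes \<Phi> :: "pt \<Rightarrow> real"
  assumes "kernel \<Phi>"
  shows "\<exists>\<epsilon>0>0. \<forall>\<epsilon>. 0 < \<epsilon> \<and> \<epsilon> < \<epsilon>0 \<longrightarrow> (\<exists>C::real.
    \<forall>(\<zeta>::pt \<Rightarrow> real) (\<tau>1::pt \<Rightarrow> real) (Y2::pt \<Rightarrow> real) (Y3::pt \<Rightarrow> real) (u::pt \<Rightarrow> real) (C1::real) (C2::real).
      let \<tau>2 = (\<lambda>z. (\<tau>1 z)\<^sup>2 - C1);
          \<tau>3 = (\<lambda>z. (\<tau>1 z) ^ 3 - 3 * C1 * \<tau>1 z);
          v = (\<lambda>z. u z - \<tau>1 z);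
          Q1 = negnorm \<Phi> (-1/2 - \<epsilon>) \<tau>1;
          Q2 = negnorm \<Phi> (-1 - 2*\<epsilon>) \<tau>2;
          Q3 = negnorm \<Phi> (-3/2 - 3*\<epsilon>) \<tau>3;
          Q4 = hoelder (1 - 2*\<epsilon>) Y2;
          Q5 = hoelder (1/2 - 3*\<epsilon>) Y3;
          Q6 = wsupX \<Phi> (2*\<epsilon>) \<tau>2;
          Q7 = wsup \<Phi> (4*\<epsilon>) (\<lambda>x y. Y2 y * \<tau>2 y - C2 - Y2 x * \<tau>2 y);
          Q8 = wsup \<Phi> (4*\<epsilon>) (\<lambda>x y. Y3 y * \<tau>1 y - Y3 x * \<tau>1 y);
          Q9 = wsup \<Phi> (1/2 + 5*\<epsilon>) (\<lambda>x y. Y3 y * \<tau>2 y - 3 * C2 * \<tau>1 y - Y3 x * \<tau>2 y);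
          e = (\<lambda>n::nat. 1 / (real n * (1/2 - \<epsilon>)))
      in smooth \<zeta> \<longrightarrow> smooth \<tau>1 \<longrightarrow> smooth Y2 \<longrightarrow> smooth Y3 \<longrightarrow> smooth u \<longrightarrow>
         (\<forall>z\<in>Pset. heat \<tau>1 z = \<zeta> z) \<longrightarrow>
         (\<forall>z\<in>Pset. heat Y2 z = \<tau>2 z) \<longrightarrow>
         (\<forall>z\<in>Pset. heat Y3 z = \<tau>3 z) \<longrightarrow>
         (\<forall>z\<in>Pset. heat u z = - ((u z) ^ 3) + \<zeta> z + (3 * C1 - 9 * C2) * u z) \<longrightarrow>
         (\<forall>R. 0 < R \<and> R < 1 \<longrightarrow>
            (SUP z\<in>PRset R. ereal \<bar>v z\<bar>) \<le> ereal C * Max {ereal (1 / R),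
               epow Q1 (e 1), epow Q2 (e 2), epow Q3 (e 3), epow Q4 (e 2), epow Q5 (e 3),
               epow Q6 (e 2), epow Q7 (e 4), epow Q8 (e 4), epow Q9 (e 5)}))"
proof -
  have "\<exists>q\<^sub>0. noise_threshold \<Phi> \<epsilon> q\<^sub>0" if "0 < \<epsilon> \<and> \<epsilon> < 1 / 100" for \<epsilon>
    using noise_threshold_exists[OF assms] that by blast
  then obtain q\<^sub>0 where q\<^sub>0: "\<And>\<epsilon>. 0 < \<epsilon> \<and> \<epsilon> < 1 / 100 \<Longrightarrow> noise_threshold \<Phi> \<epsilon> (q\<^sub>0 \<epsilon>)" by metis
  show ?thesis
    unfolding Let_def
  proof (rule exI[of _ "1 / 100"], intro conjI allI impI, simp,
      rule exI[of _ "max 34 (1 / q\<^sub>0 \<epsilon>)" for \<epsilon>], intro allI impI, elim conjE,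
      rule phi4_data.SUP_v_le_norms)
    fix \<epsilon> C1 C2 :: real and \<zeta> \<tau>1 Y2 Y3 u :: "pt \<Rightarrow> real"
    assume \<epsilon>: "0 < \<epsilon>" "\<epsilon> < 1 / 100"
    then show "noise_threshold \<Phi> \<epsilon> (q\<^sub>0 \<epsilon>)" using q\<^sub>0 by blast
    assume "smooth \<tau>1" "smooth Y2" "smooth Y3" "smooth u"
      and "\<forall>z\<in>Pset. heat \<tau>1 z = \<zeta> z" "\<forall>z\<in>Pset. heat Y2 z = (\<tau>1 z)\<^sup>2 - C1"
        "\<forall>z\<in>Pset. heat Y3 z = \<tau>1 z ^ 3 - 3 * C1 * \<tau>1 z"
        "\<forall>z\<in>Pset. heat u z = - (u z ^ 3) + \<zeta> z + (3 * C1 - 9 * C2) * u z"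
    with \<epsilon> show "phi4_data \<Phi> \<epsilon> \<zeta> \<tau>1 Y2 Y3 u C1 C2" by (intro phi4_data.intro assms; blast)
  qed
qed

end
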